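(* Let $X_0$ be a random initial state independent of $\sigma(Y_n,\varepsilon_{n+1}\mid n\in\mathbb{N})$, let $X_{t+1}=f(X_t,Y_t,\varepsilon_{t+1})$, $t\in\mathbb{N}$, and assume that the iteration satisfies the coupling condition with some $x_0\in\mathcal{X}$, i.e. $b(n):=\sup_{j\in\mathbb{N}}\mathbb{P}(Z_{j,j+n}^{X_j}\neq Z_{j,j+n}^{x_0})\to 0$ as $n\to\infty$. Let $\Phi:\mathcal{X}\to\mathbb{R}$ be measurable such that $\mu_n=\mathbb{E}[\Phi(X_n)]$ exists and is finite for all $n\in\mathbb{N}$, and put $S_n=\sum_{k=1}^n(\Phi(X_k)-\mu_k)$, $n\ge 1$. Let $\tilde Y_n=(Y_n,\varepsilon_{n+1})$. Then: A) If $(\tilde Y_n)_{n\in\mathbb{N}}$ is strongly mixing (i.e. $\alpha^{\tilde Y}(n)\to0$) and $\sup_{n\in\mathbb{N}}\mathbb{E}|\Phi(X_n)|^p<\infty$ for some $p>1$, then $S_n/n\to 0$ in $L^1$ as $n\to\infty$. B) Assume that there exist $c>0$ and $r>2$ such that $\alpha^{\tilde Y}(n)+b(n)\le c\,n^{-\frac{r}{r-2}}$ for all $n\ge1$, and that for some $p$ with $r/2<p\le r<\infty$ one has $\sup_{n\in\mathbb{N}}\mathbb{E}|\Phi(X_n)|^p<\infty$. Then $S_n/n\to0$ almost surely as $n\to\infty$. C) If for some $r>2$, $\sup_{n\in\mathbb{N}}\mathbb{E}|\Phi(X_n)|^r<\infty$ and $$\sum_{k=0}^{\infty}(k+1)^2\left(\alpha^{\tilde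 Y}(k)^{\frac{r-2}{r+2}}+b(k)^{\frac{r-2}{r+2}}\right)<\infty,$$ then the distributions of $n^{-1/2}S_n$ and $\mathcal{N}(0,\mathrm{Var}(n^{-1/2}S_n))$ are weakly approaching, that is, for any bounded continuous $g:\mathbb{R}\to\mathbb{R}$, $$\mathbb{E}\left[g(n^{-1/2}S_n)\right]-\int_{\mathbb{R}}g\left(\mathrm{Var}(n^{-1/2}S_n)^{1/2}t\right)\frac{1}{\sqrt{2\pi}}e^{-t^2/2}\,dt\to0\quad\text{as }n\to\infty.$$ Furthermore, there exists $\sigma>0$ such that for any $a>0$, $$\limsup_{n\to\infty}\mathbb{P}(n^{-1/2}|S_n|\ge a)\le\int_{\mathbb{R}}\mathbf{1}_{[-a,a]^c}(\sigma t)\frac{1}{\sqrt{2\pi}}e^{-t^2/2}\,dt.$$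
   Context: $\mathbb{N}=\{0,1,2,\dots\}$. $\mathcal{X},\mathcal{Y}$ are complete separable metric spaces, $f:\mathcal{X}\times\mathcal{Y}\times[0,1]\to\mathcal{X}$ is measurable, $(Y_t)_{t\in\mathbb{N}}$ is a $\mathcal{Y}$-valued process and $(\varepsilon_t)_{t\ge 1}$ a $[0,1]$-valued process on a probability space $(\Omega,\mathcal{F},\mathbb{P})$ (no independence or stationarity of these is assumed). For $x\in\mathcal{X}$ (possibly random) and $s\in\mathbb N$: $Z_{s,t}^{x}=x$ if $t\le s$, and $Z_{s,t}^{x}=f(Z_{s,t-1}^{x},Y_{t-1},\varepsilon_t)$ if $t>s$. For sub-$\sigma$-algebras $\mathcal{G},\mathcal{H}\subset\mathcal{F}$, $\alpha(\mathcal{G},\mathcal{H})=\sup_{G\in\mathcal{G},H\in\mathcal{H}}|\mathbb{P}(G\cap H)-\mathbb{P}(G)\mathbb{P}(H)|$. For a process $(W_t)_{t\in\mathbb{N}}$ and $n\ge0$, $\alpha^W(n)=\sup_{j\in\mathbb{N}}\alpha\big(\sigma(W_k, 0\le k\le j),\sigma(W_k,k\ge j+n)\big)$. *)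

theory Defs
  imports "HOL-Probability.Probability"
begin

text \<open>
  A process is a function \<^term>\<open>W :: nat \<Rightarrow> 'w \<Rightarrow> 's\<close> on the sample space of a measure
  \<^term>\<open>M\<close>; a sub-sigma-algebra is given by its set of events.
\<close>

definition generated_events ::
    "'w measure \<Rightarrow> 's measure \<Rightarrow> (nat \<Rightarrow> 'w \<Rightarrow> 's) \<Rightarrow> nat set \<Rightarrow> 'w set set" where
  "generated_events M N W I =
     sigma_sets (space M) (\<Union>k\<in>I. {W k -` A \<inter> space M | A. A \<in> sets N})"

text \<open>
  The suprema of reals below are over nonempty bounded sets whenever \<^term>\<open>M\<close> is a probability
  measure, so they are genuine suprema.
\<close>

definition alpha_coeff :: "'w measure \<Rightarrow> 'w set set \<Rightarrow> 'w set set \<Rightarrow> real" where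
  "alpha_coeff M \<G> \<H> =
     (SUP (G, H)\<in>\<G> \<times> \<H>. \<bar>measure M (G \<inter> H) - measure M G * measure M H\<bar>)"

definition alpha_mixing ::
    "'w measure \<Rightarrow> 's measure \<Rightarrow> (nat \<Rightarrow> 'w \<Rightarrow> 's) \<Rightarrow> nat \<Rightarrow> real" where
  "alpha_mixing M N W n =
     (SUP j. alpha_coeff M (generated_events M N W {0..j}) (generated_events M N W {j + n..}))"

definition strongly_mixing ::
    "'w measure \<Rightarrow> 's measure \<Rightarrow> (nat \<Rightarrow> 'w \<Rightarrow> 's) \<Rightarrow> bool" where
  "strongly_mixing M N W \<longleftrightarrow> alpha_mixing M N W \<longlonglongrightarrow> 0"

text \<open>
  \<open>iter_from f Y \<epsilon> s x t\<close> is $Z_{s,t}^{x}$. The initial state is always a function on the sample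
  space; a deterministic state is a constant function. The value \<open>\<epsilon> 0\<close> is never used.
\<close>

primrec iter_from ::
    "('x \<Rightarrow> 'y \<Rightarrow> real \<Rightarrow> 'x) \<Rightarrow> (nat \<Rightarrow> 'w \<Rightarrow> 'y) \<Rightarrow> (nat \<Rightarrow> 'w \<Rightarrow> real) \<Rightarrow>
     nat \<Rightarrow> ('w \<Rightarrow> 'x) \<Rightarrow> nat \<Rightarrow> 'w \<Rightarrow> 'x" where
  "iter_from f Y \<epsilon> s x 0 = x"
| "iter_from f Y \<epsilon> s x (Suc t) =
     (if Suc t \<le> s then x else (\<lambda>\<omega>. f (iter_from f Y \<epsilon> s x t \<omega>) (Y t \<omega>) (\<epsilon> (Suc t) \<omega>)))"

definition coupling_coeff ::
    "'w measure \<Rightarrow> ('x \<Rightarrow> 'y \<Rightarrow> real \<Rightarrow> 'x) \<Rightarrow> (nat \<Rightarrow> 'w \<Rightarrow> 'y) \<Rightarrow> (nat \<Rightarrow> 'w \<Rightarrow> real) \<Rightarrow>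
     (nat \<Rightarrow> 'w \<Rightarrow> 'x) \<Rightarrow> 'x \<Rightarrow> nat \<Rightarrow> real" where
  "coupling_coeff M f Y \<epsilon> X x0 n =
     (SUP j. measure M {\<omega> \<in> space M.
        iter_from f Y \<epsilon> j (X j) (j + n) \<omega> \<noteq> iter_from f Y \<epsilon> j (\<lambda>_. x0) (j + n) \<omega>})"

definition centered_sum :: "'w measure \<Rightarrow> (nat \<Rightarrow> 'w \<Rightarrow> real) \<Rightarrow> nat \<Rightarrow> 'w \<Rightarrow> real" where
  "centered_sum M V n \<omega> = (\<Sum>k=1..n. V k \<omega> - (\<integral>\<omega>'. V k \<omega>' \<partial>M))"

text \<open>
  The condition $\sup_n E|V_n|^p < \infty$; it is stated with the nonnegative integral so that
  a non-integrable power counts as infinite rather than zero.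
\<close>

definition bounded_moments :: "'w measure \<Rightarrow> (nat \<Rightarrow> 'w \<Rightarrow> real) \<Rightarrow> real \<Rightarrow> bool" where
  "bounded_moments M V p \<longleftrightarrow> (SUP n. \<integral>\<^sup>+\<omega>. ennreal (\<bar>V n \<omega>\<bar> powr p) \<partial>M) < \<infinity>"

end

theory Submission
  imports Defs
begin

text \<open>
  Once \<open>X l\<close> coincides with the iteration restarted from \<open>x0\<close> at time \<open>s\<close>, the two agree forever, so
  up to an event of probability \<open>b (l - s)\<close> the future of \<open>X\<close> after time \<open>l\<close> is a function of the inputs
  after time \<open>s\<close>; its past is a function of \<open>X 0\<close> and of the past inputs, and \<open>X 0\<close> is integrated out by
  independence. Hence \<open>X\<close> is strongly mixing with rate \<open>\<alpha> (n div 2) + 2 * b (n div 2)\<close>.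

  For a mixing sequence, truncation and the bound \<open>4 * x * z * a\<close> on covariances of bounded variables control
  the variance of partial sums. This yields A) directly, and B) by Borel-Cantelli along \<open>k ^ m\<close> and
  monotonicity of the sums of positive and negative parts. For C), truncation at a fixed level changes
  \<open>S n / sqrt n\<close> little in mean square, uniformly in \<open>n\<close>. For bounded summands, cutting a window of
  length of order \<open>n powr \<beta>\<close> with \<open>\<beta> < 1/4\<close> around each index shows that the characteristic function \<open>\<phi>\<close> of
  \<open>S n / sqrt n\<close>, with variance \<open>v\<close>, nearly solves \<open>\<phi>' t = - v * t * \<phi> t\<close>, so it is close to \<open>exp (- v * t\<^sup>2 / 2)\<close>.
  Levy's theorem along subsequences with convergent \<open>v\<close> concludes.
\<close>

section \<open>Covariances of decoupled random variables\<close>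

text \<open>Without stationarity the variance of \<open>S n / sqrt n\<close> need not converge and
  may tend to 0, so there is no fixed limit law and no normalisation by the variance. The
  differential equation suits this: its integrating factor turns a defect \<open>d\<close> on
  \<open>[-T, T]\<close> into an error \<open>T * d\<close>, whatever the variance. Two demands fix
  the exponents in C). A window of length \<open>m\<close> leaves errors of order
  \<open>sqrt n * a m\<close> and \<open>m^2 / sqrt n\<close>; a rate \<open>a m\<close> of order
  \<open>m powr -\<theta>\<close> with \<open>\<theta> > 2\<close> leaves room between them. These
  errors grow with the truncation level, so the level must not move with \<open>n\<close>, and the
  truncation error must be small uniformly in \<open>n\<close>: this is what covariances decaying
  faster than \<open>lag^-2\<close> give. The weight \<open>(k + 1)^2\<close> yields the rate with
  \<open>\<theta> = 2 * (r + 2) / (r - 2)\<close>, and then covariances decay with exponent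
  \<open>\<theta> * (1 - 2 / r) = 2 + 4 / r\<close>. The number \<open>\<sigma>\<close> is not a
  limit of standard deviations: it is twice an upper bound for them, the factor paying for a
  continuous cutoff.\<close>

definition decoupled :: "'w measure \<Rightarrow> 'w measure \<Rightarrow> 'w measure \<Rightarrow> real \<Rightarrow> bool" where
  "decoupled M F G a \<longleftrightarrow> subalgebra M F \<and> subalgebra M G \<and>
     (\<forall>A\<in>sets F. \<forall>B\<in>sets G. \<bar>measure M (A \<inter> B) - measure M A * measure M B\<bar> \<le> a)"

lemma decoupledD:
  assumes "decoupled M F G a"
  shows "subalgebra M F" "subalgebra M G"
    "\<And>A B. A \<in> sets F \<Longrightarrow> B \<in> sets G \<Longrightarrow> \<bar>measure M (A \<inter> B) - measure M A * measure M B\<bar> \<le> a"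
  using assms by (auto simp: decoupled_def)

lemma decoupled_nonneg: "decoupled M F G a \<Longrightarrow> 0 \<le> a"
  using decoupledD(3)[of M F G a "{}" "{}"] by auto

text \<open>A layer-cake sum: exactly \<open>floor (N * x)\<close> of the thresholds
  \<open>i / N\<close> lie at or below \<open>x\<close>, and rounding \<open>N * x\<close> down
  costs at most 1. It turns a function with values in [0,1] into an average of indicators of its
  level sets.\<close>

lemma level_count:
  fixes x :: real
  assumes "0 \<le> x" "x \<le> 1" "N \<ge> 1"
  shows "\<bar>x - (\<Sum>i\<in>{1..N}. indicator {real i / real N..} x) / real N\<bar> \<le> 1 / real N"
proof -
  have "(\<Sum>i\<in>{1..N}. indicator {real i / real N..} x)
      = (\<Sum>i\<in>{1..N}. if i \<in> {i. real i / real N \<le> x} then 1 else (0::real))"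
    by (intro sum.cong) (auto simp: indicator_def)
  also have "\<dots> = (\<Sum>i\<in>{1..N} \<inter> {i. real i / real N \<le> x}. (1::real))"
    by (rule sum.inter_restrict[symmetric]) simp
  also have "{1..N} \<inter> {i. real i / real N \<le> x} = {1..nat \<lfloor>N * x\<rfloor>}"
  proof -
    have "real i / real N \<le> x \<longleftrightarrow> i \<le> nat \<lfloor>N * x\<rfloor>" if "i \<ge> 1" for i
      using assms that by (simp add: le_nat_iff le_floor_iff pos_divide_le_eq mult.commute)
    moreover have "nat \<lfloor>N * x\<rfloor> \<le> N"
    proof -
      have "N * x \<le> real N" using assms by (simp add: mult_left_le)
      then show ?thesis by (simp add: nat_le_iff floor_le_iff)
    qed
    ultimately show ?thesis by auto
  qed
  finally have *: "(\<Sum>i\<in>{1..N}. indicator {real i / real N..} x) = real (nat \<lfloor>N * x\<rfloor>)" by simp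
  have "real (nat \<lfloor>N * x\<rfloor>) = of_int \<lfloor>N * x\<rfloor>" using assms by simp
  then have "\<bar>N * x - real (nat \<lfloor>N * x\<rfloor>)\<bar> \<le> 1" by linarith
  then have "\<bar>N * x - real (nat \<lfloor>N * x\<rfloor>)\<bar> / N \<le> 1 / N"
    using assms by (simp add: divide_right_mono)
  moreover have "\<bar>N * x - real (nat \<lfloor>N * x\<rfloor>)\<bar> / N = \<bar>x - real (nat \<lfloor>N * x\<rfloor>) / N\<bar>"
    using assms by (simp add: abs_if field_simps)
  ultimately show ?thesis unfolding * by simp
qed

context prob_space
begin

lemma integrable_bounded:
  fixes X :: "'a \<Rightarrow> 'b::{banach, second_countable_topology}"
  assumes "X \<in> borel_measurable M" "\<And>\<omega>. \<omega> \<in> space M \<Longrightarrow> norm (X \<omega>) \<le> c"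
  shows "integrable M X"
  using assms by (intro integrable_const_bound[where B=c]) auto

lemma norm_expectation_le:
  fixes X :: "'a \<Rightarrow> 'b::{banach, second_countable_topology}"
  assumes "\<And>\<omega>. \<omega> \<in> space M \<Longrightarrow> norm (X \<omega>) \<le> c" "0 \<le> c"
  shows "norm (\<integral>\<omega>. X \<omega> \<partial>M) \<le> c"
proof (cases "integrable M X")
  case True
  have "norm (\<integral>\<omega>. X \<omega> \<partial>M) \<le> (\<integral>\<omega>. norm (X \<omega>) \<partial>M)" by simp
  also have "\<dots> \<le> (\<integral>\<omega>. c \<partial>M)" using True assms by (intro integral_mono) auto
  finally show ?thesis by (simp add: prob_space)
next
  case False
  then show ?thesis using assms by (simp add: not_integrable_integral_eq)
qed

text \<open>After discretisation both variables are averages of \<open>N\<close> indicators, so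
  their covariance is an average of \<open>N * N\<close> event covariances, each at most
  \<open>a\<close>. Replacing the variables by their discretisations costs \<open>2 / N\<close> in
  the mixed moment and \<open>2 / N\<close> in the product of means; then \<open>N\<close> tends to
  infinity.\<close>

lemma covariance_unit_interval:
  fixes X Z :: "'a \<Rightarrow> real"
  assumes d: "decoupled M F G a"
    and X: "X \<in> borel_measurable F" and Z: "Z \<in> borel_measurable G"
    and X01: "\<And>\<omega>. \<omega> \<in> space M \<Longrightarrow> 0 \<le> X \<omega> \<and> X \<omega> \<le> 1"
    and Z01: "\<And>\<omega>. \<omega> \<in> space M \<Longrightarrow> 0 \<le> Z \<omega> \<and> Z \<omega> \<le> 1"
  shows "\<bar>(\<integral>\<omega>. X \<omega> * Z \<omega> \<partial>M) - (\<integral>\<omega>. X \<omega> \<partial>M) * (\<integral>\<omega>. Z \<omega> \<partial>M)\<bar> \<le> a"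
proof -
  note sub = decoupledD(1,2)[OF d]
  have XM[measurable]: "X \<in> borel_measurable M" and ZM[measurable]: "Z \<in> borel_measurable M"
    using X Z sub by (auto intro: measurable_from_subalg)
  have "\<bar>(\<integral>\<omega>. X \<omega> * Z \<omega> \<partial>M) - (\<integral>\<omega>. X \<omega> \<partial>M) * (\<integral>\<omega>. Z \<omega> \<partial>M)\<bar> \<le> a + 4 / real N"
    if N: "N \<ge> 1" for N :: nat
  proof -
    define A where "A i = {\<omega>\<in>space M. real i / real N \<le> X \<omega>}" for i
    define B where "B i = {\<omega>\<in>space M. real i / real N \<le> Z \<omega>}" for i
    have AF: "A i \<in> sets F" for i
    proof -
      have "A i = {\<omega>\<in>space F. real i / real N \<le> X \<omega>}" using sub(1) by (simp add: A_def subalgebra_def)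
      also have "\<dots> \<in> sets F" using X by measurable
      finally show ?thesis .
    qed
    have BG: "B i \<in> sets G" for i
    proof -
      have "B i = {\<omega>\<in>space G. real i / real N \<le> Z \<omega>}" using sub(2) by (simp add: B_def subalgebra_def)
      also have "\<dots> \<in> sets G" using Z by measurable
      finally show ?thesis .
    qed
    have [measurable]: "A i \<in> sets M" "B i \<in> sets M" for i
      using AF BG sub unfolding subalgebra_def by auto
    define X' where "X' \<omega> = (\<Sum>i\<in>{1..N}. indicator (A i) \<omega>) / real N" for \<omega>
    define Z' where "Z' \<omega> = (\<Sum>i\<in>{1..N}. indicator (B i) \<omega>) / real N" for \<omega>
    have X'm[measurable]: "X' \<in> borel_measurable M" and Z'm[measurable]: "Z' \<in> borel_measurable M"
      unfolding X'_def Z'_def by measurable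
    have dX: "\<bar>X \<omega> - X' \<omega>\<bar> \<le> 1 / N" if "\<omega> \<in> space M" for \<omega>
      using level_count[of "X \<omega>" N] X01[OF that] N that by (simp add: X'_def A_def indicator_def)
    have dZ: "\<bar>Z \<omega> - Z' \<omega>\<bar> \<le> 1 / N" if "\<omega> \<in> space M" for \<omega>
      using level_count[of "Z \<omega>" N] Z01[OF that] N that by (simp add: Z'_def B_def indicator_def)
    have sum01: "0 \<le> (\<Sum>i\<in>{1..N}. indicator (C i) \<omega>) / real N \<and> (\<Sum>i\<in>{1..N}. indicator (C i) \<omega>) / real N \<le> (1::real)"
      for C and \<omega> :: 'a
    proof -
      have "(\<Sum>i\<in>{1..N}. indicator (C i) \<omega>) \<le> (\<Sum>i\<in>{1..N}. 1::real)"
        by (intro sum_mono) (auto simp: indicator_def)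
      then show ?thesis using N by (auto simp: divide_le_eq_1 intro!: sum_nonneg divide_nonneg_nonneg)
    qed
    have X'01: "0 \<le> X' \<omega>" "X' \<omega> \<le> 1" and Z'01: "0 \<le> Z' \<omega>" "Z' \<omega> \<le> 1" for \<omega>
      using sum01[of A \<omega>] sum01[of B \<omega>] by (auto simp: X'_def Z'_def)
    have iX: "integrable M X" "integrable M Z" "integrable M X'" "integrable M Z'"
      using X01 Z01 X'01 Z'01 by (auto intro!: integrable_bounded[where c=1])
    have iXZ: "integrable M (\<lambda>\<omega>. X \<omega> * Z \<omega>)" "integrable M (\<lambda>\<omega>. X' \<omega> * Z' \<omega>)"
      using X01 Z01 X'01 Z'01 by (auto intro!: integrable_bounded[where c=1] simp: abs_mult mult_le_one)
    have c0: "(\<integral>\<omega>. X' \<omega> * Z' \<omega> \<partial>M) = (\<Sum>i\<in>{1..N}. \<Sum>j\<in>{1..N}. prob (A i \<inter> B j)) / (real N * real N)"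
    proof -
      have "X' \<omega> * Z' \<omega> = (\<Sum>i\<in>{1..N}. \<Sum>j\<in>{1..N}. indicator (A i \<inter> B j) \<omega>) / (real N * real N)" for \<omega>
        by (simp add: X'_def Z'_def sum_product indicator_inter_arith)
      then have "(\<integral>\<omega>. X' \<omega> * Z' \<omega> \<partial>M)
          = (\<integral>\<omega>. (\<Sum>i\<in>{1..N}. \<Sum>j\<in>{1..N}. indicator (A i \<inter> B j) \<omega>) \<partial>M) / (real N * real N)" by simp
      also have "(\<integral>\<omega>. (\<Sum>i\<in>{1..N}. \<Sum>j\<in>{1..N}. indicator (A i \<inter> B j) \<omega>) \<partial>M)
          = (\<Sum>i\<in>{1..N}. \<Sum>j\<in>{1..N}. prob (A i \<inter> B j))"
      proof -
        have "integrable M (\<lambda>\<omega>. indicat_real (A i \<inter> B j) \<omega>)" for i j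
          by (intro integrable_real_indicator) (auto simp: emeasure_eq_measure)
        then show ?thesis
          by (subst Bochner_Integration.integral_sum Bochner_Integration.integrable_sum; auto intro!: sum.cong)
      qed
      finally show ?thesis .
    qed
    have c1: "(\<integral>\<omega>. X' \<omega> \<partial>M) * (\<integral>\<omega>. Z' \<omega> \<partial>M) = (\<Sum>i\<in>{1..N}. \<Sum>j\<in>{1..N}. prob (A i) * prob (B j)) / (real N * real N)"
    proof -
      have "integrable M (indicat_real (A i))" "integrable M (indicat_real (B i))" for i
        by (intro integrable_real_indicator; simp add: emeasure_eq_measure)+
      then have "(\<integral>\<omega>. (\<Sum>i\<in>{1..N}. indicat_real (A i) \<omega>) \<partial>M) = (\<Sum>i\<in>{1..N}. prob (A i))"
        "(\<integral>\<omega>. (\<Sum>i\<in>{1..N}. indicat_real (B i) \<omega>) \<partial>M) = (\<Sum>i\<in>{1..N}. prob (B i))"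
        by (subst Bochner_Integration.integral_sum; auto)+
      then show ?thesis by (simp add: X'_def Z'_def sum_product)
    qed
    have "\<bar>(\<integral>\<omega>. X' \<omega> * Z' \<omega> \<partial>M) - (\<integral>\<omega>. X' \<omega> \<partial>M) * (\<integral>\<omega>. Z' \<omega> \<partial>M)\<bar>
        = \<bar>\<Sum>i\<in>{1..N}. \<Sum>j\<in>{1..N}. prob (A i \<inter> B j) - prob (A i) * prob (B j)\<bar> / (real N * real N)"
      unfolding c0 c1 using N by (simp add: sum_subtractf diff_divide_distrib[symmetric])
    also have "\<dots> \<le> (\<Sum>i\<in>{1..N}. \<Sum>j\<in>{1..N}. a) / (real N * real N)"
      using decoupledD(3)[OF d AF BG]
      by (intro divide_right_mono order_trans[OF sum_abs] sum_mono) auto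
    also have "\<dots> = a" using N by simp
    finally have 1: "\<bar>(\<integral>\<omega>. X' \<omega> * Z' \<omega> \<partial>M) - (\<integral>\<omega>. X' \<omega> \<partial>M) * (\<integral>\<omega>. Z' \<omega> \<partial>M)\<bar> \<le> a" .
    have prod_diff: "\<bar>x * z - x' * z'\<bar> \<le> \<bar>x - x'\<bar> + \<bar>z - z'\<bar>"
      if "0 \<le> z" "z \<le> 1" "0 \<le> x'" "x' \<le> 1" for x z x' z' :: real
    proof -
      have "x * z - x' * z' = (x - x') * z + x' * (z - z')" by (simp add: algebra_simps)
      also have "\<bar>\<dots>\<bar> \<le> \<bar>x - x'\<bar> * z + x' * \<bar>z - z'\<bar>"
        using that by (intro order_trans[OF abs_triangle_ineq]) (simp add: abs_mult)
      also have "\<dots> \<le> \<bar>x - x'\<bar> * 1 + 1 * \<bar>z - z'\<bar>"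
        using that by (intro add_mono mult_left_mono mult_right_mono) auto
      finally show ?thesis by simp
    qed
    have 2: "\<bar>(\<integral>\<omega>. X \<omega> * Z \<omega> \<partial>M) - (\<integral>\<omega>. X' \<omega> * Z' \<omega> \<partial>M)\<bar> \<le> 2 / N"
    proof -
      have "norm (\<integral>\<omega>. X \<omega> * Z \<omega> - X' \<omega> * Z' \<omega> \<partial>M) \<le> 2 / N"
      proof (rule norm_expectation_le)
        fix \<omega> assume w: "\<omega> \<in> space M"
        show "norm (X \<omega> * Z \<omega> - X' \<omega> * Z' \<omega>) \<le> 2 / N"
          using prod_diff[of "Z \<omega>" "X' \<omega>" "X \<omega>" "Z' \<omega>"] Z01[OF w] X'01[of \<omega>] dX[OF w] dZ[OF w] by auto
      qed auto
      then show ?thesis using iXZ by simp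
    qed
    have 3: "\<bar>(\<integral>\<omega>. X \<omega> \<partial>M) * (\<integral>\<omega>. Z \<omega> \<partial>M) - (\<integral>\<omega>. X' \<omega> \<partial>M) * (\<integral>\<omega>. Z' \<omega> \<partial>M)\<bar> \<le> 2 / N"
    proof -
      have a: "norm (\<integral>\<omega>. X \<omega> - X' \<omega> \<partial>M) \<le> 1 / N" "norm (\<integral>\<omega>. Z \<omega> - Z' \<omega> \<partial>M) \<le> 1 / N"
        by (intro norm_expectation_le; use dX dZ in simp)+
      have b: "0 \<le> (\<integral>\<omega>. Z \<omega> \<partial>M)" "0 \<le> (\<integral>\<omega>. X' \<omega> \<partial>M)"
        using Z01 X'01 by (auto intro!: integral_nonneg_AE)
      have c: "norm (\<integral>\<omega>. Z \<omega> \<partial>M) \<le> 1" "norm (\<integral>\<omega>. X' \<omega> \<partial>M) \<le> 1"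
        by (intro norm_expectation_le; use Z01 X'01 in simp)+
      show ?thesis
        using prod_diff[of "\<integral>\<omega>. Z \<omega> \<partial>M" "\<integral>\<omega>. X' \<omega> \<partial>M" "\<integral>\<omega>. X \<omega> \<partial>M" "\<integral>\<omega>. Z' \<omega> \<partial>M"] a b c iX by auto
    qed
    show ?thesis using 1 2 3 by linarith
  qed
  moreover have "(\<lambda>N. a + 4 / real N) \<longlonglongrightarrow> a + 0"
    by (intro tendsto_intros lim_const_over_n)
  ultimately show ?thesis
    by (intro LIMSEQ_le_const[of "\<lambda>N. a + 4 / real N" a]) auto
qed

text \<open>The affine maps of [-x, x] and [-z, z] onto [0, 1] divide the covariance by
  \<open>2 * x * 2 * z\<close>, which is where the 4 comes from.\<close>

lemma covariance_bounded:
  fixes X Z :: "'a \<Rightarrow> real"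
  assumes d: "decoupled M F G a"
    and X: "X \<in> borel_measurable F" and Z: "Z \<in> borel_measurable G"
    and Xx: "\<And>\<omega>. \<omega> \<in> space M \<Longrightarrow> \<bar>X \<omega>\<bar> \<le> x"
    and Zz: "\<And>\<omega>. \<omega> \<in> space M \<Longrightarrow> \<bar>Z \<omega>\<bar> \<le> z"
  shows "\<bar>(\<integral>\<omega>. X \<omega> * Z \<omega> \<partial>M) - (\<integral>\<omega>. X \<omega> \<partial>M) * (\<integral>\<omega>. Z \<omega> \<partial>M)\<bar> \<le> 4 * x * z * a"
proof -
  note sub = decoupledD(1,2)[OF d]
  have XM[measurable]: "X \<in> borel_measurable M" and ZM[measurable]: "Z \<in> borel_measurable M"
    using X Z sub by (auto intro: measurable_from_subalg)
  obtain \<omega>0 where w0: "\<omega>0 \<in> space M" using not_empty by auto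
  have nn: "0 \<le> x" "0 \<le> z" using Xx[OF w0] Zz[OF w0] by auto
  have iX: "integrable M X" "integrable M Z"
    using Xx Zz by (auto intro!: integrable_bounded)
  have iXZ: "integrable M (\<lambda>\<omega>. X \<omega> * Z \<omega>)"
    using Xx Zz nn by (intro integrable_bounded[where c="x * z"]) (auto simp: abs_mult intro!: mult_mono)
  show ?thesis
  \<comment> \<open>A zero bound is split off because the rescaling divides by \<open>x\<close> and
    \<open>z\<close>; one variable then vanishes and both sides are 0.\<close>
  proof (cases "x = 0 \<or> z = 0")
    case True
    then have "(\<forall>\<omega>\<in>space M. X \<omega> = 0) \<or> (\<forall>\<omega>\<in>space M. Z \<omega> = 0)" using Xx Zz by force
    then have "(\<integral>\<omega>. X \<omega> * Z \<omega> \<partial>M) = 0" "(\<integral>\<omega>. X \<omega> \<partial>M) = 0 \<or> (\<integral>\<omega>. Z \<omega> \<partial>M) = 0"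
      by (auto cong: Bochner_Integration.integral_cong)
    then show ?thesis using True by auto
  next
    case False
    with nn have p: "0 < x" "0 < z" by auto
    define X' where "X' \<omega> = (X \<omega> + x) / (2 * x)" for \<omega>
    define Z' where "Z' \<omega> = (Z \<omega> + z) / (2 * z)" for \<omega>
    have [measurable]: "X' \<in> borel_measurable F" "Z' \<in> borel_measurable G"
      unfolding X'_def Z'_def using X Z by measurable
    have "\<bar>(\<integral>\<omega>. X' \<omega> * Z' \<omega> \<partial>M) - (\<integral>\<omega>. X' \<omega> \<partial>M) * (\<integral>\<omega>. Z' \<omega> \<partial>M)\<bar> \<le> a"
    proof (rule covariance_unit_interval[OF d])
      fix \<omega> assume w: "\<omega> \<in> space M"
      show "0 \<le> X' \<omega> \<and> X' \<omega> \<le> 1" "0 \<le> Z' \<omega> \<and> Z' \<omega> \<le> 1"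
        using Xx[OF w] Zz[OF w] p by (auto simp: X'_def Z'_def field_simps)
    qed auto
    moreover have "(\<integral>\<omega>. X' \<omega> \<partial>M) = ((\<integral>\<omega>. X \<omega> \<partial>M) + x) / (2 * x)"
      "(\<integral>\<omega>. Z' \<omega> \<partial>M) = ((\<integral>\<omega>. Z \<omega> \<partial>M) + z) / (2 * z)"
      unfolding X'_def Z'_def using iX by (auto simp: prob_space)
    moreover have "(\<integral>\<omega>. X' \<omega> * Z' \<omega> \<partial>M)
        = ((\<integral>\<omega>. X \<omega> * Z \<omega> \<partial>M) + x * (\<integral>\<omega>. Z \<omega> \<partial>M) + z * (\<integral>\<omega>. X \<omega> \<partial>M) + x * z) / (4 * x * z)"
    proof -
      have "X' \<omega> * Z' \<omega> = (X \<omega> * Z \<omega> + x * Z \<omega> + z * X \<omega> + x * z) / (4 * x * z)" for \<omega>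
        unfolding X'_def Z'_def using p by (simp add: field_simps)
      then show ?thesis using iX iXZ by (simp add: prob_space)
    qed
    ultimately have "\<bar>((\<integral>\<omega>. X \<omega> * Z \<omega> \<partial>M) + x * (\<integral>\<omega>. Z \<omega> \<partial>M) + z * (\<integral>\<omega>. X \<omega> \<partial>M) + x * z) / (4 * x * z)
        - ((\<integral>\<omega>. X \<omega> \<partial>M) + x) / (2 * x) * (((\<integral>\<omega>. Z \<omega> \<partial>M) + z) / (2 * z))\<bar> \<le> a" by simp
    also have "((\<integral>\<omega>. X \<omega> * Z \<omega> \<partial>M) + x * (\<integral>\<omega>. Z \<omega> \<partial>M) + z * (\<integral>\<omega>. X \<omega> \<partial>M) + x * z) / (4 * x * z)
        - ((\<integral>\<omega>. X \<omega> \<partial>M) + x) / (2 * x) * (((\<integral>\<omega>. Z \<omega> \<partial>M) + z) / (2 * z))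
        = ((\<integral>\<omega>. X \<omega> * Z \<omega> \<partial>M) - (\<integral>\<omega>. X \<omega> \<partial>M) * (\<integral>\<omega>. Z \<omega> \<partial>M)) / (4 * x * z)"
      using p by (simp add: field_simps)
    finally show ?thesis using p by (simp add: abs_mult pos_divide_le_eq mult.commute mult.left_commute)
  qed
qed

text \<open>Real and imaginary part of the covariance are each a combination of two real covariances
  bounded by \<open>4 * x * z * a\<close>; adding all four gives the 16.\<close>

lemma covariance_complex:
  fixes X Z :: "'a \<Rightarrow> complex"
  assumes d: "decoupled M F G a"
    and X: "X \<in> borel_measurable F" and Z: "Z \<in> borel_measurable G"
    and Xx: "\<And>\<omega>. \<omega> \<in> space M \<Longrightarrow> norm (X \<omega>) \<le> x"
    and Zz: "\<And>\<omega>. \<omega> \<in> space M \<Longrightarrow> norm (Z \<omega>) \<le> z"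
  shows "norm ((\<integral>\<omega>. X \<omega> * Z \<omega> \<partial>M) - (\<integral>\<omega>. X \<omega> \<partial>M) * (\<integral>\<omega>. Z \<omega> \<partial>M)) \<le> 16 * x * z * a"
proof -
  note sub = decoupledD(1,2)[OF d]
  have XM[measurable]: "X \<in> borel_measurable M" and ZM[measurable]: "Z \<in> borel_measurable M"
    using X Z sub by (auto intro: measurable_from_subalg)
  obtain \<omega>0 where w0: "\<omega>0 \<in> space M" using not_empty by auto
  have nn: "0 \<le> x" "0 \<le> z" using order_trans[OF norm_ge_zero Xx[OF w0]] order_trans[OF norm_ge_zero Zz[OF w0]] by auto
  have iX: "integrable M X" "integrable M Z"
    using Xx Zz by (auto intro!: integrable_bounded)
  have iXZ: "integrable M (\<lambda>\<omega>. X \<omega> * Z \<omega>)"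
    using Xx Zz nn by (intro integrable_bounded[where c="x * z"]) (auto simp: norm_mult intro!: mult_mono)
  define c where "c f g = (\<integral>\<omega>. f \<omega> * g \<omega> \<partial>M) - (\<integral>\<omega>. f \<omega> \<partial>M) * (\<integral>\<omega>. g \<omega> \<partial>M)" for f g :: "'a \<Rightarrow> real"
  have XF: "(\<lambda>\<omega>. Re (X \<omega>)) \<in> borel_measurable F" "(\<lambda>\<omega>. Im (X \<omega>)) \<in> borel_measurable F"
    using X by measurable
  have ZG: "(\<lambda>\<omega>. Re (Z \<omega>)) \<in> borel_measurable G" "(\<lambda>\<omega>. Im (Z \<omega>)) \<in> borel_measurable G"
    using Z by measurable
  have Xb: "\<omega> \<in> space M \<Longrightarrow> \<bar>Re (X \<omega>)\<bar> \<le> x" "\<omega> \<in> space M \<Longrightarrow> \<bar>Im (X \<omega>)\<bar> \<le> x"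
    and Zb: "\<omega> \<in> space M \<Longrightarrow> \<bar>Re (Z \<omega>)\<bar> \<le> z" "\<omega> \<in> space M \<Longrightarrow> \<bar>Im (Z \<omega>)\<bar> \<le> z" for \<omega>
    using abs_Re_le_cmod abs_Im_le_cmod Xx Zz order_trans by blast+
  note cb = covariance_bounded[OF d, folded c_def]
  have b: "\<bar>c (\<lambda>\<omega>. Re (X \<omega>)) (\<lambda>\<omega>. Re (Z \<omega>))\<bar> \<le> 4 * x * z * a"
     "\<bar>c (\<lambda>\<omega>. Im (X \<omega>)) (\<lambda>\<omega>. Im (Z \<omega>))\<bar> \<le> 4 * x * z * a"
     "\<bar>c (\<lambda>\<omega>. Re (X \<omega>)) (\<lambda>\<omega>. Im (Z \<omega>))\<bar> \<le> 4 * x * z * a"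
     "\<bar>c (\<lambda>\<omega>. Im (X \<omega>)) (\<lambda>\<omega>. Re (Z \<omega>))\<bar> \<le> 4 * x * z * a"
    by (intro cb XF ZG Xb Zb; simp)+
  have ii: "integrable M (\<lambda>\<omega>. Re (X \<omega>) * Re (Z \<omega>))" "integrable M (\<lambda>\<omega>. Im (X \<omega>) * Im (Z \<omega>))"
    "integrable M (\<lambda>\<omega>. Re (X \<omega>) * Im (Z \<omega>))" "integrable M (\<lambda>\<omega>. Im (X \<omega>) * Re (Z \<omega>))"
    by (intro integrable_bounded[where c="x * z"], measurable, simp add: abs_mult mult_mono Xb Zb nn)+
  define D where "D = (\<integral>\<omega>. X \<omega> * Z \<omega> \<partial>M) - (\<integral>\<omega>. X \<omega> \<partial>M) * (\<integral>\<omega>. Z \<omega> \<partial>M)"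
  have "Re D = c (\<lambda>\<omega>. Re (X \<omega>)) (\<lambda>\<omega>. Re (Z \<omega>)) - c (\<lambda>\<omega>. Im (X \<omega>)) (\<lambda>\<omega>. Im (Z \<omega>))"
    "Im D = c (\<lambda>\<omega>. Re (X \<omega>)) (\<lambda>\<omega>. Im (Z \<omega>)) + c (\<lambda>\<omega>. Im (X \<omega>)) (\<lambda>\<omega>. Re (Z \<omega>))"
  proof -
    have "Re (\<integral>\<omega>. X \<omega> * Z \<omega> \<partial>M) = (\<integral>\<omega>. Re (X \<omega>) * Re (Z \<omega>) \<partial>M) - (\<integral>\<omega>. Im (X \<omega>) * Im (Z \<omega>) \<partial>M)"
      "Im (\<integral>\<omega>. X \<omega> * Z \<omega> \<partial>M) = (\<integral>\<omega>. Re (X \<omega>) * Im (Z \<omega>) \<partial>M) + (\<integral>\<omega>. Im (X \<omega>) * Re (Z \<omega>) \<partial>M)"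
      using ii by (simp_all add: integral_Re[OF iXZ, symmetric] integral_Im[OF iXZ, symmetric])
    then show "Re D = c (\<lambda>\<omega>. Re (X \<omega>)) (\<lambda>\<omega>. Re (Z \<omega>)) - c (\<lambda>\<omega>. Im (X \<omega>)) (\<lambda>\<omega>. Im (Z \<omega>))"
      "Im D = c (\<lambda>\<omega>. Re (X \<omega>)) (\<lambda>\<omega>. Im (Z \<omega>)) + c (\<lambda>\<omega>. Im (X \<omega>)) (\<lambda>\<omega>. Re (Z \<omega>))"
      unfolding D_def c_def using iX by simp_all
  qed
  then show ?thesis
    using cmod_le[of D] b unfolding D_def[symmetric] by linarith
qed

end

section \<open>Mixing sequences\<close>

text \<open>The events of \<open>generated_events\<close> packaged as a measure, so that
  measurability with respect to a stretch of the process can be stated with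
  \<open>borel_measurable\<close>.\<close>

definition proc_algebra :: "'w measure \<Rightarrow> 's measure \<Rightarrow> (nat \<Rightarrow> 'w \<Rightarrow> 's) \<Rightarrow> nat set \<Rightarrow> 'w measure" where
  "proc_algebra M N W I = sigma (space M) (\<Union>k\<in>I. {W k -` A \<inter> space M | A. A \<in> sets N})"

lemma space_proc_algebra [simp]: "space (proc_algebra M N W I) = space M"
  by (simp add: proc_algebra_def space_measure_of_conv)

lemma sets_proc_algebra: "sets (proc_algebra M N W I) = generated_events M N W I"
  unfolding proc_algebra_def generated_events_def by (rule sets_measure_of) auto

lemma measurable_proc_algebra:
  assumes "k \<in> I" "W k \<in> space M \<rightarrow> space N"
  shows "W k \<in> proc_algebra M N W I \<rightarrow>\<^sub>M N"
proof (rule measurableI)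
  fix A assume "A \<in> sets N"
  then show "W k -` A \<inter> space (proc_algebra M N W I) \<in> sets (proc_algebra M N W I)"
    using assms(1) unfolding sets_proc_algebra generated_events_def by (auto intro!: sigma_sets.Basic)
qed (use assms(2) in auto)

lemma sets_proc_algebra_subset:
  assumes "space F = space M" "\<And>k. k \<in> I \<Longrightarrow> W k \<in> F \<rightarrow>\<^sub>M N"
  shows "sets (proc_algebra M N W I) \<subseteq> sets F"
proof -
  have "sigma_sets (space F) (\<Union>k\<in>I. {W k -` A \<inter> space F | A. A \<in> sets N}) \<subseteq> sets F"
    by (rule sets.sigma_sets_subset) (auto intro!: measurable_sets[OF assms(2)])
  then show ?thesis by (simp add: sets_proc_algebra generated_events_def assms(1))
qed

lemma subalgebra_proc_algebra:
  assumes "\<And>k. k \<in> I \<Longrightarrow> W k \<in> M \<rightarrow>\<^sub>M N"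
  shows "subalgebra M (proc_algebra M N W I)"
  using sets_proc_algebra_subset[of M M I W N] assms by (auto simp: subalgebra_def)

lemma decoupled_mono:
  assumes "decoupled M F G a" "sets F' \<subseteq> sets F" "sets G' \<subseteq> sets G" "space F' = space M" "space G' = space M"
    and "a \<le> b"
  shows "decoupled M F' G' b"
  unfolding decoupled_def subalgebra_def
proof (intro conjI ballI)
  show "sets F' \<subseteq> sets M" "sets G' \<subseteq> sets M"
    using assms decoupledD(1,2)[OF assms(1)] by (auto simp: subalgebra_def)
  fix A B assume "A \<in> sets F'" "B \<in> sets G'"
  then show "\<bar>measure M (A \<inter> B) - measure M A * measure M B\<bar> \<le> b"
    using decoupledD(3)[OF assms(1), of A B] assms(2,3,6) by (meson subsetD order_trans)
qed (use assms in auto)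

text \<open>The distance of the two indices: with subtraction cut off at 0, at least one of the
  summands vanishes.\<close>

definition lag :: "nat \<Rightarrow> nat \<Rightarrow> nat" where "lag i j = (i - j) + (j - i)"

text \<open>Each lag occurs at most twice, once on either side of \<open>i\<close>, which explains
  the factor 2.\<close>

lemma lag_sum_le:
  fixes c :: "nat \<Rightarrow> real"
  assumes c: "\<And>k. 0 \<le> c k" and i: "i \<in> {1..n}"
  shows "(\<Sum>j\<in>{1..n}. c (lag i j)) \<le> 2 * (\<Sum>k<n. c k)"
proof -
  have "(\<Sum>j\<in>{1..n}. c (lag i j)) = (\<Sum>j\<in>{1..i}. c (lag i j)) + (\<Sum>j\<in>{i<..n}. c (lag i j))"
    using i by (subst sum.union_disjoint[symmetric]) (auto intro!: sum.cong)
  also have "(\<Sum>j\<in>{1..i}. c (lag i j)) = (\<Sum>j\<in>{1..i}. c (i - j))"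
    by (intro sum.cong) (auto simp: lag_def)
  also have "\<dots> = (\<Sum>k\<in>(\<lambda>j. i - j) ` {1..i}. c k)"
    by (subst sum.reindex) (auto simp: inj_on_def)
  also have "\<dots> \<le> (\<Sum>k<n. c k)"
    using i c by (intro sum_mono2) auto
  also have "(\<Sum>j\<in>{i<..n}. c (lag i j)) = (\<Sum>j\<in>{i<..n}. c (j - i))"
    by (intro sum.cong) (auto simp: lag_def)
  also have "\<dots> = (\<Sum>k\<in>(\<lambda>j. j - i) ` {i<..n}. c k)"
    by (subst sum.reindex) (auto simp: inj_on_def)
  also have "\<dots> \<le> (\<Sum>k<n. c k)"
    using i c by (intro sum_mono2) auto
  finally show ?thesis by simp
qed

lemma lag_double_sum_le:
  fixes c :: "nat \<Rightarrow> real"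
  assumes c: "\<And>k. 0 \<le> c k"
  shows "(\<Sum>i\<in>{1..n}. \<Sum>j\<in>{1..n}. c (lag i j)) \<le> 2 * real n * (\<Sum>k<n. c k)"
proof -
  have "(\<Sum>i\<in>{1..n}. \<Sum>j\<in>{1..n}. c (lag i j)) \<le> (\<Sum>i\<in>{1..n}. 2 * (\<Sum>k<n. c k))"
    by (intro sum_mono lag_sum_le c)
  then show ?thesis by simp
qed

lemma lag_double_sum_le_suminf:
  fixes c :: "nat \<Rightarrow> real"
  assumes c: "\<And>k. 0 \<le> c k" and "summable c"
  shows "(\<Sum>i\<in>{1..n}. \<Sum>j\<in>{1..n}. c (lag i j)) \<le> 2 * real n * (\<Sum>k. c k)"
proof -
  have "(\<Sum>k<n. c k) \<le> (\<Sum>k. c k)" using assms by (intro sum_le_suminf) auto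
  then have "2 * real n * (\<Sum>k<n. c k) \<le> 2 * real n * (\<Sum>k. c k)"
    by (intro mult_left_mono) auto
  then show ?thesis using lag_double_sum_le[of c n, OF c] by linarith
qed

section \<open>Covariances and variances of centered sums\<close>

lemma abs_mult_le_squares: "\<bar>x * z\<bar> \<le> (x\<^sup>2 + z\<^sup>2) / 2" for x z :: real
  using sum_squares_bound[of "\<bar>x\<bar>" "\<bar>z\<bar>"] by (simp add: abs_mult)

context prob_space
begin

definition covar :: "('a \<Rightarrow> real) \<Rightarrow> ('a \<Rightarrow> real) \<Rightarrow> real" where
  "covar X Z = (\<integral>\<omega>. X \<omega> * Z \<omega> \<partial>M) - (\<integral>\<omega>. X \<omega> \<partial>M) * (\<integral>\<omega>. Z \<omega> \<partial>M)"

lemma integrable_product_if_squares: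
  fixes X Z :: "'a \<Rightarrow> real"
  assumes [measurable]: "X \<in> borel_measurable M" "Z \<in> borel_measurable M"
    and "integrable M (\<lambda>\<omega>. (X \<omega>)\<^sup>2)" "integrable M (\<lambda>\<omega>. (Z \<omega>)\<^sup>2)"
  shows "integrable M (\<lambda>\<omega>. X \<omega> * Z \<omega>)"
proof (rule Bochner_Integration.integrable_bound[where f="\<lambda>\<omega>. ((X \<omega>)\<^sup>2 + (Z \<omega>)\<^sup>2) / 2"])
  show "AE \<omega> in M. norm (X \<omega> * Z \<omega>) \<le> norm (((X \<omega>)\<^sup>2 + (Z \<omega>)\<^sup>2) / 2)"
    unfolding real_norm_def
    by (intro always_eventually allI order_trans[OF abs_mult_le_squares abs_ge_self])
qed (use assms in auto)

lemma covar_centered: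
  fixes X Z :: "'a \<Rightarrow> real"
  assumes [measurable]: "X \<in> borel_measurable M" "Z \<in> borel_measurable M"
    and sq: "integrable M (\<lambda>\<omega>. (X \<omega>)\<^sup>2)" "integrable M (\<lambda>\<omega>. (Z \<omega>)\<^sup>2)"
  shows "(\<integral>\<omega>. (X \<omega> - x) * (Z \<omega> - z) \<partial>M) = covar X Z + (expectation X - x) * (expectation Z - z)"
    and "integrable M (\<lambda>\<omega>. (X \<omega> - x) * (Z \<omega> - z))"
proof -
  note i = integrable_product_if_squares[OF assms] square_integrable_imp_integrable[OF assms(1,3)] square_integrable_imp_integrable[OF assms(2,4)]
  have "(X \<omega> - x) * (Z \<omega> - z) = X \<omega> * Z \<omega> - x * Z \<omega> - z * X \<omega> + x * z" for \<omega>
    by (simp add: algebra_simps)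
  then show "(\<integral>\<omega>. (X \<omega> - x) * (Z \<omega> - z) \<partial>M) = covar X Z + (expectation X - x) * (expectation Z - z)"
      "integrable M (\<lambda>\<omega>. (X \<omega> - x) * (Z \<omega> - z))"
    using i by (auto simp: covar_def prob_space algebra_simps)
qed

lemma square_centered_sum:
  "(centered_sum M V n \<omega>)\<^sup>2 = (\<Sum>i\<in>{1..n}. \<Sum>j\<in>{1..n}. (V i \<omega> - expectation (V i)) * (V j \<omega> - expectation (V j)))"
  by (simp add: centered_sum_def power2_eq_square sum_product)

lemma centered_sum_measurable [measurable]:
  "(\<And>k. V k \<in> borel_measurable M) \<Longrightarrow> centered_sum M V n \<in> borel_measurable M"
  unfolding centered_sum_def[abs_def]
  by (intro borel_measurable_sum borel_measurable_diff borel_measurable_const)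

lemma centered_sum_variance:
  assumes [measurable]: "\<And>k. V k \<in> borel_measurable M" and sq: "\<And>k. integrable M (\<lambda>\<omega>. (V k \<omega>)\<^sup>2)"
  shows "integrable M (\<lambda>\<omega>. (centered_sum M V n \<omega>)\<^sup>2)"
    "(\<integral>\<omega>. (centered_sum M V n \<omega>)\<^sup>2 \<partial>M) = (\<Sum>i\<in>{1..n}. \<Sum>j\<in>{1..n}. covar (V i) (V j))"
proof -
  have i: "integrable M (\<lambda>\<omega>. (V i \<omega> - expectation (V i)) * (V j \<omega> - expectation (V j)))" for i j
    by (rule covar_centered(2)) (use sq in auto)
  have e: "(\<integral>\<omega>. (V i \<omega> - expectation (V i)) * (V j \<omega> - expectation (V j)) \<partial>M) = covar (V i) (V j)" for i j
    using covar_centered(1)[of "V i" "V j" "expectation (V i)" "expectation (V j)"] sq by simp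
  show "integrable M (\<lambda>\<omega>. (centered_sum M V n \<omega>)\<^sup>2)"
    unfolding square_centered_sum using i by auto
  show "(\<integral>\<omega>. (centered_sum M V n \<omega>)\<^sup>2 \<partial>M) = (\<Sum>i\<in>{1..n}. \<Sum>j\<in>{1..n}. covar (V i) (V j))"
    unfolding square_centered_sum using i e by (simp add: Bochner_Integration.integral_sum)
qed

text \<open>The inequality between arithmetic and geometric mean stands in for Cauchy-Schwarz; no
  constant is lost because both second moments share the bound \<open>B\<close> and centering only
  decreases them.\<close>

lemma covar_le_second_moments:
  fixes X Z :: "'a \<Rightarrow> real"
  assumes [measurable]: "X \<in> borel_measurable M" "Z \<in> borel_measurable M"
    and sq: "integrable M (\<lambda>\<omega>. (X \<omega>)\<^sup>2)" "integrable M (\<lambda>\<omega>. (Z \<omega>)\<^sup>2)"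
    and b: "(\<integral>\<omega>. (X \<omega>)\<^sup>2 \<partial>M) \<le> B" "(\<integral>\<omega>. (Z \<omega>)\<^sup>2 \<partial>M) \<le> B"
  shows "\<bar>covar X Z\<bar> \<le> B"
proof -
  define x z where "x = expectation X" and "z = expectation Z"
  note i = square_integrable_imp_integrable[OF assms(1,3)] square_integrable_imp_integrable[OF assms(2,4)]
  have vx: "integrable M (\<lambda>\<omega>. (X \<omega> - x)\<^sup>2)" and vz: "integrable M (\<lambda>\<omega>. (Z \<omega> - z)\<^sup>2)"
    using covar_centered(2)[of X X x x] covar_centered(2)[of Z Z z z] sq by (simp_all add: power2_eq_square)
  have "(\<integral>\<omega>. (X \<omega> - x)\<^sup>2 \<partial>M) = (\<integral>\<omega>. (X \<omega>)\<^sup>2 \<partial>M) - x\<^sup>2" "(\<integral>\<omega>. (Z \<omega> - z)\<^sup>2 \<partial>M) = (\<integral>\<omega>. (Z \<omega>)\<^sup>2 \<partial>M) - z\<^sup>2"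
    using variance_eq[OF i(1) sq(1)] variance_eq[OF i(2) sq(2)] by (simp_all add: x_def z_def)
  then have le: "(\<integral>\<omega>. (X \<omega> - x)\<^sup>2 \<partial>M) \<le> B" "(\<integral>\<omega>. (Z \<omega> - z)\<^sup>2 \<partial>M) \<le> B"
    using b zero_le_power2[of x] zero_le_power2[of z] by linarith+
  have c: "covar X Z = (\<integral>\<omega>. (X \<omega> - x) * (Z \<omega> - z) \<partial>M)"
    using covar_centered(1)[OF assms(1-4), of x z] by (simp add: x_def)
  have "\<bar>\<integral>\<omega>. (X \<omega> - x) * (Z \<omega> - z) \<partial>M\<bar> \<le> (\<integral>\<omega>. \<bar>(X \<omega> - x) * (Z \<omega> - z)\<bar> \<partial>M)"
    by (rule integral_abs_bound)
  also have "\<dots> \<le> (\<integral>\<omega>. ((X \<omega> - x)\<^sup>2 + (Z \<omega> - z)\<^sup>2) / 2 \<partial>M)"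
  proof (rule integral_mono)
    show "integrable M (\<lambda>\<omega>. \<bar>(X \<omega> - x) * (Z \<omega> - z)\<bar>)"
      using covar_centered(2)[OF assms(1-4), of x z] by (rule integrable_abs)
    show "integrable M (\<lambda>\<omega>. ((X \<omega> - x)\<^sup>2 + (Z \<omega> - z)\<^sup>2) / 2)" using vx vz by auto
    show "\<bar>(X \<omega> - x) * (Z \<omega> - z)\<bar> \<le> ((X \<omega> - x)\<^sup>2 + (Z \<omega> - z)\<^sup>2) / 2" for \<omega>
      by (rule abs_mult_le_squares)
  qed
  also have "\<dots> \<le> B" using vx vz le by simp
  finally show ?thesis unfolding c .
qed

end

text \<open>\<open>a\<close> is only an upper bound for the mixing coefficients of \<open>V\<close>
  and is not assumed monotone. This admits explicit power rates and makes the locale stable under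
  measurable transformations of the single \<open>V k\<close>.\<close>

locale mixing = prob_space M for M :: "'a measure" +
  fixes V :: "nat \<Rightarrow> 'a \<Rightarrow> real" and a :: "nat \<Rightarrow> real"
  assumes V_meas [measurable]: "\<And>k. V k \<in> borel_measurable M"
    and decoupled: "\<And>j n. decoupled M (proc_algebra M borel V {0..j}) (proc_algebra M borel V {j + n..}) (a n)"
begin

abbreviation alg :: "nat set \<Rightarrow> 'a measure" where "alg I \<equiv> proc_algebra M borel V I"

lemma rate_nonneg: "0 \<le> a n"
  using decoupled_nonneg[OF decoupled[of 0 n]] .

lemma alg_mono: "I \<subseteq> J \<Longrightarrow> sets (alg I) \<subseteq> sets (alg J)"
  by (rule sets_proc_algebra_subset) (auto intro!: measurable_proc_algebra)

lemma alg_measurable: "k \<in> I \<Longrightarrow> V k \<in> borel_measurable (alg I)"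
  by (rule measurable_proc_algebra) auto

lemma subalgebra_alg: "subalgebra M (alg I)"
  by (rule subalgebra_proc_algebra) auto

text \<open>Only the least element \<open>j0\<close> of \<open>J\<close> matters: \<open>I\<close>
  lies in \<open>{0..j0 - m}\<close> and \<open>J\<close> in \<open>{j0..}\<close>. Empty index sets
  do occur, at either end of the range of summation; their sigma-algebra is trivial and all
  covariances with it are 0.\<close>

lemma decoupled_gap:
  assumes gap: "\<And>i j. i \<in> I \<Longrightarrow> j \<in> J \<Longrightarrow> i + m \<le> j"
  shows "decoupled M (alg I) (alg J) (a m)"
proof (cases "I = {} \<or> J = {}")
  case True
  have triv: "sets (alg {}) = {{}, space M}"
    by (auto simp: sets_proc_algebra generated_events_def sigma_sets_empty_eq)
  have sub: "B \<inter> space M = B" "space M \<inter> B = B" if "B \<in> sets (alg K)" for B K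
    using sets.sets_into_space[OF that] by auto
  show ?thesis
    unfolding decoupled_def using True rate_nonneg[of m] subalgebra_alg
    by (auto simp: triv sub prob_space)
next
  case False
  define j0 where "j0 = (LEAST j. j \<in> J)"
  have j0: "j0 \<in> J" "\<And>j. j \<in> J \<Longrightarrow> j0 \<le> j"
    using False unfolding j0_def by (auto intro: LeastI Least_le)
  have "m \<le> j0" using False gap[OF _ j0(1)] by force
  then have "I \<subseteq> {0..j0 - m}" "J \<subseteq> {(j0 - m) + m..}" using gap[OF _ j0(1)] j0(2) by force+
  then show ?thesis
    by (intro decoupled_mono[OF decoupled[of "j0 - m" m]] alg_mono) auto
qed

lemma decoupled_lag:
  "decoupled M (alg {min i j}) (alg {max i j}) (a (lag i j))"
  by (rule decoupled_gap) (auto simp: lag_def)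

lemma covar_bounded:
  assumes "\<And>\<omega>. \<omega> \<in> space M \<Longrightarrow> \<bar>V i \<omega>\<bar> \<le> x" "\<And>\<omega>. \<omega> \<in> space M \<Longrightarrow> \<bar>V j \<omega>\<bar> \<le> x"
  shows "\<bar>covar (V i) (V j)\<bar> \<le> 4 * x\<^sup>2 * a (lag i j)"
proof -
  have m: "V (min i j) \<in> borel_measurable (alg {min i j})" "V (max i j) \<in> borel_measurable (alg {max i j})"
    by (auto intro: alg_measurable)
  have "\<bar>covar (V (min i j)) (V (max i j))\<bar> \<le> 4 * x * x * a (lag i j)"
    unfolding covar_def
    by (rule covariance_bounded[OF decoupled_lag m]) (use assms in \<open>auto simp: min_def max_def split: if_splits\<close>)
  moreover have "covar (V (min i j)) (V (max i j)) = covar (V i) (V j)"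
    by (auto simp: covar_def min_def max_def mult.commute)
  ultimately show ?thesis by (simp add: power2_eq_square)
qed

text \<open>A middle block is compared with the product of a past and a future factor in three
  moves: separate \<open>B\<close> from \<open>A * X\<close>, then \<open>A\<close> from
  \<open>X\<close>, and rejoin \<open>A\<close> and \<open>B\<close>. Each costs at most
  \<open>16 * x * a m\<close>.\<close>

lemma triple_decoupling:
  fixes X A B :: "'a \<Rightarrow> complex"
  assumes gap: "\<And>i c. i \<in> I \<Longrightarrow> c \<in> C \<Longrightarrow> i + m \<le> c" "\<And>c j. c \<in> C \<Longrightarrow> j \<in> J \<Longrightarrow> c + m \<le> j"
      "\<And>i j. i \<in> I \<Longrightarrow> j \<in> J \<Longrightarrow> i + m \<le> j"
    and X: "X \<in> borel_measurable (alg C)" and A: "A \<in> borel_measurable (alg I)" and B: "B \<in> borel_measurable (alg J)"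
    and Xx: "\<And>\<omega>. \<omega> \<in> space M \<Longrightarrow> norm (X \<omega>) \<le> x"
    and A1: "\<And>\<omega>. \<omega> \<in> space M \<Longrightarrow> norm (A \<omega>) \<le> 1"
    and B1: "\<And>\<omega>. \<omega> \<in> space M \<Longrightarrow> norm (B \<omega>) \<le> 1"
  shows "norm ((\<integral>\<omega>. X \<omega> * (A \<omega> * B \<omega>) \<partial>M) - (\<integral>\<omega>. X \<omega> \<partial>M) * (\<integral>\<omega>. A \<omega> * B \<omega> \<partial>M)) \<le> 48 * x * a m"
proof -
  obtain \<omega>0 where w0: "\<omega>0 \<in> space M" using not_empty by auto
  have x0: "0 \<le> x" using order_trans[OF norm_ge_zero Xx[OF w0]] .
  have AC: "(\<lambda>\<omega>. A \<omega> * X \<omega>) \<in> borel_measurable (alg (I \<union> C))"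
  proof (rule borel_measurable_times)
    have "subalgebra (alg (I \<union> C)) (alg I)" "subalgebra (alg (I \<union> C)) (alg C)"
      using alg_mono[of I "I \<union> C"] alg_mono[of C "I \<union> C"] by (simp_all add: subalgebra_def)
    then show "A \<in> borel_measurable (alg (I \<union> C))" "X \<in> borel_measurable (alg (I \<union> C))"
      using A X by (auto intro: measurable_from_subalg)
  qed
  have d1: "decoupled M (alg (I \<union> C)) (alg J) (a m)" and d2: "decoupled M (alg I) (alg C) (a m)"
    and d3: "decoupled M (alg I) (alg J) (a m)"
    by (rule decoupled_gap; use gap in auto)+
  have 1: "norm ((\<integral>\<omega>. (A \<omega> * X \<omega>) * B \<omega> \<partial>M) - (\<integral>\<omega>. A \<omega> * X \<omega> \<partial>M) * (\<integral>\<omega>. B \<omega> \<partial>M)) \<le> 16 * x * 1 * a m"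
  proof (rule covariance_complex[OF d1 AC B _ B1])
    fix \<omega> assume "\<omega> \<in> space M"
    then show "norm (A \<omega> * X \<omega>) \<le> x" using mult_mono[OF A1 Xx] by (auto simp: norm_mult)
  qed
  have 2: "norm ((\<integral>\<omega>. A \<omega> * X \<omega> \<partial>M) - (\<integral>\<omega>. A \<omega> \<partial>M) * (\<integral>\<omega>. X \<omega> \<partial>M)) \<le> 16 * 1 * x * a m"
    by (rule covariance_complex[OF d2 A X A1 Xx])
  have 3: "norm ((\<integral>\<omega>. A \<omega> * B \<omega> \<partial>M) - (\<integral>\<omega>. A \<omega> \<partial>M) * (\<integral>\<omega>. B \<omega> \<partial>M)) \<le> 16 * 1 * 1 * a m"
    by (rule covariance_complex[OF d3 A B A1 B1])
  have nb: "norm (\<integral>\<omega>. B \<omega> \<partial>M) \<le> 1" by (rule norm_expectation_le) (use B1 in auto)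
  have nx: "norm (\<integral>\<omega>. X \<omega> \<partial>M) \<le> x" by (rule norm_expectation_le) (use Xx x0 in auto)
  define eax eb ea ex eab where "eax = (\<integral>\<omega>. A \<omega> * X \<omega> \<partial>M)" and "eb = (\<integral>\<omega>. B \<omega> \<partial>M)"
    and "ea = (\<integral>\<omega>. A \<omega> \<partial>M)" and "ex = (\<integral>\<omega>. X \<omega> \<partial>M)" and "eab = (\<integral>\<omega>. A \<omega> * B \<omega> \<partial>M)"
  have "(\<integral>\<omega>. X \<omega> * (A \<omega> * B \<omega>) \<partial>M) - ex * eab
      = ((\<integral>\<omega>. (A \<omega> * X \<omega>) * B \<omega> \<partial>M) - eax * eb) + (eax - ea * ex) * eb - ex * (eab - ea * eb)"
    by (simp add: algebra_simps)
  also have "norm \<dots> \<le> norm ((\<integral>\<omega>. (A \<omega> * X \<omega>) * B \<omega> \<partial>M) - eax * eb) + norm (eax - ea * ex) * norm eb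
      + norm ex * norm (eab - ea * eb)"
  proof -
    have "norm (u + v * eb - ex * w) \<le> norm u + norm v * norm eb + norm ex * norm w" for u v w :: complex
      using norm_triangle_ineq4[of "u + v * eb" "ex * w"] norm_triangle_ineq[of u "v * eb"]
      by (simp add: norm_mult)
    then show ?thesis .
  qed
  also have "\<dots> \<le> 16 * x * a m + (16 * x * a m) * 1 + x * (16 * a m)"
    using 1 2 3 nb nx x0 rate_nonneg[of m] unfolding eax_def eb_def ea_def ex_def eab_def
    by (intro add_mono mult_mono) auto
  finally show ?thesis by (simp add: ex_def eab_def)
qed

end

text \<open>Functions of the single \<open>V k\<close> generate smaller sigma-algebras, so the rate
  is inherited; \<open>g\<close> may depend on \<open>k\<close>, as centering requires.\<close>

lemma mixing_transform:
  assumes "mixing M V a" and g: "\<And>k. g k \<in> borel_measurable borel"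
  shows "mixing M (\<lambda>k \<omega>. g k (V k \<omega>)) a"
proof -
  interpret mixing M V a by fact
  show ?thesis
  proof (unfold_locales)
    have m: "(\<lambda>\<omega>. g k (V k \<omega>)) \<in> borel_measurable (alg I)" if "k \<in> I" for k I
      using measurable_compose[OF alg_measurable[OF that] g] .
    have s: "sets (proc_algebra M borel (\<lambda>k \<omega>. g k (V k \<omega>)) I) \<subseteq> sets (alg I)" for I
      by (rule sets_proc_algebra_subset) (auto intro: m)
    show "(\<lambda>\<omega>. g k (V k \<omega>)) \<in> borel_measurable M" for k
      using measurable_compose[OF V_meas g] .
    show "decoupled M (proc_algebra M borel (\<lambda>k \<omega>. g k (V k \<omega>)) {0..j})
        (proc_algebra M borel (\<lambda>k \<omega>. g k (V k \<omega>)) {j + n..}) (a n)" for j n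
      by (rule decoupled_mono[OF decoupled[of j n]]) (auto intro!: subsetD[OF s])
  qed
qed

section \<open>Characteristic functions of sums of bounded mixing sequences\<close>

lemma cmod_iexp_diff_le: "cmod (iexp x - iexp y) \<le> \<bar>x - y\<bar>"
proof -
  have "iexp x - iexp y = iexp y * (iexp (x - y) - 1)"
    by (simp add: algebra_simps exp_diff exp_minus divide_inverse mult.assoc[symmetric] flip: exp_add)
  moreover have "cmod (iexp (x - y) - 1) \<le> \<bar>x - y\<bar>"
    using iexp_approx1[of "x - y" 0] by simp
  ultimately show ?thesis by (simp add: norm_mult)
qed

lemma cmod_iexp_linear_le: "cmod (iexp x - 1 - \<i> * x) \<le> x\<^sup>2 / 2"
  using iexp_approx1[of x 1] by (simp add: algebra_simps power2_eq_square)

text \<open>With the integrating factor \<open>E t = exp (s * t^2 / 2)\<close>, the derivative of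
  \<open>E * \<phi>\<close> is \<open>E\<close> times the defect of the equation. For
  \<open>\<bar>t\<bar> \<le> \<bar>T\<bar>\<close> it is at most \<open>E T * \<delta>\<close>, and
  dividing by \<open>E T\<close> at the end removes every dependence on \<open>s\<close>.\<close>

lemma gaussian_ode_stability:
  fixes \<phi> \<phi>' :: "real \<Rightarrow> complex"
  assumes deriv: "\<And>t. (\<phi> has_vector_derivative \<phi>' t) (at t)"
    and init: "\<phi> 0 = 1" and s: "0 \<le> s"
    and close: "\<And>t. \<bar>t\<bar> \<le> \<bar>T\<bar> \<Longrightarrow> cmod (\<phi>' t + of_real (s * t) * \<phi> t) \<le> \<delta>"
  shows "cmod (\<phi> T - of_real (exp (- s * T\<^sup>2 / 2))) \<le> \<bar>T\<bar> * \<delta>"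
proof -
  define E where "E t = exp (s * t\<^sup>2 / 2)" for t
  have dE: "(E has_real_derivative s * t * E t) (at t)" for t
    unfolding E_def by (auto intro!: derivative_eq_intros simp: power2_eq_square)
  have d: "((\<lambda>t. of_real (E t) * \<phi> t) has_vector_derivative of_real (E t) * (\<phi>' t + of_real (s * t) * \<phi> t)) (at t)" for t
  proof -
    have "((\<lambda>t. of_real (E t) * \<phi> t) has_vector_derivative of_real (E t) * \<phi>' t + of_real (s * t * E t) * \<phi> t) (at t)"
      using dE[of t] deriv[of t]
      by (intro has_vector_derivative_mult has_vector_derivative_of_real)
         (simp_all add: has_real_derivative_iff_has_vector_derivative)
    then show ?thesis by (simp add: algebra_simps)
  qed
  have "norm ((\<lambda>t. of_real (E t) * \<phi> t) T - (\<lambda>t. of_real (E t) * \<phi> t) 0) \<le> E T * \<delta> * norm (T - 0)"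
  proof (rule differentiable_bound[where S="cball 0 \<bar>T\<bar>"
        and f'="\<lambda>t h. h *\<^sub>R (of_real (E t) * (\<phi>' t + of_real (s * t) * \<phi> t))"])
    fix t assume "t \<in> cball (0::real) \<bar>T\<bar>"
    then have t: "\<bar>t\<bar> \<le> \<bar>T\<bar>" by simp
    show "((\<lambda>t. of_real (E t) * \<phi> t) has_derivative (\<lambda>h. h *\<^sub>R (of_real (E t) * (\<phi>' t + of_real (s * t) * \<phi> t)))) (at t within cball 0 \<bar>T\<bar>)"
      using d[of t] unfolding has_vector_derivative_def by (rule has_derivative_at_withinI)
    have "norm (of_real (E t) * (\<phi>' t + of_real (s * t) * \<phi> t)) \<le> E T * \<delta>"
    proof -
      have "t\<^sup>2 \<le> T\<^sup>2" using t by (simp add: abs_le_square_iff)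
      then have "E t \<le> E T" unfolding E_def using s by (simp add: mult_left_mono)
      moreover have "0 \<le> E t" by (simp add: E_def)
      ultimately show ?thesis using close[OF t] by (auto simp: norm_mult intro!: mult_mono)
    qed
    then show "onorm (\<lambda>h. h *\<^sub>R (of_real (E t) * (\<phi>' t + of_real (s * t) * \<phi> t))) \<le> E T * \<delta>"
      by (intro onorm_le) (simp add: mult.commute mult_left_mono)
  qed auto
  then have 1: "cmod (of_real (E T) * \<phi> T - 1) \<le> E T * (\<bar>T\<bar> * \<delta>)"
    by (simp add: init E_def mult.commute mult.left_commute)
  have Epos: "0 < E T" by (simp add: E_def)
  have "of_real (E T) * \<phi> T - 1 = of_real (E T) * (\<phi> T - of_real (exp (- s * T\<^sup>2 / 2)))"
    by (simp add: E_def algebra_simps exp_minus flip: exp_of_real)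
  then have "cmod (of_real (E T) * \<phi> T - 1) = E T * cmod (\<phi> T - of_real (exp (- s * T\<^sup>2 / 2)))"
    using Epos by (simp add: norm_mult)
  with 1 Epos show ?thesis by simp
qed

context prob_space
begin

text \<open>For bounded \<open>X\<close> the second-order Taylor error of \<open>iexp\<close> is at
  most \<open>B^2 * (u - t)^2 / 2\<close> uniformly on the sample space, which justifies
  differentiating under the integral.\<close>

lemma char_has_vector_derivative:
  fixes X :: "'a \<Rightarrow> real"
  assumes [measurable]: "X \<in> borel_measurable M" and b: "\<And>\<omega>. \<omega> \<in> space M \<Longrightarrow> \<bar>X \<omega>\<bar> \<le> B"
  shows "((\<lambda>t. \<integral>\<omega>. iexp (t * X \<omega>) \<partial>M) has_vector_derivative
           (\<integral>\<omega>. \<i> * X \<omega> * iexp (t * X \<omega>) \<partial>M)) (at t)"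
proof -
  define \<phi> where "\<phi> t = (\<integral>\<omega>. iexp (t * X \<omega>) \<partial>M)" for t
  define D where "D = (\<integral>\<omega>. \<i> * X \<omega> * iexp (t * X \<omega>) \<partial>M)"
  have i1: "integrable M (\<lambda>\<omega>. iexp (t * X \<omega>))" for t
    by (intro integrable_bounded[where c=1]) auto
  have i2: "integrable M (\<lambda>\<omega>. \<i> * X \<omega> * iexp (t * X \<omega>))"
    using b by (intro integrable_bounded[where c=B]) (auto simp: norm_mult)
  have est: "norm (\<phi> u - \<phi> t - (u - t) *\<^sub>R D) \<le> B\<^sup>2 / 2 * (u - t)\<^sup>2" for u
  proof -
    have "\<phi> u - \<phi> t - (u - t) *\<^sub>R D
        = (\<integral>\<omega>. iexp (u * X \<omega>) - iexp (t * X \<omega>) - of_real (u - t) * (\<i> * X \<omega> * iexp (t * X \<omega>)) \<partial>M)"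
      unfolding \<phi>_def D_def scaleR_conv_of_real using i1 i2 by simp
    also have "norm \<dots> \<le> B\<^sup>2 / 2 * (u - t)\<^sup>2"
    proof (rule norm_expectation_le)
      fix \<omega> assume w: "\<omega> \<in> space M"
      have "iexp (u * X \<omega>) - iexp (t * X \<omega>) - of_real (u - t) * (\<i> * X \<omega> * iexp (t * X \<omega>))
          = iexp (t * X \<omega>) * (iexp ((u - t) * X \<omega>) - 1 - \<i> * of_real ((u - t) * X \<omega>))"
        by (simp add: algebra_simps flip: exp_add)
      also have "norm \<dots> \<le> ((u - t) * X \<omega>)\<^sup>2 / 2"
        using cmod_iexp_linear_le[of "(u - t) * X \<omega>"] by (simp add: norm_mult)
      also have "\<dots> \<le> B\<^sup>2 / 2 * (u - t)\<^sup>2"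
      proof -
        have "(X \<omega>)\<^sup>2 \<le> B\<^sup>2" using b[OF w] by (simp add: abs_le_square_iff[symmetric])
        then have "(u - t)\<^sup>2 * (X \<omega>)\<^sup>2 \<le> (u - t)\<^sup>2 * B\<^sup>2" by (intro mult_left_mono) auto
        then show ?thesis by (simp add: power_mult_distrib mult.commute)
      qed
      finally show "norm (iexp (u * X \<omega>) - iexp (t * X \<omega>) - of_real (u - t) * (\<i> * X \<omega> * iexp (t * X \<omega>)))
          \<le> B\<^sup>2 / 2 * (u - t)\<^sup>2" .
    qed simp
    finally show ?thesis .
  qed
  have "(\<phi> has_derivative (\<lambda>h. h *\<^sub>R D)) (at t)"
  proof (rule has_derivativeI_sandwich[where e=1 and H="\<lambda>u. B\<^sup>2 / 2 * \<bar>u - t\<bar>"])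
    show "bounded_linear (\<lambda>h. h *\<^sub>R D)" by (rule bounded_linear_scaleR_left)
    have "((\<lambda>u. B\<^sup>2 / 2 * \<bar>u - t\<bar>) \<longlongrightarrow> B\<^sup>2 / 2 * \<bar>t - t\<bar>) (at t)" by (intro tendsto_intros)
    then show "((\<lambda>u. B\<^sup>2 / 2 * \<bar>u - t\<bar>) \<longlongrightarrow> 0) (at t)" by simp
    fix u assume "u \<in> UNIV" "u \<noteq> t"
    then show "norm (\<phi> u - \<phi> t - (u - t) *\<^sub>R D) / norm (u - t) \<le> B\<^sup>2 / 2 * \<bar>u - t\<bar>"
      using est[of u] by (simp add: pos_divide_le_eq power2_eq_square[of "u - t"] mult.assoc)
  qed simp
  then show ?thesis unfolding has_vector_derivative_def \<phi>_def D_def .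
qed

end

section \<open>The differential equation for sums of bounded centered summands\<close>

locale bounded_mixing = mixing M V a for M :: "'a measure" and V a +
  fixes K :: real
  assumes V_bounded: "\<And>k \<omega>. \<omega> \<in> space M \<Longrightarrow> \<bar>V k \<omega>\<bar> \<le> K"
    and V_centered: "\<And>k. expectation (V k) = 0"
begin

lemma K_nonneg: "0 \<le> K"
proof -
  obtain \<omega> where "\<omega> \<in> space M" using not_empty by auto
  then show ?thesis using V_bounded[of \<omega> 0] by auto
qed

definition psum :: "nat set \<Rightarrow> 'a \<Rightarrow> real" where "psum I \<omega> = (\<Sum>j\<in>I. V j \<omega>)"

lemma psum_measurable [measurable]: "psum I \<in> borel_measurable M"
  unfolding psum_def[abs_def] by measurable

lemma psum_alg: "psum I \<in> borel_measurable (alg I)"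
  unfolding psum_def[abs_def] by (intro borel_measurable_sum alg_measurable)

lemma abs_psum_le:
  assumes "\<omega> \<in> space M" "card I \<le> d"
  shows "\<bar>psum I \<omega>\<bar> \<le> K * d"
proof -
  have "\<bar>psum I \<omega>\<bar> \<le> (\<Sum>j\<in>I. K)"
    unfolding psum_def using V_bounded[OF assms(1)] by (intro order_trans[OF sum_abs] sum_mono)
  also have "\<dots> \<le> K * d" using assms(2) K_nonneg by (simp add: mult.commute mult_left_mono)
  finally show ?thesis .
qed

text \<open>A Stein-type identity at index \<open>k\<close>. Cutting the window \<open>C m\<close>
  out of the exponential leaves \<open>g m\<close>, and the window part is expanded to first order.
  The constant term nearly vanishes because \<open>V k\<close> is centered and decoupled from
  \<open>g m\<close>; the linear term gives the local covariance; the rest is quadratic in the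
  window sum. \<open>D\<close> bounds the size of the widest window used, the one of radius
  \<open>2 * m\<close>.\<close>

lemma stein_term:
  fixes n m k :: nat and \<tau> :: real
  assumes k: "k \<in> {1..n}"
  defines "C \<equiv> \<lambda>l. {j\<in>{1..n}. lag k j \<le> l}"
  defines "D \<equiv> real (4 * m + 1)"
  defines "\<phi> \<equiv> (\<integral>\<omega>. iexp (\<tau> * psum {1..n} \<omega>) \<partial>M)"
  shows "cmod ((\<integral>\<omega>. V k \<omega> * iexp (\<tau> * psum {1..n} \<omega>) \<partial>M) - \<i> * \<tau> * (\<integral>\<omega>. V k \<omega> * psum (C m) \<omega> \<partial>M) * \<phi>)
     \<le> 48 * K * a m * (1 + \<bar>\<tau>\<bar> * (K * D)) + 4 * K * (\<tau> * (K * D))\<^sup>2"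
proof -
  \<comment> \<open>\<open>P l\<close> and \<open>F l\<close> are the indices further than
    \<open>l\<close> from \<open>k\<close> on either side, and \<open>g l\<close> is the exponential
    with the window of radius \<open>l\<close> removed.\<close>
  define P where "P l = {j\<in>{1..n}. j + l < k}" for l
  define F where "F l = {j\<in>{1..n}. k + l < j}" for l
  define g where "g l \<omega> = iexp (\<tau> * psum (P l) \<omega>) * iexp (\<tau> * psum (F l) \<omega>)" for l \<omega>
  define v where "v \<omega> = complex_of_real (V k \<omega>)" for \<omega>
  define w where "w \<omega> = complex_of_real (psum (C m) \<omega>)" for \<omega>
  define e where "e \<omega> = iexp (\<tau> * psum {1..n} \<omega>)" for \<omega>
  define R where "R \<omega> = iexp (\<tau> * psum (C m) \<omega>) - 1 - \<i> * of_real (\<tau> * psum (C m) \<omega>)" for \<omega>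
  define L where "L = K * D"
  have L0: "0 \<le> L" using K_nonneg by (simp add: L_def D_def)
  have [measurable]: "g l \<in> borel_measurable M" "v \<in> borel_measurable M" "w \<in> borel_measurable M"
      "e \<in> borel_measurable M" "R \<in> borel_measurable M" for l
    unfolding g_def[abs_def] v_def[abs_def] w_def[abs_def] e_def[abs_def] R_def[abs_def] by measurable
  have cardC: "card (C l) \<le> 2 * l + 1" for l
  proof -
    have "C l \<subseteq> {k - l..k + l}" by (auto simp: C_def lag_def)
    then have "card (C l) \<le> card {k - l..k + l}" by (rule card_mono[rotated]) simp
    then show ?thesis by simp
  qed
  have CL: "\<bar>psum (C l) \<omega>\<bar> \<le> L" if "\<omega> \<in> space M" "l \<le> 2 * m" for l \<omega>
    unfolding L_def D_def by (rule abs_psum_le[OF that(1)]) (use cardC[of l] that(2) in simp)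
  have split: "psum {1..n} \<omega> = psum (P l) \<omega> + psum (F l) \<omega> + psum (C l) \<omega>" for l \<omega>
  proof -
    have "{1..n} = (P l \<union> F l) \<union> C l" "P l \<inter> F l = {}" "(P l \<union> F l) \<inter> C l = {}"
      by (auto simp: P_def F_def C_def lag_def)
    moreover have "finite (P l)" "finite (F l)" "finite (C l)" by (auto simp: P_def F_def C_def)
    ultimately show ?thesis unfolding psum_def by (simp add: sum.union_disjoint)
  qed
  have ge: "e \<omega> = g l \<omega> * iexp (\<tau> * psum (C l) \<omega>)" for l \<omega>
    unfolding e_def g_def split[of \<omega> l] by (simp add: algebra_simps flip: exp_add)
  have g1: "cmod (g l \<omega>) = 1" for l \<omega> by (simp add: g_def norm_mult)
  have ge': "cmod (g l \<omega> - e \<omega>) \<le> \<bar>\<tau>\<bar> * L" if "\<omega> \<in> space M" "l \<le> 2 * m" for l \<omega>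
  proof -
    have "g l \<omega> - e \<omega> = - (g l \<omega> * (iexp (\<tau> * psum (C l) \<omega>) - iexp 0))"
      unfolding ge[of \<omega> l] by (simp add: algebra_simps)
    then have "cmod (g l \<omega> - e \<omega>) \<le> \<bar>\<tau> * psum (C l) \<omega> - 0\<bar>"
      using cmod_iexp_diff_le[of "\<tau> * psum (C l) \<omega>" 0] by (simp add: norm_mult g1)
    also have "\<dots> \<le> \<bar>\<tau>\<bar> * L" using CL[OF that] by (simp add: abs_mult mult_left_mono)
    finally show ?thesis .
  qed
  have vK: "cmod (v \<omega>) \<le> K" and wL: "cmod (w \<omega>) \<le> L" if "\<omega> \<in> space M" for \<omega>
    using V_bounded[OF that] CL[OF that] by (auto simp: v_def w_def)
  have vwL: "cmod (v \<omega> * w \<omega>) \<le> K * L" if "\<omega> \<in> space M" for \<omega>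
    unfolding norm_mult by (intro mult_mono vK wL K_nonneg that) simp
  have RL: "cmod (R \<omega>) \<le> (\<tau> * L)\<^sup>2 / 2" if "\<omega> \<in> space M" for \<omega>
  proof -
    have "cmod (R \<omega>) \<le> (\<tau> * psum (C m) \<omega>)\<^sup>2 / 2"
      unfolding R_def by (rule cmod_iexp_linear_le)
    also have "\<dots> \<le> (\<tau> * L)\<^sup>2 / 2"
      using CL[OF that, of m] L0 by (intro divide_right_mono) (auto simp: abs_le_square_iff[symmetric] abs_mult mult_left_mono)
    finally show ?thesis .
  qed
  have iv: "\<And>h c. h \<in> borel_measurable M \<Longrightarrow> (\<And>\<omega>. \<omega> \<in> space M \<Longrightarrow> cmod (h \<omega>) \<le> c) \<Longrightarrow> integrable M (\<lambda>\<omega>. v \<omega> * h \<omega>)"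
  proof -
    fix h :: "'a \<Rightarrow> complex" and c assume [measurable]: "h \<in> borel_measurable M" and "\<And>\<omega>. \<omega> \<in> space M \<Longrightarrow> cmod (h \<omega>) \<le> c"
    then show "integrable M (\<lambda>\<omega>. v \<omega> * h \<omega>)"
      using vK K_nonneg
      by (intro integrable_bounded[where c="K * c"]) (auto simp: norm_mult intro!: mult_mono)
  qed
  have iG: "integrable M (\<lambda>\<omega>. v \<omega> * (g m \<omega> * R \<omega>))" "integrable M (\<lambda>\<omega>. v \<omega> * g m \<omega>)"
      "integrable M (\<lambda>\<omega>. v \<omega> * (w \<omega> * g l \<omega>))" for l
    by (rule iv[of _ "(\<tau> * L)\<^sup>2 / 2"] iv[of _ 1] iv[of _ L]; use RL wL in \<open>simp add: norm_mult g1\<close>)+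
  have ig: "integrable M (g l)" and ie: "integrable M e" for l
    by (auto intro!: integrable_bounded[where c=1] simp: g1 e_def)
  have pt: "v \<omega> * e \<omega> = v \<omega> * (g m \<omega> * R \<omega>) + v \<omega> * g m \<omega> + \<i> * \<tau> * (v \<omega> * (w \<omega> * g m \<omega>))" for \<omega>
    unfolding ge[of \<omega> m] R_def w_def by (simp add: algebra_simps)
  have E1: "(\<integral>\<omega>. v \<omega> * e \<omega> \<partial>M)
      = (\<integral>\<omega>. v \<omega> * (g m \<omega> * R \<omega>) \<partial>M) + (\<integral>\<omega>. v \<omega> * g m \<omega> \<partial>M) + \<i> * \<tau> * (\<integral>\<omega>. v \<omega> * (w \<omega> * g m \<omega>) \<partial>M)"
    unfolding pt using iG by simp
  have b1: "cmod (\<integral>\<omega>. v \<omega> * (g m \<omega> * R \<omega>) \<partial>M) \<le> K * ((\<tau> * L)\<^sup>2 / 2)"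
  proof (rule norm_expectation_le)
    fix \<omega> assume "\<omega> \<in> space M"
    then show "cmod (v \<omega> * (g m \<omega> * R \<omega>)) \<le> K * ((\<tau> * L)\<^sup>2 / 2)"
      unfolding norm_mult g1 using vK RL K_nonneg by (intro mult_mono) auto
  qed (use K_nonneg in auto)
  have Pm: "(\<lambda>\<omega>. iexp (\<tau> * psum (P l) \<omega>)) \<in> borel_measurable (alg (P l))"
    and Fm: "(\<lambda>\<omega>. iexp (\<tau> * psum (F l) \<omega>)) \<in> borel_measurable (alg (F l))" for l
    using psum_alg[of "P l"] psum_alg[of "F l"] by measurable
  have ev: "(\<integral>\<omega>. v \<omega> \<partial>M) = 0"
    unfolding v_def using V_centered[of k] by simp
  have b2: "cmod (\<integral>\<omega>. v \<omega> * g m \<omega> \<partial>M) \<le> 48 * K * a m"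
  proof -
    have vm: "v \<in> borel_measurable (alg {k})"
      unfolding v_def[abs_def] using alg_measurable[of k "{k}"] by measurable
    have "cmod ((\<integral>\<omega>. v \<omega> * g m \<omega> \<partial>M) - (\<integral>\<omega>. v \<omega> \<partial>M) * (\<integral>\<omega>. g m \<omega> \<partial>M)) \<le> 48 * K * a m"
      unfolding g_def
      by (rule triple_decoupling[OF _ _ _ vm Pm[of m] Fm[of m] vK]) (auto simp: P_def F_def)
    then show ?thesis by (simp add: ev)
  qed
  \<comment> \<open>The product \<open>v * w\<close> reaches up to distance \<open>m\<close> from
    \<open>k\<close>, so it is not separated from \<open>g m\<close>. Widening the removed window to
    radius \<open>2 * m\<close> restores a gap of \<open>m\<close>, at the price of twice the window
    error.\<close>
  have b3: "cmod ((\<integral>\<omega>. v \<omega> * (w \<omega> * g m \<omega>) \<partial>M) - (\<integral>\<omega>. v \<omega> * (w \<omega> * g (2 * m) \<omega>) \<partial>M)) \<le> K * L * (2 * (\<bar>\<tau>\<bar> * L))"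
  proof -
    have "(\<integral>\<omega>. v \<omega> * (w \<omega> * g m \<omega>) \<partial>M) - (\<integral>\<omega>. v \<omega> * (w \<omega> * g (2 * m) \<omega>) \<partial>M)
        = (\<integral>\<omega>. v \<omega> * w \<omega> * (g m \<omega> - g (2 * m) \<omega>) \<partial>M)"
      using iG by (simp add: algebra_simps)
    also have "cmod \<dots> \<le> K * L * (2 * (\<bar>\<tau>\<bar> * L))"
    proof (rule norm_expectation_le)
      fix \<omega> assume s: "\<omega> \<in> space M"
      have "cmod (g m \<omega> - g (2 * m) \<omega>) \<le> 2 * (\<bar>\<tau>\<bar> * L)"
        using norm_triangle_ineq4[of "g m \<omega> - e \<omega>" "g (2 * m) \<omega> - e \<omega>"] ge'[OF s, of m] ge'[OF s, of "2 * m"] by simp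
      then show "cmod (v \<omega> * w \<omega> * (g m \<omega> - g (2 * m) \<omega>)) \<le> K * L * (2 * (\<bar>\<tau>\<bar> * L))"
        unfolding norm_mult[of "v \<omega> * w \<omega>"] using vwL[OF s] K_nonneg L0 by (intro mult_mono) auto
    qed (use K_nonneg L0 in auto)
    finally show ?thesis .
  qed
  have b4: "cmod ((\<integral>\<omega>. v \<omega> * (w \<omega> * g (2 * m) \<omega>) \<partial>M) - (\<integral>\<omega>. v \<omega> * w \<omega> \<partial>M) * (\<integral>\<omega>. g (2 * m) \<omega> \<partial>M)) \<le> 48 * (K * L) * a m"
  proof -
    have kC: "k \<in> C m" using k by (auto simp: C_def lag_def)
    have vm: "(\<lambda>\<omega>. v \<omega> * w \<omega>) \<in> borel_measurable (alg (C m))"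
      unfolding v_def w_def using alg_measurable[OF kC] psum_alg[of "C m"] by measurable
    have "cmod ((\<integral>\<omega>. (v \<omega> * w \<omega>) * g (2 * m) \<omega> \<partial>M) - (\<integral>\<omega>. v \<omega> * w \<omega> \<partial>M) * (\<integral>\<omega>. g (2 * m) \<omega> \<partial>M)) \<le> 48 * (K * L) * a m"
      unfolding g_def
      by (rule triple_decoupling[OF _ _ _ vm Pm[of "2 * m"] Fm[of "2 * m"] vwL])
         (auto simp: P_def F_def C_def lag_def)
    then show ?thesis by (simp add: mult.assoc)
  qed
  have evw: "cmod (\<integral>\<omega>. v \<omega> * w \<omega> \<partial>M) \<le> K * L"
    by (rule norm_expectation_le) (use vwL K_nonneg L0 in auto)
  \<comment> \<open>Putting the window back turns the mean of \<open>g (2 * m)\<close> into the full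
    characteristic function.\<close>
  have b5: "cmod ((\<integral>\<omega>. g (2 * m) \<omega> \<partial>M) - \<phi>) \<le> \<bar>\<tau>\<bar> * L"
  proof -
    have "(\<integral>\<omega>. g (2 * m) \<omega> \<partial>M) - \<phi> = (\<integral>\<omega>. g (2 * m) \<omega> - e \<omega> \<partial>M)"
      unfolding \<phi>_def e_def[symmetric] using ig ie by simp
    also have "cmod \<dots> \<le> \<bar>\<tau>\<bar> * L"
      by (rule norm_expectation_le) (use ge' L0 in auto)
    finally show ?thesis .
  qed
  have vw: "(\<integral>\<omega>. v \<omega> * w \<omega> \<partial>M) = complex_of_real (\<integral>\<omega>. V k \<omega> * psum (C m) \<omega> \<partial>M)"
    unfolding v_def w_def of_real_mult[symmetric] by (rule integral_complex_of_real)
  define x1 x2 x3 x4 q G where "x1 = (\<integral>\<omega>. v \<omega> * (g m \<omega> * R \<omega>) \<partial>M)" and "x2 = (\<integral>\<omega>. v \<omega> * g m \<omega> \<partial>M)"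
    and "x3 = (\<integral>\<omega>. v \<omega> * (w \<omega> * g m \<omega>) \<partial>M)" and "x4 = (\<integral>\<omega>. v \<omega> * (w \<omega> * g (2 * m) \<omega>) \<partial>M)"
    and "q = (\<integral>\<omega>. v \<omega> * w \<omega> \<partial>M)" and "G = (\<integral>\<omega>. g (2 * m) \<omega> \<partial>M)"
  have tri: "cmod (u1 + u2 + \<i> * \<tau> * (u3 + u4 + q * u5)) \<le> cmod u1 + cmod u2 + \<bar>\<tau>\<bar> * (cmod u3 + cmod u4 + cmod q * cmod u5)"
    for u1 u2 u3 u4 u5 :: complex
  proof -
    have "cmod (\<i> * \<tau> * (u3 + u4 + q * u5)) = \<bar>\<tau>\<bar> * cmod (u3 + u4 + q * u5)" by (simp add: norm_mult)
    also have "\<dots> \<le> \<bar>\<tau>\<bar> * (cmod u3 + cmod u4 + cmod q * cmod u5)"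
      using norm_triangle_ineq[of "u3 + u4" "q * u5"] norm_triangle_ineq[of u3 u4]
      by (intro mult_left_mono) (auto simp: norm_mult)
    finally show ?thesis
      using norm_triangle_ineq[of "u1 + u2" "\<i> * \<tau> * (u3 + u4 + q * u5)"] norm_triangle_ineq[of u1 u2] by linarith
  qed
  have "(\<integral>\<omega>. v \<omega> * e \<omega> \<partial>M) - \<i> * \<tau> * q * \<phi> = x1 + x2 + \<i> * \<tau> * ((x3 - x4) + (x4 - q * G) + q * (G - \<phi>))"
    unfolding E1 x1_def[symmetric] x2_def[symmetric] x3_def[symmetric] by (simp add: algebra_simps)
  also have "cmod \<dots> \<le> cmod x1 + cmod x2 + \<bar>\<tau>\<bar> * (cmod (x3 - x4) + cmod (x4 - q * G) + cmod q * cmod (G - \<phi>))"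
    by (rule tri)
  also have "\<dots> \<le> K * ((\<tau> * L)\<^sup>2 / 2) + 48 * K * a m + \<bar>\<tau>\<bar> * (K * L * (2 * (\<bar>\<tau>\<bar> * L)) + 48 * (K * L) * a m + K * L * (\<bar>\<tau>\<bar> * L))"
    using b1 b2 b3 b4 b5 evw K_nonneg L0 unfolding x1_def x2_def x3_def x4_def q_def G_def
    by (intro add_mono mult_left_mono mult_mono) auto
  \<comment> \<open>The quadratic terms enter with weights 1/2, 2 and 1: Taylor remainder, widening
    of the window, and putting it back.\<close>
  also have "\<dots> = 48 * K * a m * (1 + \<bar>\<tau>\<bar> * L) + 7 / 2 * K * (\<tau> * L)\<^sup>2"
    by (simp add: algebra_simps power2_eq_square)
  also have "\<dots> \<le> 48 * K * a m * (1 + \<bar>\<tau>\<bar> * L) + 4 * K * (\<tau> * L)\<^sup>2"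
    using K_nonneg by (intro add_left_mono mult_right_mono) auto
  finally show ?thesis
    unfolding q_def vw unfolding v_def e_def L_def by simp
qed

text \<open>This is \<open>stein_term\<close> summed over \<open>k\<close> at
  \<open>\<tau> = t / sqrt n\<close>. There are \<open>n\<close> terms, each divided by
  \<open>sqrt n\<close>, so the single errors are multiplied by \<open>sqrt n\<close>. The
  first-order terms add up to the banded part \<open>Q\<close> of the second moment of the sum, and
  the covariances left out are controlled by the tail of \<open>a\<close>.\<close>

lemma char_ode_estimate:
  fixes n m :: nat and t T :: real
  assumes n: "n \<ge> 1" and t: "\<bar>t\<bar> \<le> T" and sum_a: "summable a"
  defines "D \<equiv> real (4 * m + 1)"
  defines "Z \<equiv> \<lambda>\<omega>. psum {1..n} \<omega> / sqrt n"
  shows "cmod ((\<integral>\<omega>. \<i> * Z \<omega> * iexp (t * Z \<omega>) \<partial>M) + of_real ((\<integral>\<omega>. (Z \<omega>)\<^sup>2 \<partial>M) * t) * (\<integral>\<omega>. iexp (t * Z \<omega>) \<partial>M))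
     \<le> sqrt n * (48 * K * a m * (1 + T * (K * D) / sqrt n)) + 4 * K * (T * (K * D))\<^sup>2 / sqrt n
        + 8 * T * K\<^sup>2 * (\<Sum>k. if k \<le> m then 0 else a k)"
proof -
  define r where "r = sqrt (real n)"
  have r0: "0 < r" and rr: "r * r = real n" using n by (auto simp: r_def)
  define \<tau> where "\<tau> = t / r"
  define S where "S = psum {1..n}"
  define C where "C k = {j\<in>{1..n}. lag k j \<le> m}" for k
  define \<phi> where "\<phi> = (\<integral>\<omega>. iexp (\<tau> * S \<omega>) \<partial>M)"
  define q where "q k = (\<integral>\<omega>. V k \<omega> * psum (C k) \<omega> \<partial>M)" for k
  define Q where "Q = (\<Sum>k\<in>{1..n}. q k)"
  define tail where "tail = (\<Sum>k. if k \<le> m then 0 else a k)"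
  define err where "err = 48 * K * a m * (1 + \<bar>\<tau>\<bar> * (K * D)) + 4 * K * (\<tau> * (K * D))\<^sup>2"
  have Sm[measurable]: "S \<in> borel_measurable M" unfolding S_def by measurable
  have tz: "t * Z \<omega> = \<tau> * S \<omega>" for \<omega> by (simp add: Z_def \<tau>_def S_def r_def)
  have iVe: "integrable M (\<lambda>\<omega>. V k \<omega> * iexp (\<tau> * S \<omega>))" for k
    using V_bounded by (intro integrable_bounded[where c=K]) (auto simp: norm_mult)
  have iVV: "integrable M (\<lambda>\<omega>. V i \<omega> * V j \<omega>)" for i j
    using V_bounded K_nonneg by (intro integrable_bounded[where c="K * K"]) (auto simp: abs_mult intro!: mult_mono)
  have cov: "(\<integral>\<omega>. V i \<omega> * V j \<omega> \<partial>M) = covar (V i) (V j)" for i j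
    by (simp add: covar_def V_centered)
  have covb: "\<bar>covar (V i) (V j)\<bar> \<le> 4 * K\<^sup>2 * a (lag i j)" for i j
    using V_bounded by (intro covar_bounded)
  have tail_summable: "summable (\<lambda>l. if l \<le> m then 0 else a l)"
    by (rule summable_comparison_test'[OF sum_a, of 0]) (auto simp: rate_nonneg)
  have tail0: "0 \<le> tail" unfolding tail_def by (intro suminf_nonneg tail_summable) (auto simp: rate_nonneg)
  have T0: "0 \<le> T" using t by linarith
  have ES: "(\<integral>\<omega>. S \<omega> * iexp (\<tau> * S \<omega>) \<partial>M) = (\<Sum>k\<in>{1..n}. \<integral>\<omega>. V k \<omega> * iexp (\<tau> * S \<omega>) \<partial>M)"
  proof -
    have "S \<omega> * iexp (\<tau> * S \<omega>) = (\<Sum>k\<in>{1..n}. V k \<omega> * iexp (\<tau> * S \<omega>))" for \<omega>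
      by (simp add: S_def psum_def sum_distrib_right)
    then show ?thesis using iVe by (simp add: Bochner_Integration.integral_sum)
  qed
  have e1: "cmod ((\<integral>\<omega>. S \<omega> * iexp (\<tau> * S \<omega>) \<partial>M) - \<i> * \<tau> * Q * \<phi>) \<le> real n * err"
  proof -
    have "(\<integral>\<omega>. S \<omega> * iexp (\<tau> * S \<omega>) \<partial>M) - \<i> * \<tau> * Q * \<phi>
        = (\<Sum>k\<in>{1..n}. (\<integral>\<omega>. V k \<omega> * iexp (\<tau> * S \<omega>) \<partial>M) - \<i> * \<tau> * q k * \<phi>)"
      unfolding ES Q_def by (simp add: sum_subtractf sum_distrib_left sum_distrib_right)
    also have "cmod \<dots> \<le> (\<Sum>k\<in>{1..n}. err)"
      unfolding S_def \<phi>_def q_def C_def err_def D_def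
      by (intro order_trans[OF norm_sum] sum_mono stein_term)
    finally show ?thesis by simp
  qed
  have qk: "q k = (\<Sum>j\<in>{1..n}. if lag k j \<le> m then covar (V k) (V j) else 0)" for k
  proof -
    have "V k \<omega> * psum (C k) \<omega> = (\<Sum>j\<in>C k. V k \<omega> * V j \<omega>)" for \<omega>
      by (simp add: psum_def sum_distrib_left)
    then have "q k = (\<Sum>j\<in>C k. covar (V k) (V j))"
      unfolding q_def using iVV by (simp add: Bochner_Integration.integral_sum cov)
    then show ?thesis
      unfolding C_def using sum.inter_filter[of "{1..n}" "\<lambda>j. covar (V k) (V j)" "\<lambda>j. lag k j \<le> m"] by simp
  qed
  have S2: "(\<integral>\<omega>. (S \<omega>)\<^sup>2 \<partial>M) = (\<Sum>k\<in>{1..n}. \<Sum>j\<in>{1..n}. covar (V k) (V j))"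
  proof -
    have "(S \<omega>)\<^sup>2 = (\<Sum>k\<in>{1..n}. \<Sum>j\<in>{1..n}. V k \<omega> * V j \<omega>)" for \<omega>
      by (simp add: S_def psum_def power2_eq_square sum_product)
    then show ?thesis using iVV by (simp add: Bochner_Integration.integral_sum cov)
  qed
  have e2: "\<bar>(\<integral>\<omega>. (S \<omega>)\<^sup>2 \<partial>M) - Q\<bar> \<le> 8 * K\<^sup>2 * real n * tail"
  proof -
    have "(\<integral>\<omega>. (S \<omega>)\<^sup>2 \<partial>M) - Q = (\<Sum>k\<in>{1..n}. \<Sum>j\<in>{1..n}. if lag k j \<le> m then 0 else covar (V k) (V j))"
      unfolding S2 Q_def qk sum_subtractf[symmetric] by (intro sum.cong) auto
    also have "\<bar>\<dots>\<bar> \<le> (\<Sum>k\<in>{1..n}. \<Sum>j\<in>{1..n}. 4 * K\<^sup>2 * (if lag k j \<le> m then 0 else a (lag k j)))"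
      using covb by (intro order_trans[OF sum_abs] sum_mono) auto
    also have "\<dots> = 4 * K\<^sup>2 * (\<Sum>k\<in>{1..n}. \<Sum>j\<in>{1..n}. if lag k j \<le> m then 0 else a (lag k j))"
      by (simp add: sum_distrib_left)
    also have "\<dots> \<le> 4 * K\<^sup>2 * (2 * real n * tail)"
      unfolding tail_def
      by (intro mult_left_mono lag_double_sum_le_suminf[where c="\<lambda>l. if l \<le> m then 0 else a l"] tail_summable)
         (auto simp: rate_nonneg)
    finally show ?thesis by simp
  qed
  have phi1: "cmod \<phi> \<le> 1" unfolding \<phi>_def by (rule norm_expectation_le) auto
  have Z2: "(\<integral>\<omega>. (Z \<omega>)\<^sup>2 \<partial>M) = (\<integral>\<omega>. (S \<omega>)\<^sup>2 \<partial>M) / real n"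
    by (simp add: Z_def S_def power_divide)
  have IZ: "(\<integral>\<omega>. \<i> * Z \<omega> * iexp (t * Z \<omega>) \<partial>M) = \<i> / r * (\<integral>\<omega>. S \<omega> * iexp (\<tau> * S \<omega>) \<partial>M)"
  proof -
    have "\<i> * Z \<omega> * iexp (t * Z \<omega>) = \<i> / r * (S \<omega> * iexp (\<tau> * S \<omega>))" for \<omega>
      unfolding tz by (simp add: Z_def S_def r_def)
    then show ?thesis by simp
  qed
  define x where "x = (\<integral>\<omega>. S \<omega> * iexp (\<tau> * S \<omega>) \<partial>M)"
  define s where "s = (\<integral>\<omega>. (S \<omega>)\<^sup>2 \<partial>M)"
  have "(\<integral>\<omega>. \<i> * Z \<omega> * iexp (t * Z \<omega>) \<partial>M) + of_real ((\<integral>\<omega>. (Z \<omega>)\<^sup>2 \<partial>M) * t) * (\<integral>\<omega>. iexp (t * Z \<omega>) \<partial>M)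
      = \<i> / r * x + of_real (s / real n * t) * \<phi>"
  proof (rule arg_cong2[where f="(+)"])
    show "(\<integral>\<omega>. \<i> * Z \<omega> * iexp (t * Z \<omega>) \<partial>M) = \<i> / r * x" unfolding x_def by (rule IZ)
  qed (simp add: Z2 s_def \<phi>_def tz del: of_real_mult)
  also have "\<dots> = \<i> / r * (x - \<i> * \<tau> * Q * \<phi>) + of_real ((s - Q) * (t / real n)) * \<phi>"
  proof -
    \<comment> \<open>The two factors \<open>\<i>\<close> produce the minus sign that makes the
      equation a Gaussian one.\<close>
    have "\<i> / r * (\<i> * \<tau> * Q * \<phi>) = - of_real (Q * (t / (r * r))) * \<phi>"
      by (simp add: \<tau>_def algebra_simps)
    then show ?thesis unfolding rr by (simp add: algebra_simps diff_divide_distrib)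
  qed
  also have "cmod \<dots> \<le> 1 / r * cmod (x - \<i> * \<tau> * Q * \<phi>) + \<bar>s - Q\<bar> * (\<bar>t\<bar> / real n) * cmod \<phi>"
    using r0 by (intro order_trans[OF norm_triangle_ineq] add_mono) (simp_all add: norm_mult norm_divide abs_mult flip: of_real_diff)
  also have "\<dots> \<le> 1 / r * (real n * err) + (8 * K\<^sup>2 * real n * tail) * (T / real n) * 1"
    using e1 e2 phi1 t r0 tail0 T0 unfolding x_def s_def
    by (intro add_mono mult_left_mono mult_mono divide_right_mono) auto
  also have "\<dots> = r * err + 8 * T * K\<^sup>2 * tail"
    using n r0 by (simp add: rr[symmetric])
  also have "\<dots> \<le> (r * (48 * K * a m * (1 + T * (K * D) / r)) + 4 * K * (T * (K * D))\<^sup>2 / r) + 8 * T * K\<^sup>2 * tail"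
  proof -
    have KD: "0 \<le> K * D" using K_nonneg by (simp add: D_def)
    have "\<bar>\<tau>\<bar> * (K * D) \<le> T * (K * D) / r"
      using t r0 KD by (simp add: \<tau>_def divide_right_mono mult_right_mono)
    then have A: "r * (48 * K * a m * (1 + \<bar>\<tau>\<bar> * (K * D))) \<le> r * (48 * K * a m * (1 + T * (K * D) / r))"
      using r0 K_nonneg rate_nonneg[of m] by (intro mult_left_mono add_left_mono) auto
    have "t\<^sup>2 \<le> T\<^sup>2" using t T0 by (simp add: abs_le_square_iff[symmetric])
    then have "4 * K * (t\<^sup>2 * (K * D)\<^sup>2) / r \<le> 4 * K * (T\<^sup>2 * (K * D)\<^sup>2) / r"
      using r0 K_nonneg by (intro divide_right_mono mult_left_mono mult_right_mono) auto
    moreover have "r * (4 * K * (\<tau> * (K * D))\<^sup>2) = 4 * K * (t\<^sup>2 * (K * D)\<^sup>2) / r"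
      using r0 by (simp add: \<tau>_def power_mult_distrib power_divide power2_eq_square[of r])
    ultimately have B: "r * (4 * K * (\<tau> * (K * D))\<^sup>2) \<le> 4 * K * (T * (K * D))\<^sup>2 / r"
      by (simp add: power_mult_distrib)
    show ?thesis using A B unfolding err_def by (simp add: distrib_left)
  qed
  finally show ?thesis unfolding r_def tail_def by simp
qed

end

section \<open>Truncation\<close>

lemma summable_shifted_powr:
  assumes "s < -1"
  shows "summable (\<lambda>k. real (k + 1) powr s)"
proof -
  have "summable (\<lambda>n. real n powr s)" using assms by (simp add: summable_real_powr_iff)
  then show ?thesis using summable_iff_shift[of "\<lambda>n. real n powr s" 1] by simp
qed

lemma tail_sum_tendsto_0:
  fixes a :: "nat \<Rightarrow> real"
  assumes a: "summable a"
  shows "(\<lambda>m. \<Sum>k. if k \<le> m then 0 else a k) \<longlonglongrightarrow> 0"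
proof -
  have eq: "(\<Sum>k. if k \<le> m then 0 else a k) = suminf a - sum a {..m}" for m
  proof -
    have "(\<lambda>k. if k \<in> {..m} then a k else 0) sums sum a {..m}"
      by (rule sums_If_finite_set) simp
    then have "(\<lambda>k. a k - (if k \<in> {..m} then a k else 0)) sums (suminf a - sum a {..m})"
      by (intro sums_diff summable_sums a)
    moreover have "(\<lambda>k. a k - (if k \<in> {..m} then a k else 0)) = (\<lambda>k. if k \<le> m then 0 else a k)"
      by auto
    ultimately show ?thesis by (simp add: sums_iff)
  qed
  have "(\<lambda>m. suminf a - sum a {..m}) \<longlonglongrightarrow> suminf a - suminf a"
    by (intro tendsto_intros summable_LIMSEQ' a)
  then show ?thesis unfolding eq by simp
qed

lemma (in bounded_mixing) char_approx:
  assumes a: "a = (\<lambda>k. c * real (k + 1) powr (-\<theta>))" and \<theta>: "\<theta> > 2"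
  defines "Z \<equiv> \<lambda>n \<omega>. psum {1..n} \<omega> / sqrt (real n)"
  shows "(\<lambda>n. (\<integral>\<omega>. iexp (t * Z n \<omega>) \<partial>M) - of_real (exp (- (\<integral>\<omega>. (Z n \<omega>)\<^sup>2 \<partial>M) * t\<^sup>2 / 2))) \<longlonglongrightarrow> 0"
proof -
  \<comment> \<open>\<open>\<beta>\<close> is the midpoint of \<open>1 / (2 * \<theta>)\<close> and
    \<open>1/4\<close>. Being above the first makes \<open>sqrt n * a (m n)\<close> vanish, being
    below the second \<open>(m n)^2 / sqrt n\<close>; the interval is nonempty since
    \<open>\<theta> > 2\<close>.\<close>
  define \<beta> where "\<beta> = (1/4 + 1 / (2 * \<theta>)) / 2"
  have \<beta>0: "0 < \<beta>" and \<beta>1: "2 * \<beta> < 1 / 2" and \<beta>2: "1 / 2 < \<beta> * \<theta>"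
    using \<theta> by (auto simp: \<beta>_def field_simps)
  define m where "m n = nat \<lfloor>real n powr \<beta>\<rfloor>" for n
  have m1: "real (m n) \<le> real n powr \<beta>" and m2: "real n powr \<beta> \<le> real (m n + 1)" for n
  proof -
    have "real (m n) = of_int \<lfloor>real n powr \<beta>\<rfloor>" by (simp add: m_def)
    then show "real (m n) \<le> real n powr \<beta>" "real n powr \<beta> \<le> real (m n + 1)" by linarith+
  qed
  have c0: "0 \<le> c" using rate_nonneg[of 0] by (simp add: a)
  have sum_a: "summable a" unfolding a using \<theta> by (intro summable_mult summable_shifted_powr) simp
  define T where "T = \<bar>t\<bar>"
  define tail where "tail j = (\<Sum>k. if k \<le> j then 0 else a k)" for j
  \<comment> \<open>The bound of \<open>char_ode_estimate\<close> for the window \<open>m n\<close>,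
    with \<open>4 * m n + 1 \<le> 5 * n powr \<beta>\<close>; hence the 5, and the 100 as
    \<open>4 * 5^2\<close>.\<close>
  define \<delta> where "\<delta> n = 48 * K * c * real n powr (1/2 - \<beta> * \<theta>) * (1 + 5 * T * K * real n powr (\<beta> - 1/2))
      + 100 * K^3 * T\<^sup>2 * real n powr (2 * \<beta> - 1/2) + 8 * T * K\<^sup>2 * tail (m n)" for n
  have bound: "cmod ((\<integral>\<omega>. iexp (t * Z n \<omega>) \<partial>M) - of_real (exp (- (\<integral>\<omega>. (Z n \<omega>)\<^sup>2 \<partial>M) * t\<^sup>2 / 2))) \<le> T * \<delta> n"
    if n: "n \<ge> 1" for n
    unfolding T_def
  proof (rule gaussian_ode_stability[where \<phi>'="\<lambda>u. \<integral>\<omega>. \<i> * Z n \<omega> * iexp (u * Z n \<omega>) \<partial>M"])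
    define N where "N = real n"
    define D where "D = real (4 * m n + 1)"
    have N1: "1 \<le> N" and N0: "0 < N" using n by (auto simp: N_def)
    have Zm[measurable]: "Z n \<in> borel_measurable M" unfolding Z_def by measurable
    have Zb: "\<bar>Z n \<omega>\<bar> \<le> K * real n / sqrt (real n)" if "\<omega> \<in> space M" for \<omega>
      unfolding Z_def using abs_psum_le[OF that, of "{1..n}" n] by (simp add: divide_right_mono)
    show "((\<lambda>u. \<integral>\<omega>. iexp (u * Z n \<omega>) \<partial>M) has_vector_derivative (\<integral>\<omega>. \<i> * Z n \<omega> * iexp (u * Z n \<omega>) \<partial>M)) (at u)" for u
      by (rule char_has_vector_derivative[OF Zm Zb])
    show "(\<integral>\<omega>. iexp (0 * Z n \<omega>) \<partial>M) = 1" by (simp add: prob_space)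
    show "0 \<le> (\<integral>\<omega>. (Z n \<omega>)\<^sup>2 \<partial>M)" by simp
    fix u assume u: "\<bar>u\<bar> \<le> \<bar>t\<bar>"
    have sq: "sqrt N = N powr (1/2)" using N0 by (simp add: powr_half_sqrt)
    have Dle: "D \<le> 5 * N powr \<beta>"
    proof -
      have "1 \<le> N powr \<beta>" using N1 \<beta>0 by (simp add: ge_one_powr_ge_zero)
      then show ?thesis using m1[of n] by (simp add: D_def N_def)
    qed
    have D0: "0 \<le> D" by (simp add: D_def)
    have am: "a (m n) \<le> c * N powr (- (\<beta> * \<theta>))"
    proof -
      have "real (m n + 1) powr (-\<theta>) \<le> (N powr \<beta>) powr (-\<theta>)"
        using m2[of n] \<theta> N0 by (intro powr_mono2') (auto simp: N_def)
      then show ?thesis unfolding a using c0 by (simp add: powr_powr mult_left_mono)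
    qed
    have K0: "0 \<le> K" by (rule K_nonneg)
    have T0: "0 \<le> T" by (simp add: T_def)
    have 1: "sqrt N * (48 * K * a (m n) * (1 + T * (K * D) / sqrt N))
        \<le> 48 * K * c * N powr (1/2 - \<beta> * \<theta>) * (1 + 5 * T * K * N powr (\<beta> - 1/2))"
    proof -
      have "T * (K * D) / sqrt N \<le> T * (K * (5 * N powr \<beta>)) / sqrt N"
        using Dle K0 T0 N0 by (intro divide_right_mono mult_left_mono) auto
      also have "\<dots> = 5 * T * K * N powr (\<beta> - 1/2)"
        unfolding sq by (simp add: powr_diff)
      finally have x: "1 + T * (K * D) / sqrt N \<le> 1 + 5 * T * K * N powr (\<beta> - 1/2)" by simp
      have "sqrt N * (48 * K * a (m n)) \<le> sqrt N * (48 * K * (c * N powr (- (\<beta> * \<theta>))))"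
        using am K0 N0 by (intro mult_left_mono) auto
      also have "\<dots> = 48 * K * c * N powr (1/2 - \<beta> * \<theta>)"
      proof -
        have "N powr (1/2 - \<beta> * \<theta>) = N powr (1/2) * N powr (- (\<beta> * \<theta>))"
          by (simp add: powr_add[symmetric])
        then show ?thesis unfolding sq by (simp only: ac_simps)
      qed
      finally have y: "sqrt N * (48 * K * a (m n)) \<le> 48 * K * c * N powr (1/2 - \<beta> * \<theta>)" .
      have "sqrt N * (48 * K * a (m n)) * (1 + T * (K * D) / sqrt N)
          \<le> 48 * K * c * N powr (1/2 - \<beta> * \<theta>) * (1 + 5 * T * K * N powr (\<beta> - 1/2))"
        by (rule mult_mono[OF y x]) (use K0 c0 T0 D0 N0 in auto)
      then show ?thesis by (simp only: mult.assoc)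
    qed
    have 2: "4 * K * (T * (K * D))\<^sup>2 / sqrt N \<le> 100 * K^3 * T\<^sup>2 * N powr (2 * \<beta> - 1/2)"
    proof -
      have "(T * (K * D))\<^sup>2 \<le> (T * (K * (5 * N powr \<beta>)))\<^sup>2"
        using Dle K0 T0 D0 by (intro power_mono mult_left_mono) auto
      then have "4 * K * (T * (K * D))\<^sup>2 / sqrt N \<le> 4 * K * (T * (K * (5 * N powr \<beta>)))\<^sup>2 / sqrt N"
        using K0 N0 by (intro divide_right_mono mult_left_mono) auto
      also have "(N powr \<beta>)\<^sup>2 = N powr (2 * \<beta>)" using N0 by (simp add: powr_power mult.commute)
      then have "4 * K * (T * (K * (5 * N powr \<beta>)))\<^sup>2 / sqrt N = 100 * K^3 * T\<^sup>2 * N powr (2 * \<beta> - 1/2)"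
        unfolding sq by (simp add: power_mult_distrib powr_diff power3_eq_cube power2_eq_square[of K])
      finally show ?thesis .
    qed
    have "cmod ((\<integral>\<omega>. \<i> * Z n \<omega> * iexp (u * Z n \<omega>) \<partial>M) + of_real ((\<integral>\<omega>. (Z n \<omega>)\<^sup>2 \<partial>M) * u) * (\<integral>\<omega>. iexp (u * Z n \<omega>) \<partial>M))
      \<le> sqrt N * (48 * K * a (m n) * (1 + T * (K * D) / sqrt N)) + 4 * K * (T * (K * D))\<^sup>2 / sqrt N
        + 8 * T * K\<^sup>2 * tail (m n)"
      unfolding Z_def tail_def D_def N_def
      by (rule char_ode_estimate[OF n _ sum_a]) (use u in \<open>simp add: T_def\<close>)
    also have "\<dots> \<le> \<delta> n"
      using 1 2 unfolding \<delta>_def N_def[symmetric] by (intro add_mono) auto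
    finally show "cmod ((\<integral>\<omega>. \<i> * Z n \<omega> * iexp (u * Z n \<omega>) \<partial>M) + of_real ((\<integral>\<omega>. (Z n \<omega>)\<^sup>2 \<partial>M) * u) * (\<integral>\<omega>. iexp (u * Z n \<omega>) \<partial>M)) \<le> \<delta> n" .
  qed
  have np: "(\<lambda>n. real n powr s) \<longlonglongrightarrow> 0" if "s < 0" for s
    using that by (intro tendsto_neg_powr filterlim_real_sequentially)
  have minf: "filterlim m at_top sequentially"
  proof -
    have ev: "eventually (\<lambda>n. real (k + 1) \<le> real n powr \<beta>) sequentially" for k
    proof (rule eventually_sequentiallyI[of "nat \<lceil>real (k + 1) powr (1 / \<beta>)\<rceil>"])
      fix n assume "nat \<lceil>real (k + 1) powr (1 / \<beta>)\<rceil> \<le> n"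
      then have "real (k + 1) powr (1 / \<beta>) \<le> real n" by linarith
      then have "(real (k + 1) powr (1 / \<beta>)) powr \<beta> \<le> real n powr \<beta>"
        using \<beta>0 by (intro powr_mono2) auto
      then show "real (k + 1) \<le> real n powr \<beta>" using \<beta>0 by (simp add: powr_powr)
    qed
    have "eventually (\<lambda>n. k \<le> m n) sequentially" for k
      using ev[of k]
    proof eventually_elim
      case (elim n)
      then show ?case using m2[of n] by linarith
    qed
    then show ?thesis by (simp add: filterlim_at_top)
  qed
  have tail0: "(\<lambda>n. tail (m n)) \<longlonglongrightarrow> 0"
    using filterlim_compose[OF tail_sum_tendsto_0[OF sum_a] minf] unfolding tail_def .
  have "\<delta> \<longlonglongrightarrow> 48 * K * c * 0 * (1 + 5 * T * K * 0) + 100 * K^3 * T\<^sup>2 * 0 + 8 * T * K\<^sup>2 * 0"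
    unfolding \<delta>_def using \<beta>1 \<beta>2 \<beta>0 by (intro tendsto_intros np tail0) auto
  then have "(\<lambda>n. T * \<delta> n) \<longlonglongrightarrow> T * 0" by (intro tendsto_intros) simp
  then have lim: "(\<lambda>n. T * \<delta> n) \<longlonglongrightarrow> 0" by simp
  show ?thesis
    by (rule Lim_null_comparison[OF _ lim]) (use bound in \<open>auto intro!: eventually_sequentiallyI[of 1]\<close>)
qed

section \<open>Truncation of a single variable\<close>

definition truncate :: "real \<Rightarrow> real \<Rightarrow> real" where "truncate L x = max (- L) (min x L)"

lemma truncate_measurable [measurable]: "truncate L \<in> borel_measurable borel"
  unfolding truncate_def[abs_def] by measurable

lemma abs_truncate_le: "0 \<le> L \<Longrightarrow> \<bar>truncate L x\<bar> \<le> L" "0 \<le> L \<Longrightarrow> \<bar>truncate L x\<bar> \<le> \<bar>x\<bar>"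
  and abs_diff_truncate_le: "0 \<le> L \<Longrightarrow> \<bar>x - truncate L x\<bar> \<le> \<bar>x\<bar>"
  by (auto simp: truncate_def)

text \<open>Beyond the level \<open>L\<close> the factor \<open>\<bar>x\<bar> powr (s - r)\<close>,
  whose exponent is not positive, is at most its value at \<open>L\<close>.\<close>

lemma powr_truncation:
  fixes x :: real
  assumes "0 < L" "s \<le> r" "L < \<bar>x\<bar>"
  shows "\<bar>x\<bar> powr s \<le> L powr (s - r) * \<bar>x\<bar> powr r"
proof -
  have "\<bar>x\<bar> powr s = \<bar>x\<bar> powr (s - r) * \<bar>x\<bar> powr r"
    using powr_add[of "\<bar>x\<bar>" "s - r" r] by simp
  also have "\<dots> \<le> L powr (s - r) * \<bar>x\<bar> powr r"
    using assms by (intro mult_right_mono powr_mono2') auto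
  finally show ?thesis .
qed

lemma truncate_error_powr:
  assumes "0 < L" "0 < s" "s \<le> r"
  shows "\<bar>x - truncate L x\<bar> powr s \<le> L powr (s - r) * \<bar>x\<bar> powr r"
proof (cases "\<bar>x\<bar> \<le> L")
  case True
  then have "truncate L x = x" by (auto simp: truncate_def)
  then show ?thesis by simp
next
  case False
  have "\<bar>x - truncate L x\<bar> powr s \<le> \<bar>x\<bar> powr s"
    using assms abs_diff_truncate_le[of L x] by (intro powr_mono2) auto
  also have "\<dots> \<le> L powr (s - r) * \<bar>x\<bar> powr r" using assms False by (intro powr_truncation) auto
  finally show ?thesis .
qed

lemma truncate_error_square:
  assumes "0 < L" "2 \<le> r"
  shows "(x - truncate L x)\<^sup>2 \<le> L powr (2 - r) * \<bar>x\<bar> powr r"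
  using truncate_error_powr[of L 2 r x] assms by simp

lemma truncate_error_abs:
  assumes "0 < L" "1 \<le> r"
  shows "\<bar>x - truncate L x\<bar> \<le> L powr (1 - r) * \<bar>x\<bar> powr r"
  using truncate_error_powr[of L 1 r x] assms by simp

lemma powr_le_one_plus_powr:
  fixes x :: real
  assumes "0 \<le> s" "s \<le> r"
  shows "\<bar>x\<bar> powr s \<le> 1 + \<bar>x\<bar> powr r"
proof (cases "1 < \<bar>x\<bar>")
  case True
  then have "\<bar>x\<bar> powr s \<le> \<bar>x\<bar> powr r" using assms by (intro powr_mono) auto
  then show ?thesis by linarith
next
  case False
  then have "\<bar>x\<bar> powr s \<le> 1" using assms by (intro powr_le1) auto
  then show ?thesis by (rule order_trans) simp
qed

section \<open>Covariance bounds from moments\<close>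

context prob_space
begin

lemma moment_integrable:
  fixes X :: "'a \<Rightarrow> real"
  assumes [measurable]: "X \<in> borel_measurable M" and i: "integrable M (\<lambda>\<omega>. \<bar>X \<omega>\<bar> powr r)"
    and s: "0 < s" "s \<le> r"
  shows "integrable M (\<lambda>\<omega>. \<bar>X \<omega>\<bar> powr s)"
proof (rule Bochner_Integration.integrable_bound[where f="\<lambda>\<omega>. 1 + \<bar>X \<omega>\<bar> powr r"])
  show "AE \<omega> in M. norm (\<bar>X \<omega>\<bar> powr s) \<le> norm (1 + \<bar>X \<omega>\<bar> powr r)"
    using powr_le_one_plus_powr[of s r] s by (auto intro: order_trans[OF _ abs_ge_self])
qed (use i in auto)

lemma square_integrable_of_moment:
  fixes X :: "'a \<Rightarrow> real"
  assumes "X \<in> borel_measurable M" "integrable M (\<lambda>\<omega>. \<bar>X \<omega>\<bar> powr r)" "2 \<le> r"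
  shows "integrable M (\<lambda>\<omega>. (X \<omega>)\<^sup>2)"
  using moment_integrable[OF assms(1,2), of 2] assms(3) by simp

lemma covar_add_left:
  fixes X Y Z :: "'a \<Rightarrow> real"
  assumes "X \<in> borel_measurable M" "Y \<in> borel_measurable M" "Z \<in> borel_measurable M"
    "integrable M (\<lambda>\<omega>. (X \<omega>)\<^sup>2)" "integrable M (\<lambda>\<omega>. (Y \<omega>)\<^sup>2)" "integrable M (\<lambda>\<omega>. (Z \<omega>)\<^sup>2)"
  shows "covar (\<lambda>\<omega>. X \<omega> + Y \<omega>) Z = covar X Z + covar Y Z"
    and "covar Z (\<lambda>\<omega>. X \<omega> + Y \<omega>) = covar Z X + covar Z Y"
proof -
  have "integrable M X" "integrable M Y" "integrable M Z" using assms by (auto intro: square_integrable_imp_integrable)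
  moreover have "integrable M (\<lambda>\<omega>. X \<omega> * Z \<omega>)" "integrable M (\<lambda>\<omega>. Y \<omega> * Z \<omega>)"
    "integrable M (\<lambda>\<omega>. Z \<omega> * X \<omega>)" "integrable M (\<lambda>\<omega>. Z \<omega> * Y \<omega>)"
    using assms by (auto intro: integrable_product_if_squares)
  ultimately show "covar (\<lambda>\<omega>. X \<omega> + Y \<omega>) Z = covar X Z + covar Y Z"
    "covar Z (\<lambda>\<omega>. X \<omega> + Y \<omega>) = covar Z X + covar Z Y"
    by (simp_all add: covar_def algebra_simps)
qed

lemma covar_bounded_small:
  fixes X Z :: "'a \<Rightarrow> real"
  assumes [measurable]: "X \<in> borel_measurable M" "Z \<in> borel_measurable M"
    and X: "\<And>\<omega>. \<omega> \<in> space M \<Longrightarrow> \<bar>X \<omega>\<bar> \<le> L" and Z: "integrable M Z" "(\<integral>\<omega>. \<bar>Z \<omega>\<bar> \<partial>M) \<le> e"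
    and L: "0 \<le> L"
  shows "\<bar>covar X Z\<bar> \<le> 2 * L * e"
proof -
  have iXZ: "integrable M (\<lambda>\<omega>. X \<omega> * Z \<omega>)"
  proof (rule Bochner_Integration.integrable_bound[where f="\<lambda>\<omega>. L * \<bar>Z \<omega>\<bar>"])
    show "AE \<omega> in M. norm (X \<omega> * Z \<omega>) \<le> norm (L * \<bar>Z \<omega>\<bar>)"
      using X L by (intro AE_I2) (auto simp: abs_mult mult_right_mono)
  qed (use Z in auto)
  have "\<bar>\<integral>\<omega>. X \<omega> * Z \<omega> \<partial>M\<bar> \<le> (\<integral>\<omega>. \<bar>X \<omega> * Z \<omega>\<bar> \<partial>M)" by (rule integral_abs_bound)
  also have "\<dots> \<le> (\<integral>\<omega>. L * \<bar>Z \<omega>\<bar> \<partial>M)"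
    using X Z by (intro integral_mono integrable_abs iXZ) (auto simp: abs_mult mult_right_mono)
  also have "\<dots> \<le> L * e" using Z L by (simp add: mult_left_mono)
  finally have 1: "\<bar>\<integral>\<omega>. X \<omega> * Z \<omega> \<partial>M\<bar> \<le> L * e" .
  have "norm (\<integral>\<omega>. X \<omega> \<partial>M) \<le> L" using X L by (intro norm_expectation_le) auto
  moreover have "\<bar>\<integral>\<omega>. Z \<omega> \<partial>M\<bar> \<le> e" using integral_abs_bound[of M Z] Z(2) by linarith
  ultimately have "\<bar>(\<integral>\<omega>. X \<omega> \<partial>M) * (\<integral>\<omega>. Z \<omega> \<partial>M)\<bar> \<le> L * e"
    unfolding abs_mult using L by (intro mult_mono) auto
  with 1 show ?thesis unfolding covar_def by linarith
qed

text \<open>A covariance inequality of Davydov type with the level \<open>L\<close> left free for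
  later optimisation. Splitting both variables at \<open>L\<close> gives a bounded pair, two mixed
  pairs of at most \<open>2 * R * L powr (2 - r)\<close> each, and a pair of tails of at most
  \<open>R * L powr (2 - r)\<close>; the 6 rounds up the resulting 5.\<close>

lemma covar_moment_bound:
  fixes X Z :: "'a \<Rightarrow> real"
  assumes d: "decoupled M F G a"
    and X: "X \<in> borel_measurable F" and Z: "Z \<in> borel_measurable G"
    and r: "2 < r" and L: "0 < L"
    and iX: "integrable M (\<lambda>\<omega>. \<bar>X \<omega>\<bar> powr r)" "(\<integral>\<omega>. \<bar>X \<omega>\<bar> powr r \<partial>M) \<le> R"
    and iZ: "integrable M (\<lambda>\<omega>. \<bar>Z \<omega>\<bar> powr r)" "(\<integral>\<omega>. \<bar>Z \<omega>\<bar> powr r \<partial>M) \<le> R"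
  shows "\<bar>covar X Z\<bar> \<le> 4 * L\<^sup>2 * a + 6 * R * L powr (2 - r)"
proof -
  note sub = decoupledD(1,2)[OF d]
  have XM[measurable]: "X \<in> borel_measurable M" and ZM[measurable]: "Z \<in> borel_measurable M"
    using X Z sub by (auto intro: measurable_from_subalg)
  have tail: "integrable M (\<lambda>\<omega>. (U \<omega> - truncate L (U \<omega>))\<^sup>2)" "(\<integral>\<omega>. (U \<omega> - truncate L (U \<omega>))\<^sup>2 \<partial>M) \<le> R * L powr (2 - r)"
     "(\<integral>\<omega>. \<bar>U \<omega> - truncate L (U \<omega>)\<bar> \<partial>M) \<le> R * L powr (1 - r)" "integrable M (\<lambda>\<omega>. (truncate L (U \<omega>))\<^sup>2)"
     "integrable M (\<lambda>\<omega>. U \<omega> - truncate L (U \<omega>))"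
    if U[measurable]: "U \<in> borel_measurable M" and iU: "integrable M (\<lambda>\<omega>. \<bar>U \<omega>\<bar> powr r)" "(\<integral>\<omega>. \<bar>U \<omega>\<bar> powr r \<partial>M) \<le> R" for U
  proof -
    have i: "integrable M (\<lambda>\<omega>. L powr (s - r) * \<bar>U \<omega>\<bar> powr r)" for s using iU by simp
    show i1: "integrable M (\<lambda>\<omega>. (U \<omega> - truncate L (U \<omega>))\<^sup>2)"
      by (rule Bochner_Integration.integrable_bound[OF i[of 2]]) (use r L in \<open>auto intro!: AE_I2 truncate_error_square\<close>)
    show "integrable M (\<lambda>\<omega>. (truncate L (U \<omega>))\<^sup>2)"
      using abs_truncate_le(1)[of L] L by (intro integrable_bounded[where c="L\<^sup>2"]) (auto simp: abs_le_square_iff[symmetric])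
    show i3: "integrable M (\<lambda>\<omega>. U \<omega> - truncate L (U \<omega>))" by (rule square_integrable_imp_integrable[OF _ i1]) simp
    have "(\<integral>\<omega>. (U \<omega> - truncate L (U \<omega>))\<^sup>2 \<partial>M) \<le> (\<integral>\<omega>. L powr (2 - r) * \<bar>U \<omega>\<bar> powr r \<partial>M)"
      using r L by (intro integral_mono i1 i truncate_error_square) auto
    also have "\<dots> \<le> R * L powr (2 - r)"
      using mult_right_mono[OF iU(2), of "L powr (2 - r)"] by (simp add: mult.commute)
    finally show "(\<integral>\<omega>. (U \<omega> - truncate L (U \<omega>))\<^sup>2 \<partial>M) \<le> R * L powr (2 - r)" .
    have "(\<integral>\<omega>. \<bar>U \<omega> - truncate L (U \<omega>)\<bar> \<partial>M) \<le> (\<integral>\<omega>. L powr (1 - r) * \<bar>U \<omega>\<bar> powr r \<partial>M)"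
      using r L by (intro integral_mono integrable_abs i3 i truncate_error_abs) auto
    also have "\<dots> \<le> R * L powr (1 - r)"
      using mult_right_mono[OF iU(2), of "L powr (1 - r)"] by (simp add: mult.commute)
    finally show "(\<integral>\<omega>. \<bar>U \<omega> - truncate L (U \<omega>)\<bar> \<partial>M) \<le> R * L powr (1 - r)" .
  qed
  define X1 X2 Z1 Z2 where "X1 \<omega> = truncate L (X \<omega>)" and "X2 \<omega> = X \<omega> - truncate L (X \<omega>)"
    and "Z1 \<omega> = truncate L (Z \<omega>)" and "Z2 \<omega> = Z \<omega> - truncate L (Z \<omega>)" for \<omega>
  have [measurable]: "X1 \<in> borel_measurable M" "X2 \<in> borel_measurable M" "Z1 \<in> borel_measurable M" "Z2 \<in> borel_measurable M"
    unfolding X1_def[abs_def] X2_def[abs_def] Z1_def[abs_def] Z2_def[abs_def] by measurable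
  have XX: "X = (\<lambda>\<omega>. X1 \<omega> + X2 \<omega>)" "Z = (\<lambda>\<omega>. Z1 \<omega> + Z2 \<omega>)"
    by (auto simp: X1_def X2_def Z1_def Z2_def)
  note tX = tail[OF XM iX, folded X1_def X2_def] and tZ = tail[OF ZM iZ, folded Z1_def Z2_def]
  have iZsq: "integrable M (\<lambda>\<omega>. (Z \<omega>)\<^sup>2)" using iZ r by (intro square_integrable_of_moment[of Z r]) auto
  have "covar X Z = covar X1 Z + covar X2 Z"
    unfolding XX(1) by (intro covar_add_left(1)) (use tX iZsq in auto)
  also have "covar X1 Z = covar X1 Z1 + covar X1 Z2"
    unfolding XX(2) by (intro covar_add_left(2)) (use tX tZ in auto)
  also have "covar X2 Z = covar X2 Z1 + covar X2 Z2"
    unfolding XX(2) by (intro covar_add_left(2)) (use tX tZ in auto)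
  finally have split: "covar X Z = covar X1 Z1 + covar X1 Z2 + (covar X2 Z1 + covar X2 Z2)" .
  have b: "\<bar>X1 \<omega>\<bar> \<le> L" "\<bar>Z1 \<omega>\<bar> \<le> L" for \<omega> using abs_truncate_le L by (auto simp: X1_def Z1_def)
  have "X1 \<in> borel_measurable F" "Z1 \<in> borel_measurable G"
    unfolding X1_def[abs_def] Z1_def[abs_def] using X Z by measurable
  then have c1: "\<bar>covar X1 Z1\<bar> \<le> 4 * L * L * a"
    unfolding covar_def using b by (intro covariance_bounded[OF d])
  have LL: "L * (R * L powr (1 - r)) = R * L powr (2 - r)"
    using L powr_mult_base[of L "1 - r"] by (simp add: mult.left_commute)
  have c2: "\<bar>covar X1 Z2\<bar> \<le> 2 * L * (R * L powr (1 - r))"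
    using b L tZ by (intro covar_bounded_small) auto
  have "covar X2 Z1 = covar Z1 X2" by (simp add: covar_def mult.commute)
  moreover have "\<bar>covar Z1 X2\<bar> \<le> 2 * L * (R * L powr (1 - r))"
    using b L tX by (intro covar_bounded_small) auto
  ultimately have c3: "\<bar>covar X2 Z1\<bar> \<le> 2 * L * (R * L powr (1 - r))" by simp
  have c4: "\<bar>covar X2 Z2\<bar> \<le> R * L powr (2 - r)"
    using tX tZ by (intro covar_le_second_moments) auto
  have "0 \<le> (\<integral>\<omega>. (X2 \<omega>)\<^sup>2 \<partial>M)" by simp
  then have "0 \<le> R * L powr (2 - r)" using tX(2) by linarith
  then show ?thesis
    using c1 c2 c3 c4 LL unfolding split by (simp add: power2_eq_square mult.assoc)
qed

end

lemma mixing_rate_mono: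
  assumes "mixing M V a" "\<And>n. a n \<le> b n"
  shows "mixing M V b"
proof -
  interpret mixing M V a by fact
  show ?thesis
    by unfold_locales (auto intro!: decoupled_mono[OF decoupled] assms(2))
qed

section \<open>The central limit theorem\<close>

context prob_space
begin

text \<open>Both halves of the pointwise bound
  \<open>\<bar>W\<bar> \<le> (\<delta> + W^2 / \<delta>) / 2\<close> have mean at most
  \<open>\<delta> / 2\<close>.\<close>

lemma expectation_abs_le_of_square:
  fixes W :: "'a \<Rightarrow> real"
  assumes [measurable]: "W \<in> borel_measurable M" and i: "integrable M (\<lambda>\<omega>. (W \<omega>)\<^sup>2)"
    and b: "(\<integral>\<omega>. (W \<omega>)\<^sup>2 \<partial>M) \<le> \<delta>\<^sup>2" and \<delta>: "0 < \<delta>"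
  shows "(\<integral>\<omega>. \<bar>W \<omega>\<bar> \<partial>M) \<le> \<delta>"
proof -
  have iW: "integrable M W" using i by (rule square_integrable_imp_integrable[rotated]) simp
  have "(\<integral>\<omega>. \<bar>W \<omega>\<bar> \<partial>M) \<le> (\<integral>\<omega>. (\<delta> + (W \<omega>)\<^sup>2 / \<delta>) / 2 \<partial>M)"
  proof (intro integral_mono integrable_abs iW)
    show "integrable M (\<lambda>\<omega>. (\<delta> + (W \<omega>)\<^sup>2 / \<delta>) / 2)" using i by auto
    show "\<bar>W \<omega>\<bar> \<le> (\<delta> + (W \<omega>)\<^sup>2 / \<delta>) / 2" for \<omega>
      using sum_squares_bound[of \<delta> "\<bar>W \<omega>\<bar>"] \<delta> by (simp add: field_simps power2_eq_square)
  qed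
  also have "\<dots> = (\<delta> + (\<integral>\<omega>. (W \<omega>)\<^sup>2 \<partial>M) / \<delta>) / 2" using i by (simp add: prob_space)
  also have "\<dots> \<le> (\<delta> + \<delta>\<^sup>2 / \<delta>) / 2" using b \<delta> by (intro divide_right_mono add_left_mono) auto
  also have "\<dots> = \<delta>" using \<delta> by (simp add: power2_eq_square)
  finally show ?thesis .
qed

lemma char_perturb:
  fixes Z Z' :: "'a \<Rightarrow> real"
  assumes [measurable]: "Z \<in> borel_measurable M" "Z' \<in> borel_measurable M"
    and i: "integrable M (\<lambda>\<omega>. (Z \<omega> - Z' \<omega>)\<^sup>2)"
    and b: "(\<integral>\<omega>. (Z \<omega> - Z' \<omega>)\<^sup>2 \<partial>M) \<le> \<delta>\<^sup>2" and \<delta>: "0 < \<delta>"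
  shows "cmod ((\<integral>\<omega>. iexp (t * Z \<omega>) \<partial>M) - (\<integral>\<omega>. iexp (t * Z' \<omega>) \<partial>M)) \<le> \<bar>t\<bar> * \<delta>"
proof -
  have iE: "integrable M (\<lambda>\<omega>. iexp (t * Z \<omega>))" "integrable M (\<lambda>\<omega>. iexp (t * Z' \<omega>))"
    by (auto intro!: integrable_bounded[where c=1])
  have iW: "integrable M (\<lambda>\<omega>. Z \<omega> - Z' \<omega>)" using i by (rule square_integrable_imp_integrable[rotated]) simp
  have "(\<integral>\<omega>. iexp (t * Z \<omega>) \<partial>M) - (\<integral>\<omega>. iexp (t * Z' \<omega>) \<partial>M) = (\<integral>\<omega>. iexp (t * Z \<omega>) - iexp (t * Z' \<omega>) \<partial>M)"
    using iE by simp
  also have "cmod \<dots> \<le> (\<integral>\<omega>. cmod (iexp (t * Z \<omega>) - iexp (t * Z' \<omega>)) \<partial>M)" by simp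
  also have "\<dots> \<le> (\<integral>\<omega>. \<bar>t\<bar> * \<bar>Z \<omega> - Z' \<omega>\<bar> \<partial>M)"
  proof (intro integral_mono integrable_norm Bochner_Integration.integrable_diff iE)
    show "integrable M (\<lambda>\<omega>. \<bar>t\<bar> * \<bar>Z \<omega> - Z' \<omega>\<bar>)" using iW by auto
    show "cmod (iexp (t * Z \<omega>) - iexp (t * Z' \<omega>)) \<le> \<bar>t\<bar> * \<bar>Z \<omega> - Z' \<omega>\<bar>" for \<omega>
      using cmod_iexp_diff_le[of "t * Z \<omega>" "t * Z' \<omega>"] by (simp only: right_diff_distrib[symmetric] abs_mult)
  qed
  also have "\<dots> \<le> \<bar>t\<bar> * \<delta>"
    using expectation_abs_le_of_square[OF _ i b \<delta>] by (simp add: mult_left_mono)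
  finally show ?thesis .
qed

text \<open>The cross term in \<open>Z^2 - Z'^2 = 2 * W * Z - W^2\<close> is split by a mean
  inequality with weight \<open>\<delta>\<close>, so the bound is in terms of the second moment of
  \<open>Z\<close> alone. The three parts are \<open>\<delta> * B\<close>, \<open>\<delta>\<close>
  and \<open>\<delta>^2 \<le> \<delta>\<close>.\<close>

lemma second_moment_perturb:
  fixes Z Z' :: "'a \<Rightarrow> real"
  assumes [measurable]: "Z \<in> borel_measurable M" "Z' \<in> borel_measurable M"
    and iZ: "integrable M (\<lambda>\<omega>. (Z \<omega>)\<^sup>2)" and iZ': "integrable M (\<lambda>\<omega>. (Z' \<omega>)\<^sup>2)"
    and i: "integrable M (\<lambda>\<omega>. (Z \<omega> - Z' \<omega>)\<^sup>2)"
    and b: "(\<integral>\<omega>. (Z \<omega> - Z' \<omega>)\<^sup>2 \<partial>M) \<le> \<delta>\<^sup>2" and \<delta>: "0 < \<delta>" "\<delta> \<le> 1"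
    and B: "(\<integral>\<omega>. (Z \<omega>)\<^sup>2 \<partial>M) \<le> B"
  shows "\<bar>(\<integral>\<omega>. (Z \<omega>)\<^sup>2 \<partial>M) - (\<integral>\<omega>. (Z' \<omega>)\<^sup>2 \<partial>M)\<bar> \<le> \<delta> * (B + 2)"
proof -
  define W where "W \<omega> = Z \<omega> - Z' \<omega>" for \<omega>
  have iW: "integrable M (\<lambda>\<omega>. (W \<omega>)\<^sup>2)" using i by (simp add: W_def)
  have bW: "(\<integral>\<omega>. (W \<omega>)\<^sup>2 \<partial>M) \<le> \<delta>\<^sup>2" using b by (simp add: W_def)
  have pt: "\<bar>(Z \<omega>)\<^sup>2 - (Z' \<omega>)\<^sup>2\<bar> \<le> \<delta> * (Z \<omega>)\<^sup>2 + (W \<omega>)\<^sup>2 / \<delta> + (W \<omega>)\<^sup>2" for \<omega>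
  proof -
    have "(Z \<omega>)\<^sup>2 - (Z' \<omega>)\<^sup>2 = 2 * W \<omega> * Z \<omega> - (W \<omega>)\<^sup>2"
      by (simp add: W_def power2_eq_square algebra_simps)
    then have "\<bar>(Z \<omega>)\<^sup>2 - (Z' \<omega>)\<^sup>2\<bar> \<le> 2 * (\<bar>W \<omega>\<bar> * \<bar>Z \<omega>\<bar>) + (W \<omega>)\<^sup>2"
      using abs_triangle_ineq4[of "2 * W \<omega> * Z \<omega>" "(W \<omega>)\<^sup>2"] by (simp add: abs_mult)
    moreover have "2 * (\<bar>W \<omega>\<bar> * \<bar>Z \<omega>\<bar>) \<le> \<delta> * (Z \<omega>)\<^sup>2 + (W \<omega>)\<^sup>2 / \<delta>"
      using sum_squares_bound[of "\<delta> * \<bar>Z \<omega>\<bar>" "\<bar>W \<omega>\<bar>"] \<delta> by (simp add: field_simps power2_eq_square)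
    ultimately show ?thesis by linarith
  qed
  have "\<bar>(\<integral>\<omega>. (Z \<omega>)\<^sup>2 \<partial>M) - (\<integral>\<omega>. (Z' \<omega>)\<^sup>2 \<partial>M)\<bar> = \<bar>\<integral>\<omega>. (Z \<omega>)\<^sup>2 - (Z' \<omega>)\<^sup>2 \<partial>M\<bar>"
    using iZ iZ' by simp
  also have "\<dots> \<le> (\<integral>\<omega>. \<bar>(Z \<omega>)\<^sup>2 - (Z' \<omega>)\<^sup>2\<bar> \<partial>M)" by (rule integral_abs_bound)
  also have "\<dots> \<le> (\<integral>\<omega>. \<delta> * (Z \<omega>)\<^sup>2 + (W \<omega>)\<^sup>2 / \<delta> + (W \<omega>)\<^sup>2 \<partial>M)"
    using iZ iZ' iW by (intro integral_mono integrable_abs pt) auto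
  also have "\<dots> = \<delta> * (\<integral>\<omega>. (Z \<omega>)\<^sup>2 \<partial>M) + (\<integral>\<omega>. (W \<omega>)\<^sup>2 \<partial>M) / \<delta> + (\<integral>\<omega>. (W \<omega>)\<^sup>2 \<partial>M)"
    using iZ iW by simp
  also have "\<dots> \<le> \<delta> * B + \<delta>\<^sup>2 / \<delta> + \<delta>\<^sup>2"
    using B bW \<delta> by (intro add_mono mult_left_mono divide_right_mono) auto
  also have "\<dots> \<le> \<delta> * (B + 2)"
    using \<delta> mult_left_mono[of \<delta> 1 \<delta>] by (simp add: power2_eq_square algebra_simps)
  finally show ?thesis .
qed

lemma centered_sum_diff:
  assumes "\<And>k. integrable M (U k)" "\<And>k. integrable M (V k)"
  shows "centered_sum M (\<lambda>k \<omega>. U k \<omega> - V k \<omega>) n \<omega> = centered_sum M U n \<omega> - centered_sum M V n \<omega>"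
  using assms by (simp add: centered_sum_def sum_subtractf[symmetric] algebra_simps)

end

lemma abs_exp_minus_diff_le:
  fixes x y :: real
  assumes "0 \<le> x" "0 \<le> y"
  shows "\<bar>exp (- x) - exp (- y)\<bar> \<le> \<bar>x - y\<bar>"
proof -
  have *: "exp (- x) - exp (- y) \<le> y - x" if "0 \<le> x" "x \<le> y" for x y :: real
  proof -
    have "exp (- x) - exp (- y) = exp (- x) * (1 - exp (- (y - x)))"
      by (simp add: algebra_simps flip: exp_add)
    also have "\<dots> \<le> 1 * (y - x)"
      using that exp_ge_add_one_self[of "x - y"] by (intro mult_mono) (auto simp: algebra_simps)
    finally show ?thesis by simp
  qed
  show ?thesis
    using *[of x y] *[of y x] assms by (cases "x \<le> y") (auto simp: abs_if)
qed

text \<open>\<open>\<theta> * (1 - 2 / r)\<close> is the exponent at which covariances decay in the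
  lag. It exceeds 2 so that half of it, which is what remains in
  \<open>truncation_error_variance\<close>, still gives a summable series.\<close>

locale moment_mixing = mixing M V "\<lambda>k. c * real (k + 1) powr (-\<theta>)" for M :: "'a measure" and V c \<theta> +
  fixes r R :: real
  assumes r: "2 < r" and \<kappa>: "2 < \<theta> * (1 - 2 / r)"
    and moment_int: "\<And>k. integrable M (\<lambda>\<omega>. \<bar>V k \<omega>\<bar> powr r)"
    and moment_le: "\<And>k. (\<integral>\<omega>. \<bar>V k \<omega>\<bar> powr r \<partial>M) \<le> R"
begin

definition \<kappa> :: real where "\<kappa> = \<theta> * (1 - 2 / r)"

lemma \<kappa>_gt: "2 < \<kappa>" using \<kappa> by (simp add: \<kappa>_def)

lemma \<theta>_gt: "2 < \<theta>"
proof -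
  have "0 < 1 - 2 / r" "1 - 2 / r \<le> 1" using r by auto
  then have "0 < \<theta>" using \<kappa> by (metis less_trans zero_less_mult_pos2 zero_less_numeral)
  then have "\<theta> * (1 - 2 / r) \<le> \<theta> * 1" using \<open>1 - 2 / r \<le> 1\<close> by (intro mult_left_mono) auto
  then show ?thesis using \<kappa> by linarith
qed

lemma R_nonneg: "0 \<le> R"
proof -
  have "0 \<le> (\<integral>\<omega>. \<bar>V 0 \<omega>\<bar> powr r \<partial>M)" by simp
  then show ?thesis using moment_le[of 0] by linarith
qed

lemma c_nonneg: "0 \<le> c"
  using rate_nonneg[of 0] by simp

lemma square_int: "integrable M (\<lambda>\<omega>. (V k \<omega>)\<^sup>2)"
  using moment_int[of k] r by (intro square_integrable_of_moment) auto

text \<open>Truncation at the level \<open>L = (lag i j + 1) powr (\<theta> / r)\<close> balances the two error terms.\<close>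

lemma covar_decay: "\<bar>covar (V i) (V j)\<bar> \<le> (4 * c + 6 * R) * real (lag i j + 1) powr (-\<kappa>)"
proof -
  define l where "l = real (lag i j + 1)"
  define L where "L = l powr (\<theta> / r)"
  have l: "0 < l" by (simp add: l_def)
  have L: "0 < L" using l by (simp add: L_def)
  have m: "V (min i j) \<in> borel_measurable (alg {min i j})" "V (max i j) \<in> borel_measurable (alg {max i j})"
    by (auto intro: alg_measurable)
  have "\<bar>covar (V (min i j)) (V (max i j))\<bar> \<le> 4 * L\<^sup>2 * (c * l powr (-\<theta>)) + 6 * R * L powr (2 - r)"
    unfolding l_def
    by (rule covar_moment_bound[OF decoupled_lag m r L moment_int moment_le moment_int moment_le])
  moreover have "covar (V (min i j)) (V (max i j)) = covar (V i) (V j)"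
    by (auto simp: covar_def min_def max_def mult.commute)
  moreover have "L\<^sup>2 * (c * l powr (-\<theta>)) = c * l powr (-\<kappa>)"
  proof -
    have "L\<^sup>2 = l powr (2 * (\<theta> / r))" using l by (simp add: L_def powr_power mult.commute)
    moreover have "2 * (\<theta> / r) + - \<theta> = -\<kappa>" using r by (simp add: \<kappa>_def field_simps)
    ultimately show ?thesis using powr_add[of l "2 * (\<theta> / r)" "-\<theta>"] by simp
  qed
  moreover have "L powr (2 - r) = l powr (-\<kappa>)"
  proof -
    have "\<theta> / r * (2 - r) = -\<kappa>" using r by (simp add: \<kappa>_def field_simps)
    then show ?thesis by (simp add: L_def powr_powr)
  qed
  ultimately show ?thesis unfolding l_def[symmetric] by (simp only: mult.assoc distrib_right)
qed

lemma variance_linear_growth: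
  "\<exists>B\<ge>0. \<forall>n. (\<integral>\<omega>. (centered_sum M V n \<omega>)\<^sup>2 \<partial>M) \<le> real n * B"
proof (intro exI conjI allI)
  define d where "d k = (4 * c + 6 * R) * real (k + 1) powr (-\<kappa>)" for k
  have d0: "0 \<le> d k" for k using c_nonneg R_nonneg by (simp add: d_def)
  have sd: "summable d" unfolding d_def using \<kappa>_gt by (intro summable_mult summable_shifted_powr) simp
  show "0 \<le> 2 * suminf d" using d0 sd by (simp add: suminf_nonneg)
  fix n
  have "(\<integral>\<omega>. (centered_sum M V n \<omega>)\<^sup>2 \<partial>M) = (\<Sum>i\<in>{1..n}. \<Sum>j\<in>{1..n}. covar (V i) (V j))"
    by (intro centered_sum_variance square_int) auto
  also have "\<dots> \<le> (\<Sum>i\<in>{1..n}. \<Sum>j\<in>{1..n}. d (lag i j))"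
    unfolding d_def by (intro sum_mono order_trans[OF abs_ge_self covar_decay])
  also have "\<dots> \<le> 2 * real n * suminf d" by (rule lag_double_sum_le_suminf[OF d0 sd])
  finally show "(\<integral>\<omega>. (centered_sum M V n \<omega>)\<^sup>2 \<partial>M) \<le> real n * (2 * suminf d)" by simp
qed

text \<open>A covariance of truncation errors has two bounds: one small in \<open>K\<close> through
  second moments, one summable in the lag through \<open>covar_decay\<close>. Their geometric mean
  is both at once, and summing it over the lags gives a bound per summand that does not depend on
  \<open>n\<close>.\<close>

lemma truncation_error_variance:
  "\<exists>H\<ge>0. \<forall>K>0. \<forall>n. (\<integral>\<omega>. (centered_sum M (\<lambda>k \<omega>. V k \<omega> - truncate K (V k \<omega>)) n \<omega>)\<^sup>2 \<partial>M)
     \<le> real n * (H * K powr ((2 - r) / 2))"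
proof (intro exI conjI allI impI)
  define d where "d k = real (k + 1) powr (-\<kappa> / 2)" for k
  have d0: "0 \<le> d k" for k by (simp add: d_def)
  have sd: "summable d" unfolding d_def using \<kappa>_gt by (intro summable_shifted_powr) simp
  define C where "C = sqrt (R * (4 * c + 6 * R))"
  have C0: "0 \<le> C" using R_nonneg c_nonneg by (simp add: C_def)
  show "0 \<le> 2 * C * suminf d" using d0 sd C0 by (simp add: suminf_nonneg)
  fix K :: real and n assume K: "0 < K"
  define U where "U k \<omega> = V k \<omega> - truncate K (V k \<omega>)" for k \<omega>
  have Um[measurable]: "U k \<in> borel_measurable M" for k unfolding U_def[abs_def] by measurable
  have Ule: "\<bar>U k \<omega>\<bar> powr r \<le> \<bar>V k \<omega>\<bar> powr r" for k \<omega>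
    unfolding U_def using K r by (intro powr_mono2 abs_diff_truncate_le) auto
  have Uint: "integrable M (\<lambda>\<omega>. \<bar>U k \<omega>\<bar> powr r)" for k
    by (rule Bochner_Integration.integrable_bound[OF moment_int[of k]]) (use Ule in auto)
  have UR: "(\<integral>\<omega>. \<bar>U k \<omega>\<bar> powr r \<partial>M) \<le> R" for k
    using moment_le[of k] integral_mono[OF Uint moment_int Ule] by (rule order_trans[rotated])
  \<comment> \<open>The truncation errors are transformations of \<open>V\<close> dominated by
    \<open>V\<close>, so they satisfy the same assumptions with the same constants.\<close>
  interpret U: moment_mixing M U c \<theta> r R
  proof -
    have "mixing M (\<lambda>k \<omega>. V k \<omega> - truncate K (V k \<omega>)) (\<lambda>k. c * real (k + 1) powr (-\<theta>))"
      by (rule mixing_transform[OF mixing_axioms, of "\<lambda>k x. x - truncate K x"]) measurable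
    then interpret mU: mixing M U "\<lambda>k. c * real (k + 1) powr (-\<theta>)" by (simp add: U_def[abs_def])
    show "moment_mixing M U c \<theta> r R" by unfold_locales (use r \<kappa> Uint UR in auto)
  qed
  have U2: "(\<integral>\<omega>. (U k \<omega>)\<^sup>2 \<partial>M) \<le> R * K powr (2 - r)" for k
  proof -
    have "(\<integral>\<omega>. (U k \<omega>)\<^sup>2 \<partial>M) \<le> (\<integral>\<omega>. K powr (2 - r) * \<bar>V k \<omega>\<bar> powr r \<partial>M)"
      using K r unfolding U_def
      by (intro integral_mono U.square_int[unfolded U_def] integrable_mult_right moment_int truncate_error_square) auto
    also have "\<dots> \<le> R * K powr (2 - r)"
      using mult_right_mono[OF moment_le[of k], of "K powr (2 - r)"] by (simp add: mult.commute)
    finally show ?thesis .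
  qed
  have cb: "\<bar>covar (U i) (U j)\<bar> \<le> C * K powr ((2 - r) / 2) * d (lag i j)" for i j
  proof (rule power2_le_imp_le)
    have 1: "\<bar>covar (U i) (U j)\<bar> \<le> R * K powr (2 - r)"
      by (intro covar_le_second_moments U.square_int U2) auto
    have 2: "\<bar>covar (U i) (U j)\<bar> \<le> (4 * c + 6 * R) * real (lag i j + 1) powr (-\<kappa>)"
      using U.covar_decay[of i j] by (simp add: U.\<kappa>_def \<kappa>_def)
    have "(\<bar>covar (U i) (U j)\<bar>)\<^sup>2 \<le> (R * K powr (2 - r)) * ((4 * c + 6 * R) * real (lag i j + 1) powr (-\<kappa>))"
      unfolding power2_eq_square using R_nonneg by (intro mult_mono 1 2) auto
    also have "\<dots> = C\<^sup>2 * (K powr ((2 - r) / 2))\<^sup>2 * (d (lag i j))\<^sup>2"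
    proof -
      have "C\<^sup>2 = R * (4 * c + 6 * R)" using R_nonneg c_nonneg by (simp add: C_def)
      moreover have "(K powr ((2 - r) / 2))\<^sup>2 = K powr (2 - r)"
      proof -
        have "(2 - r) / 2 + (2 - r) / 2 = 2 - r" by (simp add: field_simps)
        then show ?thesis using powr_add[of K "(2 - r) / 2" "(2 - r) / 2"] by (simp only: power2_eq_square)
      qed
      moreover have "(d (lag i j))\<^sup>2 = real (lag i j + 1) powr (-\<kappa>)" by (simp add: d_def powr_power)
      ultimately show ?thesis by (simp only: ac_simps)
    qed
    finally show "(\<bar>covar (U i) (U j)\<bar>)\<^sup>2 \<le> (C * K powr ((2 - r) / 2) * d (lag i j))\<^sup>2"
      by (simp only: power_mult_distrib)
    show "0 \<le> C * K powr ((2 - r) / 2) * d (lag i j)" using C0 d0 by simp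
  qed
  have "(\<integral>\<omega>. (centered_sum M U n \<omega>)\<^sup>2 \<partial>M) = (\<Sum>i\<in>{1..n}. \<Sum>j\<in>{1..n}. covar (U i) (U j))"
    by (intro centered_sum_variance U.square_int) auto
  also have "\<dots> \<le> (\<Sum>i\<in>{1..n}. \<Sum>j\<in>{1..n}. C * K powr ((2 - r) / 2) * d (lag i j))"
    by (intro sum_mono order_trans[OF abs_ge_self cb])
  also have "\<dots> = C * K powr ((2 - r) / 2) * (\<Sum>i\<in>{1..n}. \<Sum>j\<in>{1..n}. d (lag i j))"
    by (simp add: sum_distrib_left)
  also have "\<dots> \<le> C * K powr ((2 - r) / 2) * (2 * real n * suminf d)"
    using C0 by (intro mult_left_mono lag_double_sum_le_suminf[OF d0 sd]) auto
  finally show "(\<integral>\<omega>. (centered_sum M (\<lambda>k \<omega>. V k \<omega> - truncate K (V k \<omega>)) n \<omega>)\<^sup>2 \<partial>M)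
     \<le> real n * (2 * C * suminf d * K powr ((2 - r) / 2))"
    unfolding U_def[abs_def] by (simp only: ac_simps)
qed

text \<open>The truncation level depends on the tolerance \<open>\<delta>\<close> but not on
  \<open>n\<close>, so the bounded case applies at that fixed level before \<open>\<delta>\<close>
  is made small.\<close>

lemma char_approx:
  defines "Z \<equiv> \<lambda>n \<omega>. centered_sum M V n \<omega> / sqrt (real n)"
  shows "(\<lambda>n. (\<integral>\<omega>. iexp (t * Z n \<omega>) \<partial>M) - of_real (exp (- (\<integral>\<omega>. (Z n \<omega>)\<^sup>2 \<partial>M) * t\<^sup>2 / 2))) \<longlonglongrightarrow> 0"
proof -
  obtain B where B: "0 \<le> B" "\<And>n. (\<integral>\<omega>. (centered_sum M V n \<omega>)\<^sup>2 \<partial>M) \<le> real n * B"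
    using variance_linear_growth by auto
  obtain H where H: "0 \<le> H" "\<And>K n. 0 < K \<Longrightarrow>
      (\<integral>\<omega>. (centered_sum M (\<lambda>k \<omega>. V k \<omega> - truncate K (V k \<omega>)) n \<omega>)\<^sup>2 \<partial>M) \<le> real n * (H * K powr ((2 - r) / 2))"
    using truncation_error_variance by auto
  define f where "f n = (\<integral>\<omega>. iexp (t * Z n \<omega>) \<partial>M) - of_real (exp (- (\<integral>\<omega>. (Z n \<omega>)\<^sup>2 \<partial>M) * t\<^sup>2 / 2))" for n
  \<comment> \<open>One summand for each source of error: the truncated sums contribute 1, the
    perturbation of the characteristic function \<open>\<bar>t\<bar>\<close>, and the change of the
    variance in the Gaussian exponent \<open>(B + 2) * t^2 / 2\<close>.\<close>
  define A where "A = \<bar>t\<bar> + (B + 2) * t\<^sup>2 / 2 + 1"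
  have A0: "0 < A" using B(1) by (simp add: A_def add_nonneg_pos)
  have main: "eventually (\<lambda>n. cmod (f n) \<le> A * \<delta>) sequentially" if \<delta>: "0 < \<delta>" "\<delta> \<le> 1" for \<delta>
  proof -
    \<comment> \<open>The solution of \<open>K powr ((2 - r) / 2) = \<delta>^2 / (H + 1)\<close>;
      the added 1 keeps the quotient meaningful when \<open>H = 0\<close>.\<close>
    define K where "K = (\<delta>\<^sup>2 / (H + 1)) powr (2 / (2 - r))"
    have K0: "0 < K" using \<delta> H(1) by (simp add: K_def)
    have KH: "H * K powr ((2 - r) / 2) \<le> \<delta>\<^sup>2"
    proof -
      have "K powr ((2 - r) / 2) = \<delta>\<^sup>2 / (H + 1)"
      proof -
        have "2 / (2 - r) * ((2 - r) / 2) = 1" using r by simp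
        then show ?thesis using H(1) by (simp only: K_def powr_powr) simp
      qed
      then have "H * K powr ((2 - r) / 2) = H / (H + 1) * \<delta>\<^sup>2" by simp
      also have "\<dots> \<le> 1 * \<delta>\<^sup>2" using H(1) by (intro mult_right_mono) auto
      finally show ?thesis by simp
    qed
    define V' where "V' k \<omega> = truncate K (V k \<omega>) - (\<integral>\<omega>. truncate K (V k \<omega>) \<partial>M)" for k \<omega>
    have ti: "integrable M (\<lambda>\<omega>. truncate K (V k \<omega>))" for k
      using K0 abs_truncate_le(1)[of K] by (intro integrable_bounded[where c=K]) auto
    have te: "\<bar>\<integral>\<omega>. truncate K (V k \<omega>) \<partial>M\<bar> \<le> K" for k
      using norm_expectation_le[of "\<lambda>\<omega>. truncate K (V k \<omega>)" K] K0 abs_truncate_le(1)[of K] by simp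
    \<comment> \<open>The bound is \<open>2 * K\<close> because centering can double that of a
      variable truncated at \<open>K\<close>.\<close>
    interpret B: bounded_mixing M V' "\<lambda>k. c * real (k + 1) powr (-\<theta>)" "2 * K"
    proof -
      have "mixing M (\<lambda>k \<omega>. truncate K (V k \<omega>) - (\<integral>\<omega>. truncate K (V k \<omega>) \<partial>M)) (\<lambda>k. c * real (k + 1) powr (-\<theta>))"
        by (rule mixing_transform[OF mixing_axioms, of "\<lambda>k x. truncate K x - (\<integral>\<omega>. truncate K (V k \<omega>) \<partial>M)"])
           (intro borel_measurable_diff truncate_measurable borel_measurable_const)
      then interpret mV': mixing M V' "\<lambda>k. c * real (k + 1) powr (-\<theta>)" by (simp add: V'_def[abs_def])
      show "bounded_mixing M V' (\<lambda>k. c * real (k + 1) powr (-\<theta>)) (2 * K)"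
      proof
        show "\<bar>V' k \<omega>\<bar> \<le> 2 * K" for k \<omega>
          using te[of k] abs_truncate_le(1)[of K "V k \<omega>"] K0 by (simp add: V'_def)
        show "expectation (V' k) = 0" for k
          using ti[of k] by (simp add: V'_def[abs_def] prob_space)
      qed
    qed
    define Z' where "Z' n \<omega> = B.psum {1..n} \<omega> / sqrt (real n)" for n \<omega>
    have psum: "B.psum {1..n} \<omega> = centered_sum M (\<lambda>k \<omega>. truncate K (V k \<omega>)) n \<omega>" for n \<omega>
      by (simp add: B.psum_def centered_sum_def V'_def)
    have Vi: "integrable M (V k)" for k by (rule square_integrable_imp_integrable[OF V_meas square_int])
    have diff: "Z n \<omega> - Z' n \<omega> = centered_sum M (\<lambda>k \<omega>. V k \<omega> - truncate K (V k \<omega>)) n \<omega> / sqrt (real n)" for n \<omega>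
      by (simp add: Z_def Z'_def psum centered_sum_diff[OF Vi ti] diff_divide_distrib del: One_nat_def)
    have [measurable]: "Z n \<in> borel_measurable M" "Z' n \<in> borel_measurable M" for n
      unfolding Z_def Z'_def[abs_def] by (measurable; fact V_meas)+
    have U2: "integrable M (\<lambda>\<omega>. (V k \<omega> - truncate K (V k \<omega>))\<^sup>2)" for k
      by (rule Bochner_Integration.integrable_bound[OF square_int[of k]])
         (use K0 in \<open>auto simp: abs_le_square_iff[symmetric] intro!: AE_I2 abs_diff_truncate_le\<close>)
    have T2: "integrable M (\<lambda>\<omega>. (truncate K (V k \<omega>))\<^sup>2)" for k
      by (rule Bochner_Integration.integrable_bound[OF square_int[of k]])
         (use K0 in \<open>auto simp: abs_le_square_iff[symmetric] intro!: AE_I2 abs_truncate_le\<close>)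
    have i: "integrable M (\<lambda>\<omega>. (Z n \<omega>)\<^sup>2)" "integrable M (\<lambda>\<omega>. (Z' n \<omega>)\<^sup>2)" "integrable M (\<lambda>\<omega>. (Z n \<omega> - Z' n \<omega>)\<^sup>2)" for n
      unfolding diff unfolding Z_def Z'_def psum power_divide
      by (intro integrable_divide_zero centered_sum_variance(1) square_int U2 T2 impI; measurable)+
    have sq: "(sqrt (real n))\<^sup>2 = real n" for n by simp
    have b: "(\<integral>\<omega>. (Z n \<omega> - Z' n \<omega>)\<^sup>2 \<partial>M) \<le> \<delta>\<^sup>2" if "n \<ge> 1" for n
    proof -
      have "(\<integral>\<omega>. (Z n \<omega> - Z' n \<omega>)\<^sup>2 \<partial>M)
          = (\<integral>\<omega>. (centered_sum M (\<lambda>k \<omega>. V k \<omega> - truncate K (V k \<omega>)) n \<omega>)\<^sup>2 \<partial>M) / real n"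
        unfolding diff power_divide sq by simp
      also have "\<dots> \<le> real n * (H * K powr ((2 - r) / 2)) / real n"
        using H(2)[OF K0] by (intro divide_right_mono) auto
      also have "\<dots> \<le> \<delta>\<^sup>2" using KH that by simp
      finally show ?thesis .
    qed
    have bB: "(\<integral>\<omega>. (Z n \<omega>)\<^sup>2 \<partial>M) \<le> B" if "n \<ge> 1" for n
    proof -
      have "(\<integral>\<omega>. (Z n \<omega>)\<^sup>2 \<partial>M) = (\<integral>\<omega>. (centered_sum M V n \<omega>)\<^sup>2 \<partial>M) / real n"
        unfolding Z_def power_divide sq by simp
      also have "\<dots> \<le> real n * B / real n" using B(2) by (intro divide_right_mono) auto
      finally show ?thesis using that by simp
    qed
    define f' where "f' n = (\<integral>\<omega>. iexp (t * Z' n \<omega>) \<partial>M) - of_real (exp (- (\<integral>\<omega>. (Z' n \<omega>)\<^sup>2 \<partial>M) * t\<^sup>2 / 2))" for n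
    have "f' \<longlonglongrightarrow> 0"
      unfolding f'_def Z'_def by (rule B.char_approx[OF refl \<theta>_gt])
    then have "eventually (\<lambda>n. cmod (f' n) < \<delta>) sequentially"
      using \<delta>(1) by (auto dest: tendstoD simp: dist_norm)
    then show "eventually (\<lambda>n. cmod (f n) \<le> A * \<delta>) sequentially"
      using eventually_ge_at_top[of 1]
    proof eventually_elim
      case (elim n)
      define u u' where "u = (\<integral>\<omega>. (Z n \<omega>)\<^sup>2 \<partial>M) * t\<^sup>2 / 2" and "u' = (\<integral>\<omega>. (Z' n \<omega>)\<^sup>2 \<partial>M) * t\<^sup>2 / 2"
      have "\<bar>exp (- u) - exp (- u')\<bar> \<le> \<bar>u - u'\<bar>"
        by (intro abs_exp_minus_diff_le) (auto simp: u_def u'_def)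
      also have "u - u' = ((\<integral>\<omega>. (Z n \<omega>)\<^sup>2 \<partial>M) - (\<integral>\<omega>. (Z' n \<omega>)\<^sup>2 \<partial>M)) * (t\<^sup>2 / 2)"
        by (simp add: u_def u'_def algebra_simps)
      also have "\<bar>\<dots>\<bar> \<le> \<delta> * (B + 2) * (t\<^sup>2 / 2)"
        unfolding abs_mult using second_moment_perturb[OF _ _ i b[OF elim(2)] \<delta> bB[OF elim(2)]]
        by (auto intro!: mult_right_mono)
      finally have e1: "cmod (of_real (exp (- u)) - of_real (exp (- u'))) \<le> \<delta> * (B + 2) * (t\<^sup>2 / 2)"
        by (simp flip: of_real_diff)
      have e2: "cmod ((\<integral>\<omega>. iexp (t * Z n \<omega>) \<partial>M) - (\<integral>\<omega>. iexp (t * Z' n \<omega>) \<partial>M)) \<le> \<bar>t\<bar> * \<delta>"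
        using char_perturb[OF _ _ i(3) b[OF elim(2)] \<delta>(1)] by simp
      have "f n = f' n + ((\<integral>\<omega>. iexp (t * Z n \<omega>) \<partial>M) - (\<integral>\<omega>. iexp (t * Z' n \<omega>) \<partial>M)) - (of_real (exp (- u)) - of_real (exp (- u')))"
        by (simp add: f_def f'_def u_def u'_def)
      then have "cmod (f n) \<le> cmod (f' n) + cmod ((\<integral>\<omega>. iexp (t * Z n \<omega>) \<partial>M) - (\<integral>\<omega>. iexp (t * Z' n \<omega>) \<partial>M))
          + cmod (of_real (exp (- u)) - of_real (exp (- u')) :: complex)"
        by (metis (no_types, lifting) add_right_mono norm_triangle_ineq norm_triangle_ineq4 order_trans)
      also have "\<dots> \<le> \<delta> + \<bar>t\<bar> * \<delta> + \<delta> * (B + 2) * (t\<^sup>2 / 2)" using e1 e2 elim(1) by linarith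
      also have "\<dots> = A * \<delta>" by (simp add: A_def algebra_simps)
      finally show ?case .
    qed
  qed
  have "f \<longlonglongrightarrow> 0"
  proof (rule tendstoI)
    fix e :: real assume e: "0 < e"
    define \<delta> where "\<delta> = min 1 (e / (2 * A))"
    have \<delta>: "0 < \<delta>" "\<delta> \<le> 1" using e A0 by (auto simp: \<delta>_def)
    have "A * \<delta> \<le> A * (e / (2 * A))" using A0 by (intro mult_left_mono) (auto simp: \<delta>_def)
    also have "\<dots> < e" using e A0 by simp
    finally have "A * \<delta> < e" .
    then show "eventually (\<lambda>n. dist (f n) 0 < e) sequentially"
      using main[OF \<delta>] by (auto elim!: eventually_mono simp: dist_norm)
  qed
  then show ?thesis unfolding f_def .
qed

end

section \<open>From characteristic functions to weak approach and tail bounds\<close>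

context prob_space
begin

text \<open>The variances \<open>s n\<close> need not converge, but they stay in a compact interval.
  If the claim failed along a subsequence, \<open>s\<close> would tend to some \<open>l\<close>
  along a further one, and there both integrals converge to the integral of \<open>g\<close> under
  the centered normal law of variance \<open>l\<close>.\<close>

lemma weakly_approaching_normal:
  fixes Z :: "nat \<Rightarrow> 'a \<Rightarrow> real" and s :: "nat \<Rightarrow> real" and g :: "real \<Rightarrow> real"
  assumes [measurable]: "\<And>n. Z n \<in> borel_measurable M"
    and s: "\<And>n. 0 \<le> s n" "\<And>n. s n \<le> B"
    and char: "\<And>t. (\<lambda>n. (\<integral>\<omega>. iexp (t * Z n \<omega>) \<partial>M) - of_real (exp (- s n * t\<^sup>2 / 2))) \<longlonglongrightarrow> 0"
    and g: "continuous_on UNIV g" "\<And>x. \<bar>g x\<bar> \<le> G"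
  shows "(\<lambda>n. (\<integral>\<omega>. g (Z n \<omega>) \<partial>M) - (\<integral>x. g (sqrt (s n) * x) \<partial>std_normal_distribution)) \<longlonglongrightarrow> 0"
proof (rule ccontr)
  define d where "d n = (\<integral>\<omega>. g (Z n \<omega>) \<partial>M) - (\<integral>x. g (sqrt (s n) * x) \<partial>std_normal_distribution)" for n
  assume "\<not> (\<lambda>n. (\<integral>\<omega>. g (Z n \<omega>) \<partial>M) - (\<integral>x. g (sqrt (s n) * x) \<partial>std_normal_distribution)) \<longlonglongrightarrow> 0"
  then have "\<not> d \<longlonglongrightarrow> 0" unfolding d_def .
  then obtain e where e: "0 < e" "\<not> eventually (\<lambda>n. dist (d n) 0 < e) sequentially"
    unfolding tendsto_iff by auto
  then have "\<forall>N. \<exists>n\<ge>N. e \<le> \<bar>d n\<bar>" by (auto simp: eventually_sequentially not_less)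
  then have "infinite {n. e \<le> \<bar>d n\<bar>}" unfolding infinite_nat_iff_unbounded_le by auto
  then obtain r1 :: "nat \<Rightarrow> nat" where r1: "strict_mono r1" "\<And>n. e \<le> \<bar>d (r1 n)\<bar>"
    using infinite_enumerate by blast
  have "\<forall>n. (s \<circ> r1) n \<in> {0..B}" using s by auto
  then obtain l r2 where l: "l \<in> {0..B}" "strict_mono r2" "((s \<circ> r1) \<circ> r2) \<longlonglongrightarrow> l"
    using compact_Icc[of 0 B] unfolding compact_def by blast
  define r where "r = r1 \<circ> r2"
  have r: "strict_mono r" unfolding r_def using r1(1) l(2) by (rule strict_mono_o)
  have sl: "(\<lambda>n. s (r n)) \<longlonglongrightarrow> l" using l(3) by (simp add: r_def o_def)
  \<comment> \<open>Written as an image of the standard normal law, so that \<open>l = 0\<close>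
    gives the point mass at 0 and needs no separate treatment.\<close>
  define N where "N = distr std_normal_distribution borel (\<lambda>x. sqrt l * x)"
  interpret std: real_distribution std_normal_distribution by (rule real_dist_normal_dist)
  have charN: "char N t = of_real (exp (- l * t\<^sup>2 / 2))" for t
  proof -
    have "char N t = (\<integral>x. iexp (t * (sqrt l * x)) \<partial>std_normal_distribution)"
      unfolding char_def N_def by (subst integral_distr) auto
    also have "\<dots> = char std_normal_distribution (t * sqrt l)" by (simp add: char_def mult.assoc)
    also have "\<dots> = of_real (exp (- l * t\<^sup>2 / 2))"
      using l(1) by (simp add: char_std_normal_distribution power_mult_distrib mult.commute)
    finally show ?thesis .
  qed
  have charZ: "char (distr M borel (Z n)) t = (\<integral>\<omega>. iexp (t * Z n \<omega>) \<partial>M)" for n t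
    unfolding char_def by (subst integral_distr) auto
  have "weak_conv_m (\<lambda>n. distr M borel (Z (r n))) N"
  proof (rule levy_continuity)
    show "real_distribution (distr M borel (Z (r n)))" for n by (rule real_distribution_distr) simp
    show "real_distribution N" unfolding N_def by (rule std.real_distribution_distr) simp
    fix t
    have "(\<lambda>n. (\<integral>\<omega>. iexp (t * Z (r n) \<omega>) \<partial>M) - of_real (exp (- s (r n) * t\<^sup>2 / 2))) \<longlonglongrightarrow> 0"
      using LIMSEQ_subseq_LIMSEQ[OF char[of t] r] by (simp add: o_def)
    moreover have "(\<lambda>n. of_real (exp (- s (r n) * t\<^sup>2 / 2)) :: complex) \<longlonglongrightarrow> of_real (exp (- l * t\<^sup>2 / 2))"
      by (intro tendsto_intros sl) auto
    ultimately have "(\<lambda>n. (\<integral>\<omega>. iexp (t * Z (r n) \<omega>) \<partial>M) - of_real (exp (- s (r n) * t\<^sup>2 / 2)) + of_real (exp (- s (r n) * t\<^sup>2 / 2)))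
        \<longlonglongrightarrow> 0 + of_real (exp (- l * t\<^sup>2 / 2))" by (rule tendsto_add)
    then show "(\<lambda>n. char (distr M borel (Z (r n))) t) \<longlonglongrightarrow> char N t"
      by (simp add: charN charZ)
  qed
  then have "(\<lambda>n. integral\<^sup>L (distr M borel (Z (r n))) g) \<longlonglongrightarrow> integral\<^sup>L N g"
    using g
    by (intro weak_conv_imp_integral_bdd_continuous_conv[where B=G])
       (auto simp: N_def continuous_on_eq_continuous_at intro!: real_distribution_distr std.real_distribution_distr)
  moreover have gm[measurable]: "g \<in> borel_measurable borel" using g(1) by (rule borel_measurable_continuous_onI)
  ultimately have 1: "(\<lambda>n. \<integral>\<omega>. g (Z (r n) \<omega>) \<partial>M) \<longlonglongrightarrow> (\<integral>x. g (sqrt l * x) \<partial>std_normal_distribution)"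
    unfolding N_def by (simp add: integral_distr)
  have 2: "(\<lambda>n. \<integral>x. g (sqrt (s (r n)) * x) \<partial>std_normal_distribution) \<longlonglongrightarrow> (\<integral>x. g (sqrt l * x) \<partial>std_normal_distribution)"
  proof (rule integral_dominated_convergence[where w="\<lambda>_. G"])
    show "AE x in std_normal_distribution. (\<lambda>n. g (sqrt (s (r n)) * x)) \<longlonglongrightarrow> g (sqrt l * x)"
    proof (rule AE_I2)
      fix x
      have "isCont g (sqrt l * x)" using g(1) by (simp add: continuous_on_eq_continuous_at)
      moreover have "(\<lambda>n. sqrt (s (r n)) * x) \<longlonglongrightarrow> sqrt l * x" by (intro tendsto_intros sl)
      ultimately show "(\<lambda>n. g (sqrt (s (r n)) * x)) \<longlonglongrightarrow> g (sqrt l * x)" by (rule isCont_tendsto_compose)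
    qed
  qed (use g in auto)
  have "(\<lambda>n. d (r n)) \<longlonglongrightarrow> 0"
    using tendsto_diff[OF 1 2] by (simp add: d_def)
  then have "eventually (\<lambda>n. \<bar>d (r n)\<bar> < e) sequentially"
    using e(1) by (auto dest: tendstoD simp: dist_norm)
  then obtain n where "\<bar>d (r n)\<bar> < e" by (auto simp: eventually_sequentially)
  then show False using r1(2)[of "r2 n"] by (simp add: r_def)
qed

lemma limsup_tail_le_normal:
  fixes Z :: "nat \<Rightarrow> 'a \<Rightarrow> real" and s :: "nat \<Rightarrow> real"
  assumes Zm[measurable]: "\<And>n. Z n \<in> borel_measurable M"
    and s: "\<And>n. 0 \<le> s n" "\<And>n. s n \<le> B"
    and char: "\<And>t. (\<lambda>n. (\<integral>\<omega>. iexp (t * Z n \<omega>) \<partial>M) - of_real (exp (- s n * t\<^sup>2 / 2))) \<longlonglongrightarrow> 0"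
    and a: "0 < a"
  shows "limsup (\<lambda>n. ereal (prob {\<omega>\<in>space M. a \<le> \<bar>Z n \<omega>\<bar>}))
     \<le> ereal (\<integral>x. indicator (- {-a..a}) (2 * sqrt B * x) \<partial>std_normal_distribution)"
proof -
  interpret std: real_distribution std_normal_distribution by (rule real_dist_normal_dist)
  \<comment> \<open>A continuous substitute for the indicator of
    \<open>\<bar>x\<bar> \<ge> a\<close>: it is 1 there and 0 for
    \<open>\<bar>x\<bar> \<le> a / 2\<close>. Halving the threshold is what puts the factor 2 in
    front of \<open>sqrt B\<close>.\<close>
  define g where "g x = max 0 (min 1 (2 * \<bar>x\<bar> / a - 1))" for x :: real
  have g01: "0 \<le> g x" "g x \<le> 1" for x by (auto simp: g_def)
  have gc: "continuous_on UNIV g" unfolding g_def using a by (intro continuous_intros) auto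
  have gm[measurable]: "g \<in> borel_measurable borel" using gc by (rule borel_measurable_continuous_onI)
  define d where "d n = (\<integral>\<omega>. g (Z n \<omega>) \<partial>M) - (\<integral>x. g (sqrt (s n) * x) \<partial>std_normal_distribution)" for n
  define p where "p = (\<integral>x. indicator (- {-a..a}) (2 * sqrt B * x) \<partial>std_normal_distribution :: real)"
  have d0: "d \<longlonglongrightarrow> 0"
    unfolding d_def using g01 by (intro weakly_approaching_normal[OF Zm s char gc, where G=1]) auto
  have le: "prob {\<omega>\<in>space M. a \<le> \<bar>Z n \<omega>\<bar>} \<le> d n + p" for n
  proof -
    have "prob {\<omega>\<in>space M. a \<le> \<bar>Z n \<omega>\<bar>} = (\<integral>\<omega>. indicator {\<omega>\<in>space M. a \<le> \<bar>Z n \<omega>\<bar>} \<omega> \<partial>M)" by simp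
    also have "\<dots> \<le> (\<integral>\<omega>. g (Z n \<omega>) \<partial>M)"
    proof (rule integral_mono)
      show "integrable M (indicat_real {\<omega>\<in>space M. a \<le> \<bar>Z n \<omega>\<bar>})"
        by (intro integrable_real_indicator) (auto simp: emeasure_eq_measure)
      show "integrable M (\<lambda>\<omega>. g (Z n \<omega>))" using g01 by (intro integrable_bounded[where c=1]) auto
      show "indicat_real {\<omega>\<in>space M. a \<le> \<bar>Z n \<omega>\<bar>} \<omega> \<le> g (Z n \<omega>)" for \<omega>
        using a g01[of "Z n \<omega>"] by (auto simp: indicator_def g_def le_divide_eq)
    qed
    finally have tail: "prob {\<omega>\<in>space M. a \<le> \<bar>Z n \<omega>\<bar>} \<le> (\<integral>\<omega>. g (Z n \<omega>) \<partial>M)" .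
    have "(\<integral>x. g (sqrt (s n) * x) \<partial>std_normal_distribution) \<le> p"
      unfolding p_def
    proof (rule integral_mono)
      show "integrable std_normal_distribution (\<lambda>x. g (sqrt (s n) * x))"
        using g01 by (intro std.integrable_bounded[where c=1]) auto
      show "integrable std_normal_distribution (\<lambda>x. indicat_real (- {-a..a}) (2 * sqrt B * x))"
        by (intro std.integrable_bounded[where c=1]) (auto simp: indicator_def)
      fix x :: real
      have "sqrt (s n) * \<bar>x\<bar> \<le> sqrt B * \<bar>x\<bar>" using s by (intro mult_right_mono) auto
      moreover have "0 \<le> sqrt B" using s order_trans by (simp add: order_trans[OF s(1) s(2)])
      ultimately have *: "a < \<bar>2 * sqrt B * x\<bar>" if "a < 2 * \<bar>sqrt (s n) * x\<bar>"
        using that s(1)[of n] by (simp add: abs_mult)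
      show "g (sqrt (s n) * x) \<le> indicat_real (- {-a..a}) (2 * sqrt B * x)"
      proof (cases "a < 2 * \<bar>sqrt (s n) * x\<bar>")
        case True
        then have "2 * sqrt B * x \<in> - {-a..a}" using * by auto
        then show ?thesis using g01 by simp
      next
        case False
        then have "g (sqrt (s n) * x) = 0" using a by (simp add: g_def divide_le_eq max_def)
        then show ?thesis by simp
      qed
    qed
    then show ?thesis using tail by (simp add: d_def)
  qed
  have "(\<lambda>n. ereal (d n + p)) \<longlonglongrightarrow> ereal (0 + p)" by (intro tendsto_intros d0)
  then have "limsup (\<lambda>n. ereal (d n + p)) = ereal p"
    by (simp add: lim_imp_Limsup)
  moreover have "limsup (\<lambda>n. ereal (prob {\<omega>\<in>space M. a \<le> \<bar>Z n \<omega>\<bar>})) \<le> limsup (\<lambda>n. ereal (d n + p))"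
    by (intro Limsup_mono always_eventually allI) (use le in simp)
  ultimately show ?thesis by (simp add: p_def)
qed

end

section \<open>Laws of large numbers\<close>

lemma cesaro_null:
  fixes a :: "nat \<Rightarrow> real"
  assumes "a \<longlonglongrightarrow> 0" and a0: "\<And>k. 0 \<le> a k"
  shows "(\<lambda>n. (\<Sum>k<n. a k) / real n) \<longlonglongrightarrow> 0"
proof (rule LIMSEQ_I)
  fix e :: real assume e: "0 < e"
  obtain N where N: "\<And>k. N \<le> k \<Longrightarrow> a k < e / 2"
    using order_tendstoD(2)[OF assms(1), of "e / 2"] e by (auto simp: eventually_sequentially)
  define C where "C = (\<Sum>k<N. a k)"
  show "\<exists>no. \<forall>n\<ge>no. norm ((\<Sum>k<n. a k) / real n - 0) < e"
  proof (intro exI allI impI)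
    fix n assume n: "nat \<lceil>2 * C / e\<rceil> + N + 1 \<le> n"
    have n1: "2 * C / e < real n" "N \<le> n" "1 \<le> n" using n by linarith+
    have "(\<Sum>k<n. a k) = C + (\<Sum>k\<in>{N..<n}. a k)"
      unfolding C_def using n1(2) by (simp add: sum.atLeastLessThan_concat lessThan_atLeast0)
    also have "(\<Sum>k\<in>{N..<n}. a k) \<le> (\<Sum>k\<in>{N..<n}. e / 2)"
      using N by (intro sum_mono) (simp add: less_imp_le)
    also have "\<dots> \<le> real n * (e / 2)" using e by (simp add: mult_right_mono)
    finally have "(\<Sum>k<n. a k) \<le> C + real n * (e / 2)" by simp
    moreover have "C < real n * (e / 2)" using n1(1) e by (simp add: field_simps)
    ultimately have "(\<Sum>k<n. a k) < e * real n" by (simp add: field_simps)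
    moreover have "0 \<le> (\<Sum>k<n. a k)" by (intro sum_nonneg a0)
    ultimately show "norm ((\<Sum>k<n. a k) / real n - 0) < e"
      using n1(3) by (simp add: pos_divide_less_eq)
  qed
qed

lemma truncate_square_powr:
  fixes x :: real
  assumes "0 < L" "p \<le> 2" "0 < p"
  shows "(truncate L x)\<^sup>2 \<le> L powr (2 - p) * \<bar>x\<bar> powr p"
proof -
  define y where "y = \<bar>truncate L x\<bar>"
  have y: "0 \<le> y" "y \<le> L" "y \<le> \<bar>x\<bar>" using assms abs_truncate_le by (auto simp: y_def)
  have "(truncate L x)\<^sup>2 = y powr (2 - p) * y powr p"
    using y by (cases "y = 0") (auto simp: y_def powr_add[symmetric])
  also have "\<dots> \<le> L powr (2 - p) * \<bar>x\<bar> powr p"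
    using assms y by (intro mult_mono powr_mono2) auto
  finally show ?thesis .
qed

section \<open>Truncated sums and the law of large numbers in mean\<close>

context mixing
begin

lemma truncated_variance:
  assumes L: "0 < L"
  shows "integrable M (\<lambda>\<omega>. (centered_sum M (\<lambda>k \<omega>. truncate L (V k \<omega>)) n \<omega>)\<^sup>2)"
    and "(\<integral>\<omega>. (centered_sum M (\<lambda>k \<omega>. truncate L (V k \<omega>)) n \<omega>)\<^sup>2 \<partial>M)
      = (\<Sum>i\<in>{1..n}. \<Sum>j\<in>{1..n}. covar (\<lambda>\<omega>. truncate L (V i \<omega>)) (\<lambda>\<omega>. truncate L (V j \<omega>)))"
    and "\<bar>covar (\<lambda>\<omega>. truncate L (V i \<omega>)) (\<lambda>\<omega>. truncate L (V j \<omega>))\<bar> \<le> 4 * L\<^sup>2 * a (lag i j)"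
proof -
  interpret T: mixing M "\<lambda>k \<omega>. truncate L (V k \<omega>)" a
    by (rule mixing_transform[OF mixing_axioms]) simp
  have b: "\<bar>truncate L (V k \<omega>)\<bar> \<le> L" for k \<omega> using L abs_truncate_le(1)[of L] by simp
  have i: "integrable M (\<lambda>\<omega>. (truncate L (V k \<omega>))\<^sup>2)" for k
    using L b by (intro integrable_bounded[where c="L\<^sup>2"]) (auto simp: abs_le_square_iff[symmetric])
  show "integrable M (\<lambda>\<omega>. (centered_sum M (\<lambda>k \<omega>. truncate L (V k \<omega>)) n \<omega>)\<^sup>2)"
    "(\<integral>\<omega>. (centered_sum M (\<lambda>k \<omega>. truncate L (V k \<omega>)) n \<omega>)\<^sup>2 \<partial>M)
      = (\<Sum>i\<in>{1..n}. \<Sum>j\<in>{1..n}. covar (\<lambda>\<omega>. truncate L (V i \<omega>)) (\<lambda>\<omega>. truncate L (V j \<omega>)))"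
    by (rule centered_sum_variance; use i in simp)+
  show "\<bar>covar (\<lambda>\<omega>. truncate L (V i \<omega>)) (\<lambda>\<omega>. truncate L (V j \<omega>))\<bar> \<le> 4 * L\<^sup>2 * a (lag i j)"
    by (rule T.covar_bounded) (use b in auto)
qed

text \<open>Truncation at a fixed level leaves a mean error of at most \<open>e / 2\<close> per
  summand, uniformly in \<open>n\<close>. The variance of the truncated sum is at most a multiple of
  \<open>n\<close> times the sum of the first \<open>n\<close> rates; after division by
  \<open>n^2\<close> the Cesaro means of \<open>a\<close> appear, so convergence to 0 without any
  speed is enough.\<close>

lemma L1_law_of_large_numbers:
  assumes a0: "a \<longlonglongrightarrow> 0" and p: "1 < p"
    and iV: "\<And>k. integrable M (V k)"
    and iVp: "\<And>k. integrable M (\<lambda>\<omega>. \<bar>V k \<omega>\<bar> powr p)" "\<And>k. (\<integral>\<omega>. \<bar>V k \<omega>\<bar> powr p \<partial>M) \<le> R"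
  shows "(\<lambda>n. \<integral>\<omega>. \<bar>centered_sum M V n \<omega> / real n\<bar> \<partial>M) \<longlonglongrightarrow> 0"
proof (rule LIMSEQ_I)
  fix e :: real assume e: "0 < e"
  have R0: "0 \<le> R"
  proof -
    have "0 \<le> (\<integral>\<omega>. \<bar>V 0 \<omega>\<bar> powr p \<partial>M)" by simp
    then show ?thesis using iVp(2)[of 0] by linarith
  qed
  \<comment> \<open>Chosen so that \<open>K powr (1 - p) = e / (4 * (R + 1))\<close>. The truncation
    error is counted twice, once for the variable and once for its mean.\<close>
  define K where "K = (e / (4 * (R + 1))) powr (1 / (1 - p))"
  have K: "0 < K" using e R0 by (simp add: K_def)
  have KR: "2 * (R * K powr (1 - p)) \<le> e / 2"
  proof -
    have "1 / (1 - p) * (1 - p) = 1" using p by simp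
    then have "K powr (1 - p) = e / (4 * (R + 1))" using e R0 by (simp only: K_def powr_powr) simp
    then have "2 * (R * K powr (1 - p)) = R / (R + 1) * (e / 2)" using R0 by (simp add: field_simps)
    also have "\<dots> \<le> 1 * (e / 2)" using R0 e by (intro mult_right_mono) auto
    finally show ?thesis by simp
  qed
  define T where "T k \<omega> = truncate K (V k \<omega>)" for k \<omega>
  define U where "U k \<omega> = V k \<omega> - T k \<omega>" for k \<omega>
  have [measurable]: "T k \<in> borel_measurable M" "U k \<in> borel_measurable M" for k
    unfolding U_def[abs_def] T_def[abs_def] by measurable
  have iT: "integrable M (T k)" for k
    unfolding T_def using K abs_truncate_le(1)[of K] by (intro integrable_bounded[where c=K]) auto
  have iU: "integrable M (U k)" for k unfolding U_def using iV iT by auto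
  have Ue: "(\<integral>\<omega>. \<bar>U k \<omega>\<bar> \<partial>M) \<le> R * K powr (1 - p)" for k
  proof -
    have "(\<integral>\<omega>. \<bar>U k \<omega>\<bar> \<partial>M) \<le> (\<integral>\<omega>. K powr (1 - p) * \<bar>V k \<omega>\<bar> powr p \<partial>M)"
      using K p unfolding U_def T_def
      by (intro integral_mono integrable_abs iU[unfolded U_def T_def] integrable_mult_right iVp truncate_error_abs) auto
    also have "\<dots> \<le> R * K powr (1 - p)"
      using mult_right_mono[OF iVp(2)[of k], of "K powr (1 - p)"] by (simp add: mult.commute)
    finally show ?thesis .
  qed
  have UE: "(\<integral>\<omega>. \<bar>centered_sum M U n \<omega>\<bar> \<partial>M) \<le> real n * (e / 2)" for n
  proof -
    have "(\<integral>\<omega>. \<bar>centered_sum M U n \<omega>\<bar> \<partial>M) \<le> (\<integral>\<omega>. (\<Sum>k=1..n. \<bar>U k \<omega>\<bar> + R * K powr (1 - p)) \<partial>M)"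
    proof (rule integral_mono)
      show "integrable M (\<lambda>\<omega>. \<bar>centered_sum M U n \<omega>\<bar>)"
        unfolding centered_sum_def using iU by auto
      show "integrable M (\<lambda>\<omega>. \<Sum>k=1..n. \<bar>U k \<omega>\<bar> + R * K powr (1 - p))" using iU by auto
      show "\<bar>centered_sum M U n \<omega>\<bar> \<le> (\<Sum>k=1..n. \<bar>U k \<omega>\<bar> + R * K powr (1 - p))" for \<omega>
        unfolding centered_sum_def
      proof (intro order_trans[OF sum_abs] sum_mono)
        fix k
        have "\<bar>\<integral>\<omega>. U k \<omega> \<partial>M\<bar> \<le> R * K powr (1 - p)"
          using integral_abs_bound[of M "U k"] Ue[of k] by linarith
        then show "\<bar>U k \<omega> - (\<integral>\<omega>. U k \<omega> \<partial>M)\<bar> \<le> \<bar>U k \<omega>\<bar> + R * K powr (1 - p)"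
          using abs_triangle_ineq4[of "U k \<omega>" "\<integral>\<omega>. U k \<omega> \<partial>M"] by linarith
      qed
    qed
    also have "\<dots> = (\<Sum>k=1..n. (\<integral>\<omega>. \<bar>U k \<omega>\<bar> \<partial>M) + R * K powr (1 - p))"
      using iU by (subst Bochner_Integration.integral_sum) (auto simp: prob_space)
    also have "\<dots> \<le> (\<Sum>k=1..n. e / 2)"
      using Ue KR by (intro sum_mono) (smt (verit))
    finally show ?thesis by simp
  qed
  define q where "q n = 8 * K\<^sup>2 * ((\<Sum>k<n. a k) / real n)" for n
  have "q \<longlonglongrightarrow> 8 * K\<^sup>2 * 0"
    unfolding q_def by (intro tendsto_intros cesaro_null a0 rate_nonneg)
  then have "eventually (\<lambda>n. q n < (e / 4)\<^sup>2) sequentially"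
    using e by (intro order_tendstoD(2)) auto
  then obtain N where N: "\<And>n. N \<le> n \<Longrightarrow> q n < (e / 4)\<^sup>2" by (auto simp: eventually_sequentially)
  show "\<exists>no. \<forall>n\<ge>no. norm ((\<integral>\<omega>. \<bar>centered_sum M V n \<omega> / real n\<bar> \<partial>M) - 0) < e"
  proof (intro exI allI impI)
    fix n assume n: "max N 1 \<le> n"
    have iS: "integrable M (\<lambda>\<omega>. \<bar>centered_sum M W n \<omega> / real n\<bar>)" if "\<And>k. integrable M (W k)" for W
      unfolding centered_sum_def using that by auto
    have i2: "integrable M (\<lambda>\<omega>. (centered_sum M T n \<omega>)\<^sup>2)"
      using truncated_variance(1)[OF K, of n] by (simp add: T_def[abs_def])
    have "(\<integral>\<omega>. (centered_sum M T n \<omega>)\<^sup>2 \<partial>M) \<le> (\<Sum>i\<in>{1..n}. \<Sum>j\<in>{1..n}. 4 * K\<^sup>2 * a (lag i j))"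
      unfolding T_def[abs_def] truncated_variance(2)[OF K]
      by (intro sum_mono order_trans[OF abs_ge_self truncated_variance(3)[OF K]])
    also have "\<dots> = 4 * K\<^sup>2 * (\<Sum>i\<in>{1..n}. \<Sum>j\<in>{1..n}. a (lag i j))" by (simp add: sum_distrib_left)
    also have "\<dots> \<le> 4 * K\<^sup>2 * (2 * real n * (\<Sum>k<n. a k))"
      by (intro mult_left_mono lag_double_sum_le rate_nonneg) auto
    also have "\<dots> = q n * (real n)\<^sup>2" using n by (simp add: q_def power2_eq_square)
    finally have v: "(\<integral>\<omega>. (centered_sum M T n \<omega>)\<^sup>2 \<partial>M) \<le> q n * (real n)\<^sup>2" .
    have "(\<integral>\<omega>. \<bar>centered_sum M T n \<omega> / real n\<bar> \<partial>M) \<le> e / 4"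
    proof (rule expectation_abs_le_of_square)
      show "integrable M (\<lambda>\<omega>. (centered_sum M T n \<omega> / real n)\<^sup>2)" using i2 by (simp add: power_divide)
      have "(\<integral>\<omega>. (centered_sum M T n \<omega> / real n)\<^sup>2 \<partial>M) = (\<integral>\<omega>. (centered_sum M T n \<omega>)\<^sup>2 \<partial>M) / (real n)\<^sup>2"
        by (simp add: power_divide)
      also have "\<dots> \<le> q n" using v n by (simp add: pos_divide_le_eq)
      finally show "(\<integral>\<omega>. (centered_sum M T n \<omega> / real n)\<^sup>2 \<partial>M) \<le> (e / 4)\<^sup>2" using N[of n] n by simp
    qed (use e in simp_all)
    moreover have "(\<integral>\<omega>. \<bar>centered_sum M U n \<omega> / real n\<bar> \<partial>M) \<le> e / 2"
      using UE[of n] n by (simp add: abs_divide pos_divide_le_eq mult.commute)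
    moreover have "(\<integral>\<omega>. \<bar>centered_sum M V n \<omega> / real n\<bar> \<partial>M)
        \<le> (\<integral>\<omega>. \<bar>centered_sum M T n \<omega> / real n\<bar> + \<bar>centered_sum M U n \<omega> / real n\<bar> \<partial>M)"
    proof (rule integral_mono)
      show "integrable M (\<lambda>\<omega>. \<bar>centered_sum M V n \<omega> / real n\<bar>)"
        "integrable M (\<lambda>\<omega>. \<bar>centered_sum M T n \<omega> / real n\<bar> + \<bar>centered_sum M U n \<omega> / real n\<bar>)"
        by (intro Bochner_Integration.integrable_add iS iV iT iU)+
      fix \<omega>
      have "centered_sum M U n \<omega> = centered_sum M V n \<omega> - centered_sum M T n \<omega>"
        unfolding U_def[abs_def] by (rule centered_sum_diff[OF iV iT])
      then show "\<bar>centered_sum M V n \<omega> / real n\<bar> \<le> \<bar>centered_sum M T n \<omega> / real n\<bar> + \<bar>centered_sum M U n \<omega> / real n\<bar>"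
        using abs_triangle_ineq[of "centered_sum M T n \<omega> / real n" "centered_sum M U n \<omega> / real n"]
        by (simp add: add_divide_distrib[symmetric])
    qed
    moreover have "\<dots> = (\<integral>\<omega>. \<bar>centered_sum M T n \<omega> / real n\<bar> \<partial>M) + (\<integral>\<omega>. \<bar>centered_sum M U n \<omega> / real n\<bar> \<partial>M)"
      by (rule Bochner_Integration.integral_add) (intro iS iT iU)+
    ultimately have "(\<integral>\<omega>. \<bar>centered_sum M V n \<omega> / real n\<bar> \<partial>M) < e" using e by linarith
    moreover have "0 \<le> (\<integral>\<omega>. \<bar>centered_sum M V n \<omega> / real n\<bar> \<partial>M)" by simp
    ultimately show "norm ((\<integral>\<omega>. \<bar>centered_sum M V n \<omega> / real n\<bar> \<partial>M) - 0) < e" by simp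
  qed
qed

end

text \<open>The condition \<open>1 / \<theta> < 2 - 2 / p\<close> leaves room for an interpolation
  weight \<open>s\<close> in between: \<open>s > 1 / \<theta>\<close> makes the interpolated
  covariances summable, and \<open>s < 2 - 2 / p\<close> keeps the variance of the truncated sums
  small enough for Chebyshev.\<close>

locale power_mixing = mixing M V "\<lambda>k. c * real (k + 1) powr (-\<theta>)" for M :: "'a measure" and V c \<theta> +
  fixes p R :: real
  assumes \<theta>: "1 < \<theta>" and p: "1 < p" "p \<le> 2" and p\<theta>: "1 / \<theta> < 2 - 2 / p"
    and pint: "\<And>k. integrable M (\<lambda>\<omega>. \<bar>V k \<omega>\<bar> powr p)"
    and ple: "\<And>k. (\<integral>\<omega>. \<bar>V k \<omega>\<bar> powr p \<partial>M) \<le> R"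
    and int: "\<And>k. integrable M (V k)"
begin

lemma R_nonneg: "0 \<le> R"
proof -
  have "0 \<le> (\<integral>\<omega>. \<bar>V 0 \<omega>\<bar> powr p \<partial>M)" by simp
  then show ?thesis using ple[of 0] by linarith
qed

lemma c_nonneg: "0 \<le> c"
  using rate_nonneg[of 0] by simp

text \<open>Here the two bounds \<open>4 * L\<^sup>2 * a k\<close> and \<open>R * L powr (2 - p)\<close> on a covariance are interpolated
  with weights \<open>s\<close> and \<open>1 - s\<close>.\<close>

lemma truncated_variance_power_bound:
  assumes s: "1 / \<theta> < s" "s \<le> 1"
  shows "\<exists>C\<ge>0. \<forall>L>0. \<forall>n. (\<integral>\<omega>. (centered_sum M (\<lambda>k \<omega>. truncate L (V k \<omega>)) n \<omega>)\<^sup>2 \<partial>M)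
     \<le> C * real n * L powr (2 - p + p * s)"
proof (intro exI conjI allI impI)
  define d where "d k = real (k + 1) powr (-\<theta> * s)" for k
  have s0: "0 < s" using s(1) \<theta> less_trans[of 0 "1 / \<theta>" s] by simp
  have d0: "0 \<le> d k" for k by (simp add: d_def)
  have sd: "summable d"
  proof -
    have "1 < s * \<theta>" using s(1) \<theta> by (simp add: pos_divide_less_eq)
    then show ?thesis unfolding d_def by (intro summable_shifted_powr) (simp add: mult.commute)
  qed
  define C where "C = (4 * c) powr s * R powr (1 - s)"
  have C0: "0 \<le> C" by (simp add: C_def)
  show "0 \<le> 2 * C * suminf d" using C0 sd d0 by (simp add: suminf_nonneg)
  fix L :: real and n assume L: "0 < L"
  define T where "T k \<omega> = truncate L (V k \<omega>)" for k \<omega>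
  have [measurable]: "T k \<in> borel_measurable M" for k unfolding T_def[abs_def] by measurable
  have T2: "integrable M (\<lambda>\<omega>. (T k \<omega>)\<^sup>2)" for k
    unfolding T_def using L abs_truncate_le(1)[of L]
    by (intro integrable_bounded[where c="L\<^sup>2"]) (auto simp: abs_le_square_iff[symmetric])
  have TE: "(\<integral>\<omega>. (T k \<omega>)\<^sup>2 \<partial>M) \<le> R * L powr (2 - p)" for k
  proof -
    have "(\<integral>\<omega>. (T k \<omega>)\<^sup>2 \<partial>M) \<le> (\<integral>\<omega>. L powr (2 - p) * \<bar>V k \<omega>\<bar> powr p \<partial>M)"
      using L p unfolding T_def
      by (intro integral_mono T2[unfolded T_def] integrable_mult_right pint truncate_square_powr) auto
    also have "\<dots> \<le> R * L powr (2 - p)"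
      using mult_right_mono[OF ple[of k], of "L powr (2 - p)"] by (simp add: mult.commute)
    finally show ?thesis .
  qed
  have cb: "\<bar>covar (T i) (T j)\<bar> \<le> C * L powr (2 - p + p * s) * d (lag i j)" for i j
  proof -
    define x where "x = \<bar>covar (T i) (T j)\<bar>"
    define l where "l = real (lag i j + 1)"
    have x0: "0 \<le> x" by (simp add: x_def)
    have 1: "x \<le> 4 * L\<^sup>2 * (c * l powr (-\<theta>))"
      unfolding x_def T_def[abs_def] l_def using truncated_variance(3)[OF L, of i j] by simp
    have 2: "x \<le> R * L powr (2 - p)"
      unfolding x_def by (intro covar_le_second_moments T2 TE) auto
    have "x = x powr s * x powr (1 - s)" using x0 by (simp add: powr_add[symmetric])
    also have "\<dots> \<le> (4 * L\<^sup>2 * (c * l powr (-\<theta>))) powr s * (R * L powr (2 - p)) powr (1 - s)"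
      using x0 1 2 s s0 by (intro mult_mono powr_mono2) auto
    also have "(4 * L\<^sup>2 * (c * l powr (-\<theta>))) powr s = (4 * c) powr s * L powr (2 * s) * l powr (-\<theta> * s)"
    proof -
      have "4 * L\<^sup>2 * (c * l powr (-\<theta>)) = (4 * c) * L powr 2 * l powr (-\<theta>)" using L by simp
      then show ?thesis using c_nonneg by (simp only: powr_mult powr_powr)
    qed
    also have "(R * L powr (2 - p)) powr (1 - s) = R powr (1 - s) * L powr ((2 - p) * (1 - s))"
      using R_nonneg by (simp add: powr_mult powr_powr)
    also have "(4 * c) powr s * L powr (2 * s) * l powr (-\<theta> * s) * (R powr (1 - s) * L powr ((2 - p) * (1 - s)))
        = C * (L powr (2 * s) * L powr ((2 - p) * (1 - s))) * l powr (-\<theta> * s)"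
      by (simp only: C_def ac_simps)
    also have "L powr (2 * s) * L powr ((2 - p) * (1 - s)) = L powr (2 - p + p * s)"
      by (simp add: powr_add[symmetric] algebra_simps)
    finally show ?thesis by (simp add: x_def d_def l_def)
  qed
  have "(\<integral>\<omega>. (centered_sum M T n \<omega>)\<^sup>2 \<partial>M) = (\<Sum>i\<in>{1..n}. \<Sum>j\<in>{1..n}. covar (T i) (T j))"
    by (intro centered_sum_variance T2) auto
  also have "\<dots> \<le> (\<Sum>i\<in>{1..n}. \<Sum>j\<in>{1..n}. C * L powr (2 - p + p * s) * d (lag i j))"
    by (intro sum_mono order_trans[OF abs_ge_self cb])
  also have "\<dots> = C * L powr (2 - p + p * s) * (\<Sum>i\<in>{1..n}. \<Sum>j\<in>{1..n}. d (lag i j))"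
    by (simp add: sum_distrib_left)
  also have "\<dots> \<le> C * L powr (2 - p + p * s) * (2 * real n * suminf d)"
    using C0 by (intro mult_left_mono lag_double_sum_le_suminf[OF d0 sd]) auto
  finally show "(\<integral>\<omega>. (centered_sum M (\<lambda>k \<omega>. truncate L (V k \<omega>)) n \<omega>)\<^sup>2 \<partial>M)
     \<le> 2 * C * suminf d * real n * L powr (2 - p + p * s)"
    unfolding T_def[abs_def] by (simp only: ac_simps)
qed

text \<open>Truncation takes place at \<open>L = n powr \<gamma>\<close>. Some summand exceeds
  \<open>L\<close> with probability at most \<open>R * n powr (1 - \<gamma> * p)\<close>, and
  Chebyshev gives order \<open>n powr (\<gamma> * q - 1)\<close> for the truncated sum.\<close>

lemma large_deviation_rate:
  "\<exists>\<delta>>0. \<forall>e>0. \<exists>C N. \<forall>n\<ge>N. prob {\<omega>\<in>space M. e * real n \<le> \<bar>centered_sum M V n \<omega>\<bar>} \<le> C * real n powr (-\<delta>)"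
proof -
  have p2: "2 - 2 / p \<le> 1" using p by (simp add: field_simps)
  obtain s where s: "1 / \<theta> < s" "s < 2 - 2 / p" using dense[OF p\<theta>] by auto
  have s1: "s \<le> 1" using s p2 by linarith
  have s0: "0 < s" using s(1) \<theta> less_trans[of 0 "1 / \<theta>" s] by simp
  define q where "q = 2 - p + p * s"
  have q0: "0 < q" using p s0 by (simp add: q_def add_nonneg_pos)
  have "p * s < p * (2 - 2 / p)" using s(2) p by (intro mult_strict_left_mono) auto
  then have "q < p" using p by (simp add: q_def algebra_simps)
  then have "1 / p < 1 / q" using q0 by (simp add: frac_less2)
  \<comment> \<open>Both exponents are negative exactly for \<open>1 / p < \<gamma> < 1 / q\<close>.
    The interval is nonempty because \<open>q < p\<close>, which is \<open>s < 2 - 2 / p\<close>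
    rewritten.\<close>
  then obtain \<gamma> where \<gamma>: "1 / p < \<gamma>" "\<gamma> < 1 / q" using dense by blast
  have \<gamma>0: "0 < \<gamma>" using \<gamma>(1) p less_trans[of 0 "1 / p" \<gamma>] by simp
  have \<gamma>p: "1 < \<gamma> * p" using \<gamma>(1) p by (simp add: pos_divide_less_eq)
  have \<gamma>q: "\<gamma> * q < 1" using \<gamma>(2) q0 by (simp add: pos_less_divide_eq)
  define \<delta> where "\<delta> = min (\<gamma> * p - 1) (1 - \<gamma> * q)"
  have \<delta>: "0 < \<delta>" "\<delta> \<le> \<gamma> * p - 1" "\<delta> \<le> 1 - \<gamma> * q" using \<gamma>p \<gamma>q by (auto simp: \<delta>_def)
  obtain C where C: "0 \<le> C" "\<And>L n. 0 < L \<Longrightarrow>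
      (\<integral>\<omega>. (centered_sum M (\<lambda>k \<omega>. truncate L (V k \<omega>)) n \<omega>)\<^sup>2 \<partial>M) \<le> C * real n * L powr q"
    using truncated_variance_power_bound[OF s(1) s1] unfolding q_def by blast
  have "\<exists>D N. \<forall>n\<ge>N. prob {\<omega>\<in>space M. e * real n \<le> \<bar>centered_sum M V n \<omega>\<bar>} \<le> D * real n powr (-\<delta>)"
    if e: "0 < e" for e
  proof -
    \<comment> \<open>Truncation shifts each mean by at most \<open>R * L powr (1 - p)\<close>,
      which tends to 0; from \<open>N\<close> on the shift is below half of the deviation
      \<open>e\<close>.\<close>
    have "(\<lambda>n. R * real n powr (\<gamma> * (1 - p))) \<longlonglongrightarrow> R * 0"
      using \<gamma>0 p by (intro tendsto_intros tendsto_neg_powr filterlim_real_sequentially) (simp add: mult_pos_neg)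
    then have "eventually (\<lambda>n. R * real n powr (\<gamma> * (1 - p)) < e / 2) sequentially"
      using e by (intro order_tendstoD(2)) auto
    then obtain N where N: "\<And>n. N \<le> n \<Longrightarrow> R * real n powr (\<gamma> * (1 - p)) < e / 2"
      by (auto simp: eventually_sequentially)
    show ?thesis
    proof (intro exI allI impI)
      fix n assume n: "max N 1 \<le> n"
      define L where "L = real n powr \<gamma>"
      have n1: "1 \<le> real n" using n by simp
      have L: "0 < L" using n by (simp add: L_def)
      define T where "T k \<omega> = truncate L (V k \<omega>)" for k \<omega>
      have [measurable]: "T k \<in> borel_measurable M" for k unfolding T_def[abs_def] by measurable
      have iT: "integrable M (T k)" for k
        unfolding T_def using L abs_truncate_le(1)[of L] by (intro integrable_bounded[where c=L]) auto
      have mean: "\<bar>expectation (V k) - expectation (T k)\<bar> \<le> e / 2" for k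
      proof -
        have "\<bar>expectation (V k) - expectation (T k)\<bar> = \<bar>\<integral>\<omega>. V k \<omega> - T k \<omega> \<partial>M\<bar>"
          using int iT by simp
        also have "\<dots> \<le> (\<integral>\<omega>. \<bar>V k \<omega> - T k \<omega>\<bar> \<partial>M)" by (rule integral_abs_bound)
        also have "\<dots> \<le> (\<integral>\<omega>. L powr (1 - p) * \<bar>V k \<omega>\<bar> powr p \<partial>M)"
          using L p unfolding T_def
          by (intro integral_mono integrable_abs Bochner_Integration.integrable_diff int iT[unfolded T_def]
              integrable_mult_right pint truncate_error_abs) auto
        also have "\<dots> \<le> R * L powr (1 - p)"
          using mult_right_mono[OF ple[of k], of "L powr (1 - p)"] by (simp add: mult.commute)
        also have "\<dots> = R * real n powr (\<gamma> * (1 - p))" by (simp add: L_def powr_powr)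
        finally show ?thesis using N[of n] n by simp
      qed
      define A where "A k = {\<omega>\<in>space M. L < \<bar>V k \<omega>\<bar>}" for k
      define B where "B = {\<omega>\<in>space M. e / 2 * real n \<le> \<bar>centered_sum M T n \<omega>\<bar>}"
      have AM[measurable]: "A k \<in> sets M" for k unfolding A_def by measurable
      have BM[measurable]: "B \<in> sets M" unfolding B_def by measurable
      have PA: "prob (A k) \<le> R * L powr (- p)" for k
      proof -
        have "prob (A k) = (\<integral>\<omega>. indicator (A k) \<omega> \<partial>M)" by simp
        also have "\<dots> \<le> (\<integral>\<omega>. L powr (- p) * \<bar>V k \<omega>\<bar> powr p \<partial>M)"
        proof (rule integral_mono)
          show "integrable M (indicat_real (A k))"
            by (intro integrable_real_indicator) (auto simp: emeasure_eq_measure)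
          show "integrable M (\<lambda>\<omega>. L powr (- p) * \<bar>V k \<omega>\<bar> powr p)" using pint by auto
          show "indicat_real (A k) \<omega> \<le> L powr (- p) * \<bar>V k \<omega>\<bar> powr p" for \<omega>
            using powr_truncation[of L 0 p "V k \<omega>"] L p by (cases "V k \<omega> = 0") (auto simp: indicator_def A_def)
        qed
        also have "\<dots> \<le> R * L powr (- p)"
          using mult_right_mono[OF ple[of k], of "L powr (- p)"] by (simp add: mult.commute)
        finally show ?thesis .
      qed
      have PB: "prob B \<le> C * real n * L powr q / (e / 2 * real n)\<^sup>2"
      proof -
        have i2: "integrable M (\<lambda>\<omega>. (centered_sum M T n \<omega>)\<^sup>2)"
          using truncated_variance(1)[OF L, of n] by (simp add: T_def[abs_def])
        have "prob B \<le> (\<integral>\<omega>. (centered_sum M T n \<omega>)\<^sup>2 \<partial>M) / (e / 2 * real n)\<^sup>2"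
          unfolding B_def using e n by (intro second_moment_method i2) auto
        also have "\<dots> \<le> C * real n * L powr q / (e / 2 * real n)\<^sup>2"
          using C(2)[OF L, of n] by (intro divide_right_mono) (auto simp: T_def[abs_def])
        finally show ?thesis .
      qed
      have "{\<omega>\<in>space M. e * real n \<le> \<bar>centered_sum M V n \<omega>\<bar>} \<subseteq> (\<Union>k\<in>{1..n}. A k) \<union> B"
      proof
        fix \<omega> assume w: "\<omega> \<in> {\<omega>\<in>space M. e * real n \<le> \<bar>centered_sum M V n \<omega>\<bar>}"
        show "\<omega> \<in> (\<Union>k\<in>{1..n}. A k) \<union> B"
        proof (cases "\<omega> \<in> (\<Union>k\<in>{1..n}. A k)")
          case False
          then have VT: "V k \<omega> = T k \<omega>" if "k \<in> {1..n}" for k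
            using w that by (force simp: A_def T_def truncate_def)
          have "centered_sum M V n \<omega> - centered_sum M T n \<omega> = (\<Sum>k=1..n. expectation (T k) - expectation (V k))"
            unfolding centered_sum_def sum_subtractf[symmetric] by (intro sum.cong) (auto simp: VT)
          also have "\<bar>\<dots>\<bar> \<le> (\<Sum>k=1..n. e / 2)"
            using mean by (intro order_trans[OF sum_abs] sum_mono) (simp add: abs_minus_commute)
          finally have "\<bar>centered_sum M V n \<omega> - centered_sum M T n \<omega>\<bar> \<le> e / 2 * real n" by (simp add: mult.commute)
          then have "e / 2 * real n \<le> \<bar>centered_sum M T n \<omega>\<bar>"
            using w abs_triangle_ineq2[of "centered_sum M V n \<omega>" "centered_sum M T n \<omega>"] by auto
          then show ?thesis using w by (simp add: B_def)
        qed auto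
      qed
      then have "prob {\<omega>\<in>space M. e * real n \<le> \<bar>centered_sum M V n \<omega>\<bar>} \<le> prob ((\<Union>k\<in>{1..n}. A k) \<union> B)"
        by (intro finite_measure_mono) auto
      also have "\<dots> \<le> prob (\<Union>k\<in>{1..n}. A k) + prob B" by (intro measure_Un_le) auto
      also have "prob (\<Union>k\<in>{1..n}. A k) \<le> (\<Sum>k\<in>{1..n}. prob (A k))"
        by (intro measure_UNION_le) auto
      also have "\<dots> \<le> (\<Sum>k\<in>{1..n}. R * L powr (- p))" by (intro sum_mono PA)
      also have "\<dots> = R * real n powr (1 - \<gamma> * p)"
        using n by (simp add: L_def powr_powr powr_diff powr_minus divide_inverse)
      also have "\<dots> \<le> R * real n powr (-\<delta>)"
        using n1 \<delta> R_nonneg by (intro mult_left_mono powr_mono) auto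
      also have "prob B \<le> 4 * C / e\<^sup>2 * real n powr (-\<delta>)"
      proof -
        have "C * real n * L powr q / (e / 2 * real n)\<^sup>2 = 4 * C / e\<^sup>2 * real n powr (\<gamma> * q - 1)"
          using n e by (simp add: L_def powr_powr powr_diff power_mult_distrib power_divide power2_eq_square[of "real n"])
        also have "\<dots> \<le> 4 * C / e\<^sup>2 * real n powr (-\<delta>)"
          using n1 \<delta> C(1) by (intro mult_left_mono powr_mono) auto
        finally show ?thesis using PB by simp
      qed
      finally show "prob {\<omega>\<in>space M. e * real n \<le> \<bar>centered_sum M V n \<omega>\<bar>} \<le> (R + 4 * C / e\<^sup>2) * real n powr (-\<delta>)"
        by (simp add: distrib_right)
    qed
  qed
  then show ?thesis using \<delta>(1) by blast
qed

text \<open>However small \<open>\<delta>\<close> is, sparse enough powers make the deviation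
  probabilities summable: along \<open>k ^ m\<close> they are of order
  \<open>k powr (- m * \<delta>)\<close>, and \<open>m\<close> exceeds
  \<open>2 / \<delta>\<close>.\<close>

lemma subsequence_law_of_large_numbers:
  "\<exists>m\<ge>1. AE \<omega> in M. (\<lambda>k. centered_sum M V (k ^ m) \<omega> / real (k ^ m)) \<longlonglongrightarrow> 0"
proof -
  obtain \<delta> where \<delta>: "0 < \<delta>" and dev: "\<And>e. 0 < e \<Longrightarrow> \<exists>C N. \<forall>n\<ge>N.
      prob {\<omega>\<in>space M. e * real n \<le> \<bar>centered_sum M V n \<omega>\<bar>} \<le> C * real n powr (-\<delta>)"
    using large_deviation_rate by blast
  define m where "m = nat \<lceil>2 / \<delta>\<rceil> + 1"
  have m1: "1 \<le> m" and m\<delta>: "1 < real m * \<delta>"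
  proof -
    have "2 / \<delta> < real m" unfolding m_def by linarith
    then show "1 < real m * \<delta>" using \<delta> by (simp add: pos_divide_less_eq)
  qed (simp add: m_def)
  have "AE \<omega> in M. eventually (\<lambda>k. \<bar>centered_sum M V (k ^ m) \<omega> / real (k ^ m)\<bar> < e) sequentially" if e: "0 < e" for e
  proof -
    define A where "A k = {\<omega>\<in>space M. e * real (k ^ m) \<le> \<bar>centered_sum M V (k ^ m) \<omega>\<bar>}" for k
    have AM: "A k \<in> sets M" for k unfolding A_def by measurable
    obtain C N where CN: "\<And>n. N \<le> n \<Longrightarrow> prob {\<omega>\<in>space M. e * real n \<le> \<bar>centered_sum M V n \<omega>\<bar>} \<le> C * real n powr (-\<delta>)"
      using dev[OF e] by blast
    have "summable (\<lambda>k. prob (A k))"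
    proof (rule summable_comparison_test')
      show "summable (\<lambda>k. C * real k powr (- (real m * \<delta>)))"
        using m\<delta> by (intro summable_mult) (simp add: summable_real_powr_iff)
      fix k assume k: "max N 1 \<le> k"
      have "N \<le> k ^ m" using k m1 self_le_power[of k m] by linarith
      then have "prob (A k) \<le> C * real (k ^ m) powr (-\<delta>)" unfolding A_def by (rule CN)
      also have "real (k ^ m) powr (-\<delta>) = real k powr (- (real m * \<delta>))"
        using k by (simp add: powr_realpow[symmetric] powr_powr)
      finally show "norm (prob (A k)) \<le> C * real k powr (- (real m * \<delta>))" by simp
    qed
    then have "AE \<omega> in M. eventually (\<lambda>k. \<omega> \<in> space M - A k) sequentially"
      by (intro borel_cantelli_AE1 AM) (simp add: less_top[symmetric])
    then show ?thesis
    proof eventually_elim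
      case (elim \<omega>)
      show ?case using elim eventually_ge_at_top[of 1]
      proof eventually_elim
        case (elim k)
        then show ?case by (auto simp: A_def abs_divide pos_divide_less_eq not_le)
      qed
    qed
  qed
  then have "AE \<omega> in M. \<forall>j. eventually (\<lambda>k. \<bar>centered_sum M V (k ^ m) \<omega> / real (k ^ m)\<bar> < 1 / real (Suc j)) sequentially"
    by (subst AE_all_countable) simp
  then have "AE \<omega> in M. (\<lambda>k. centered_sum M V (k ^ m) \<omega> / real (k ^ m)) \<longlonglongrightarrow> 0"
  proof eventually_elim
    case (elim \<omega>)
    show ?case
    proof (rule tendstoI)
      fix e :: real assume "0 < e"
      then obtain j where "1 / real (Suc j) < e" using nat_approx_posE by blast
      then show "eventually (\<lambda>k. dist (centered_sum M V (k ^ m) \<omega> / real (k ^ m)) 0 < e) sequentially"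
        using elim[rule_format, of j] by (auto elim!: eventually_mono simp: dist_norm)
    qed
  qed
  then show ?thesis using m1 by blast
qed

end

text \<open>For nonnegative summands the partial sums are monotone, so they are controlled between two
  consecutive indices \<open>k ^ m\<close>, whose ratio tends to 1.\<close>

lemma averages_interpolation:
  fixes x e :: "nat \<Rightarrow> real"
  assumes m: "1 \<le> m" and x: "\<And>k. 0 \<le> x k" and e: "\<And>k. 0 \<le> e k" "\<And>k. e k \<le> D"
    and sub: "(\<lambda>k. (\<Sum>i=1..k ^ m. x i - e i) / real (k ^ m)) \<longlonglongrightarrow> 0"
  shows "(\<lambda>n. (\<Sum>i=1..n. x i - e i) / real n) \<longlonglongrightarrow> 0"
proof -
  define A where "A n = (\<Sum>i=1..n. x i)" for n
  define E where "E n = (\<Sum>i=1..n. e i)" for n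
  define d where "d k = (A (k ^ m) - E (k ^ m)) / real (k ^ m)" for k
  have AE: "(\<Sum>i=1..n. x i - e i) = A n - E n" for n by (simp add: A_def E_def sum_subtractf)
  have "d = (\<lambda>k. (\<Sum>i=1..k ^ m. x i - e i) / real (k ^ m))" by (simp only: fun_eq_iff d_def AE) simp
  then have d0: "d \<longlonglongrightarrow> 0" using sub by (simp only:)
  define \<rho> where "\<rho> k = real (Suc k ^ m) / real (k ^ m)" for k
  have \<rho>1: "\<rho> \<longlonglongrightarrow> 1"
  proof -
    have "(\<lambda>k. (real (Suc k) / real k) ^ m) \<longlonglongrightarrow> 1 ^ m"
      by (intro tendsto_power LIMSEQ_Suc_n_over_n)
    then show ?thesis unfolding \<rho>_def by (simp add: power_divide)
  qed
  \<comment> \<open>Collects the deviations at the two neighbouring powers and the growth of the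
    means between them, all relative to the lower power.\<close>
  define h where "h k = \<bar>d (Suc k)\<bar> * \<rho> k + \<bar>d k\<bar> + D * (\<rho> k - 1)" for k
  have "h \<longlonglongrightarrow> \<bar>0\<bar> * 1 + \<bar>0\<bar> + D * (1 - 1)"
    unfolding h_def by (intro tendsto_intros d0 \<rho>1 LIMSEQ_Suc)
  then have h0: "h \<longlonglongrightarrow> 0" by simp
  have Amono: "A i \<le> A j" and Emono: "E i \<le> E j" if "i \<le> j" for i j
    unfolding A_def E_def using that x e by (auto intro!: sum_mono2)
  have Ediff: "E j - E i \<le> D * (real j - real i)" if "i \<le> j" for i j
  proof -
    have "E j = E i + (\<Sum>l\<in>{i<..j}. e l)"
      unfolding E_def using that by (subst sum.union_disjoint[symmetric]) (auto intro!: sum.cong)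
    also have "(\<Sum>l\<in>{i<..j}. e l) \<le> (\<Sum>l\<in>{i<..j}. D)" by (intro sum_mono e)
    finally show ?thesis using that by (simp add: of_nat_diff mult.commute)
  qed
  have key: "\<bar>(A n - E n) / real n\<bar> \<le> h k" if k: "1 \<le> k" "k ^ m \<le> n" "n \<le> Suc k ^ m" for n k
  proof -
    define P Q where "P = k ^ m" and "Q = Suc k ^ m"
    have P: "0 < real P" using k by (simp add: P_def)
    have PQ: "P \<le> n" "n \<le> Q" "P \<le> Q" using k by (auto simp: P_def Q_def)
    have Q: "0 < real Q" by (simp add: Q_def)
    have dP: "A P - E P = d k * real P" using P by (simp add: d_def P_def)
    have dQ: "A Q - E Q = d (Suc k) * real Q" using Q by (simp add: d_def Q_def)
    have up: "A n - E n \<le> \<bar>d (Suc k)\<bar> * real Q + D * (real Q - real P)"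
    proof -
      have "A n - E n \<le> A Q - E P" using Amono[of n Q] Emono[of P n] PQ by linarith
      also have "\<dots> = d (Suc k) * real Q + (E Q - E P)" using dQ by linarith
      also have "\<dots> \<le> \<bar>d (Suc k)\<bar> * real Q + D * (real Q - real P)"
        using Ediff[OF PQ(3)] by (intro add_mono mult_right_mono) auto
      finally show ?thesis .
    qed
    have lo: "- (A n - E n) \<le> \<bar>d k\<bar> * real P + D * (real Q - real P)"
    proof -
      have "- (A n - E n) \<le> E Q - A P" using Amono[of P n] Emono[of n Q] PQ by linarith
      also have "\<dots> = (- d k) * real P + (E Q - E P)" using dP by simp
      also have "\<dots> \<le> \<bar>d k\<bar> * real P + D * (real Q - real P)"
        using Ediff[OF PQ(3)] by (intro add_mono mult_right_mono) auto
      finally show ?thesis .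
    qed
    have nn: "0 \<le> \<bar>d k\<bar> * real P" "0 \<le> \<bar>d (Suc k)\<bar> * real Q" by auto
    have "\<bar>A n - E n\<bar> \<le> \<bar>d (Suc k)\<bar> * real Q + \<bar>d k\<bar> * real P + D * (real Q - real P)"
      using up lo nn by linarith
    also have "\<dots> = h k * real P"
    proof -
      have "\<rho> k * real P = real Q" unfolding \<rho>_def P_def[symmetric] Q_def[symmetric] using P by simp
      then show ?thesis by (simp add: h_def algebra_simps)
    qed
    finally have *: "\<bar>A n - E n\<bar> \<le> h k * real P" .
    have "0 \<le> h k * real P" using * by linarith
    then have hk: "0 \<le> h k" using P by (simp add: zero_le_mult_iff)
    have "\<bar>A n - E n\<bar> \<le> h k * real n" using * mult_left_mono[OF _ hk, of "real P" "real n"] PQ by linarith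
    then show ?thesis using PQ P by (simp add: abs_divide pos_divide_le_eq)
  qed
  show ?thesis
  proof (rule LIMSEQ_I)
    fix \<epsilon> :: real assume "0 < \<epsilon>"
    then obtain k0 where k0: "\<And>k. k0 \<le> k \<Longrightarrow> \<bar>h k\<bar> < \<epsilon>" using LIMSEQ_D[OF h0, of \<epsilon>] by auto
    show "\<exists>no. \<forall>n\<ge>no. norm ((\<Sum>i=1..n. x i - e i) / real n - 0) < \<epsilon>"
    proof (intro exI allI impI)
      fix n assume n: "(k0 + 1) ^ m \<le> n"
      \<comment> \<open>The set is finite since \<open>k \<le> k ^ m\<close>, and its maximum
        \<open>k\<close> brackets \<open>n\<close> between \<open>k ^ m\<close> and
        \<open>Suc k ^ m\<close>.\<close>
      define K where "K = {k. k ^ m \<le> n}"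
      have "k \<le> n" if "k \<in> K" for k
        using that m self_le_power[of k m] by (cases "k = 0") (auto simp: K_def)
      then have fin: "finite K" by (meson finite_nat_set_iff_bounded_le)
      have k0K: "k0 + 1 \<in> K" using n by (simp add: K_def)
      define k where "k = Max K"
      have "k \<in> K" unfolding k_def using fin k0K by (intro Max_in) auto
      moreover have ge: "k0 + 1 \<le> k" unfolding k_def using fin k0K by (rule Max_ge)
      moreover have "Suc k \<notin> K" using Max_ge[OF fin, of "Suc k"] unfolding k_def by auto
      ultimately have "\<bar>(A n - E n) / real n\<bar> \<le> h k" by (intro key) (auto simp: K_def)
      then show "norm ((\<Sum>i=1..n. x i - e i) / real n - 0) < \<epsilon>"
        unfolding AE using k0[of k] ge by simp
    qed
  qed
qed

lemma (in power_mixing) nonneg_strong_law: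
  assumes nn: "\<And>k \<omega>. 0 \<le> V k \<omega>"
  shows "AE \<omega> in M. (\<lambda>n. centered_sum M V n \<omega> / real n) \<longlonglongrightarrow> 0"
proof -
  obtain m where m: "1 \<le> m" and AE: "AE \<omega> in M. (\<lambda>k. centered_sum M V (k ^ m) \<omega> / real (k ^ m)) \<longlonglongrightarrow> 0"
    using subsequence_law_of_large_numbers by blast
  have e1: "expectation (V k) \<le> 1 + R" for k
  proof -
    have *: "x \<le> 1 + \<bar>x\<bar> powr p" for x :: real
      using powr_le_one_plus_powr[of 1 p x] p by simp
    have "expectation (V k) \<le> (\<integral>\<omega>. 1 + \<bar>V k \<omega>\<bar> powr p \<partial>M)"
      by (intro integral_mono * int) (use pint in auto)
    also have "\<dots> \<le> 1 + R" using pint ple[of k] by (simp add: prob_space)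
    finally show ?thesis .
  qed
  from AE show ?thesis
  proof eventually_elim
    case (elim \<omega>)
    show ?case
      unfolding centered_sum_def
      by (rule averages_interpolation[OF m nn _ e1])
         (use elim nn in \<open>auto simp: centered_sum_def\<close>)
  qed
qed

lemma (in power_mixing) strong_law_of_large_numbers:
  "AE \<omega> in M. (\<lambda>n. centered_sum M V n \<omega> / real n) \<longlonglongrightarrow> 0"
proof -
  \<comment> \<open>Positive and negative part do not increase absolute values, so they meet the
    assumptions of the locale with the same constants.\<close>
  have part: "power_mixing M (\<lambda>k \<omega>. g (V k \<omega>)) c \<theta> p R"
    if [measurable]: "g \<in> borel_measurable borel" and g: "\<And>x. \<bar>g x\<bar> \<le> \<bar>x\<bar>" for g :: "real \<Rightarrow> real"
  proof -
    interpret g: mixing M "\<lambda>k \<omega>. g (V k \<omega>)" "\<lambda>k. c * real (k + 1) powr (-\<theta>)"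
      by (rule mixing_transform[OF mixing_axioms]) simp
    have le: "\<bar>g x\<bar> powr p \<le> \<bar>x\<bar> powr p" for x using p g by (intro powr_mono2) auto
    have i: "integrable M (\<lambda>\<omega>. \<bar>g (V k \<omega>)\<bar> powr p)" for k
      by (rule Bochner_Integration.integrable_bound[OF pint[of k]]) (use le in auto)
    have "(\<integral>\<omega>. \<bar>g (V k \<omega>)\<bar> powr p \<partial>M) \<le> R" for k
      using integral_mono[OF i pint le] ple[of k] by (rule order_trans)
    moreover have "integrable M (\<lambda>\<omega>. g (V k \<omega>))" for k
      by (rule Bochner_Integration.integrable_bound[OF int[of k]]) (use g in auto)
    ultimately show ?thesis using \<theta> p p\<theta> i by unfold_locales auto
  qed
  interpret pos: power_mixing M "\<lambda>k \<omega>. max 0 (V k \<omega>)" c \<theta> p R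
    by (rule part[of "max 0"]) auto
  interpret neg: power_mixing M "\<lambda>k \<omega>. max 0 (- V k \<omega>)" c \<theta> p R
    by (rule part[of "\<lambda>x. max 0 (- x)"]) auto
  have eq: "centered_sum M V n \<omega> = centered_sum M (\<lambda>k \<omega>. max 0 (V k \<omega>)) n \<omega> - centered_sum M (\<lambda>k \<omega>. max 0 (- V k \<omega>)) n \<omega>" for n \<omega>
  proof -
    have "V = (\<lambda>k \<omega>. max 0 (V k \<omega>) - max 0 (- V k \<omega>))" by (auto simp: fun_eq_iff)
    then have "centered_sum M V n \<omega> = centered_sum M (\<lambda>k \<omega>. max 0 (V k \<omega>) - max 0 (- V k \<omega>)) n \<omega>" by simp
    then show ?thesis by (simp add: centered_sum_diff[OF pos.int neg.int])
  qed
  have "AE \<omega> in M. (\<lambda>n. centered_sum M (\<lambda>k \<omega>. max 0 (V k \<omega>)) n \<omega> / real n) \<longlonglongrightarrow> 0"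
    by (rule pos.nonneg_strong_law) simp
  moreover have "AE \<omega> in M. (\<lambda>n. centered_sum M (\<lambda>k \<omega>. max 0 (- V k \<omega>)) n \<omega> / real n) \<longlonglongrightarrow> 0"
    by (rule neg.nonneg_strong_law) simp
  ultimately show ?thesis
  proof eventually_elim
    case (elim \<omega>)
    show ?case using tendsto_diff[OF elim] by (simp add: eq diff_divide_distrib)
  qed
qed

section \<open>Mixing of the iteration\<close>

text \<open>Agreement of events off a fixed set survives complements and countable unions, so it
  passes from the generators to all events. The exceptional set \<open>N\<close> is common to all
  \<open>k\<close> in \<open>I\<close>, which is what permanent coupling provides.\<close>

lemma proc_algebra_agree:
  assumes agree: "\<And>k \<omega>. k \<in> I \<Longrightarrow> \<omega> \<in> space M - N \<Longrightarrow> W k \<omega> = W' k \<omega>"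
    and H: "H \<in> sets (proc_algebra M S W I)"
  shows "\<exists>H'\<in>sets (proc_algebra M S W' I). H - N = H' - N"
proof -
  have "H \<in> sigma_sets (space M) (\<Union>k\<in>I. {W k -` A \<inter> space M | A. A \<in> sets S})"
    using H by (simp add: sets_proc_algebra generated_events_def)
  then show ?thesis
  proof induction
    case (Basic H)
    then obtain k A where k: "k \<in> I" "A \<in> sets S" "H = W k -` A \<inter> space M" by auto
    have "W' k -` A \<inter> space M \<in> sets (proc_algebra M S W' I)"
      unfolding sets_proc_algebra generated_events_def using k by (auto intro!: sigma_sets.Basic)
    moreover have "H - N = (W' k -` A \<inter> space M) - N"
      using agree[OF k(1)] k(3) by auto
    ultimately show ?case by blast
  next
    case Empty
    show ?case by (rule bexI[of _ "{}"]) auto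
  next
    case (Compl H)
    then obtain H' where "H' \<in> sets (proc_algebra M S W' I)" "H - N = H' - N" by blast
    then show ?case
      using sets.compl_sets[of H' "proc_algebra M S W' I"] by (intro bexI[of _ "space M - H'"]) auto
  next
    case (Union H)
    then obtain H' where "\<And>i. H' i \<in> sets (proc_algebra M S W' I)" "\<And>i. H i - N = H' i - N" by metis
    then show ?case by (intro bexI[of _ "\<Union>i. H' i"]) auto
  qed
qed

context prob_space
begin

text \<open>Replacing \<open>H\<close> by \<open>H'\<close> moves the probability of
  \<open>A \<inter> H\<close> and that of \<open>H\<close> by at most \<open>b\<close> each, hence
  \<open>2 * b\<close>.\<close>

lemma decoupled_approx:
  assumes d: "decoupled M F G a" and G': "subalgebra M G'"
    and N: "N \<in> sets M" "prob N \<le> b"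
    and approx: "\<And>H. H \<in> sets G' \<Longrightarrow> \<exists>H'\<in>sets G. H - N = H' - N"
  shows "decoupled M F G' (a + 2 * b)"
  unfolding decoupled_def
proof (intro conjI ballI)
  note sub = decoupledD(1,2)[OF d]
  fix A H assume A: "A \<in> sets F" and H: "H \<in> sets G'"
  obtain H' where H': "H' \<in> sets G" "H - N = H' - N" using approx[OF H] by auto
  have M: "A \<in> sets M" "H \<in> sets M" "H' \<in> sets M" using A H H' G' sub by (auto simp: subalgebra_def)
  have near: "\<bar>prob B - prob B'\<bar> \<le> b" if "B \<in> sets M" "B' \<in> sets M" "B - N = B' - N" for B B'
  proof -
    have "prob B \<le> prob (B' \<union> N)" "prob B' \<le> prob (B \<union> N)"
      using that N by (auto intro!: finite_measure_mono)
    moreover have "prob (B' \<union> N) \<le> prob B' + prob N" "prob (B \<union> N) \<le> prob B + prob N"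
      using that N by (auto intro!: measure_Un_le)
    ultimately show ?thesis using N(2) by linarith
  qed
  have 1: "\<bar>prob (A \<inter> H) - prob (A \<inter> H')\<bar> \<le> b" by (rule near) (use M H'(2) in auto)
  have 2: "\<bar>prob H - prob H'\<bar> \<le> b" by (rule near) (use M H'(2) in auto)
  have 3: "\<bar>prob A * prob H - prob A * prob H'\<bar> \<le> b"
  proof -
    have "\<bar>prob A * prob H - prob A * prob H'\<bar> = prob A * \<bar>prob H - prob H'\<bar>"
      by (simp add: abs_mult flip: right_diff_distrib)
    also have "\<dots> \<le> 1 * b" using 2 by (intro mult_mono) auto
    finally show ?thesis by simp
  qed
  have "\<bar>prob (A \<inter> H') - prob A * prob H'\<bar> \<le> a" using decoupledD(3)[OF d A H'(1)] .
  then show "\<bar>prob (A \<inter> H) - prob A * prob H\<bar> \<le> a + 2 * b" using 1 3 by linarith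
qed (use decoupledD(1)[OF d] G' in auto)

text \<open>Conditioning on the independent part \<open>F\<close> by Fubini: the law of the diagonal map is the
  product of the restrictions of \<open>M\<close> to \<open>F\<close> and \<open>E\<close>.\<close>

lemma decoupled_adjoin_independent:
  assumes F: "subalgebra M F" and E: "subalgebra M E"
    and indep: "\<And>A B. A \<in> sets F \<Longrightarrow> B \<in> sets E \<Longrightarrow> prob (A \<inter> B) = prob A * prob B"
    and d: "decoupled M G H a" and GE: "sets G \<subseteq> sets E" and HE: "sets H \<subseteq> sets E"
  shows "decoupled M (vimage_algebra (space M) (\<lambda>\<omega>. (\<omega>, \<omega>)) (F \<Otimes>\<^sub>M G)) H a"
proof -
  note sub = decoupledD(1,2)[OF d]
  have sp: "space F = space M" "space E = space M" "space G = space M" "space H = space M"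
    using F E sub by (auto simp: subalgebra_def)
  have GF: "sets (F \<Otimes>\<^sub>M G) \<subseteq> sets (F \<Otimes>\<^sub>M E)"
    using GE unfolding sets_pair_measure sp by (intro sigma_sets_mono') auto
  have diagE: "(\<lambda>\<omega>. (\<omega>, \<omega>)) \<in> M \<rightarrow>\<^sub>M F \<Otimes>\<^sub>M E"
    using F E by (intro measurable_Pair measurable_from_subalg[of M F] measurable_from_subalg[of M E]) auto
  define M1 where "M1 = restr_to_subalg M F"
  define M2 where "M2 = restr_to_subalg M E"
  interpret M1: prob_space M1 unfolding M1_def by (rule prob_space_restr_to_subalg[OF F prob_space_axioms])
  interpret M2: prob_space M2 unfolding M2_def by (rule prob_space_restr_to_subalg[OF E prob_space_axioms])
  interpret P: pair_prob_space M1 M2 ..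
  have sM1: "sets M1 = sets F" "space M1 = space M" and sM2: "sets M2 = sets E" "space M2 = space M"
    unfolding M1_def M2_def by (auto simp: sets_restr_to_subalg[OF F] sets_restr_to_subalg[OF E] space_restr_to_subalg)
  have prod: "M1 \<Otimes>\<^sub>M M2 = distr M (F \<Otimes>\<^sub>M E) (\<lambda>\<omega>. (\<omega>, \<omega>))"
  proof (rule pair_measure_eqI)
    show "sigma_finite_measure M1" "sigma_finite_measure M2" by unfold_locales
    show "sets (M1 \<Otimes>\<^sub>M M2) = sets (distr M (F \<Otimes>\<^sub>M E) (\<lambda>\<omega>. (\<omega>, \<omega>)))"
      by (simp add: sM1 sM2 cong: sets_pair_measure_cong)
    fix A B assume "A \<in> sets M1" "B \<in> sets M2"
    then have A: "A \<in> sets F" and B: "B \<in> sets E" by (auto simp: sM1 sM2)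
    have "(\<lambda>\<omega>. (\<omega>, \<omega>)) -` (A \<times> B) \<inter> space M = A \<inter> B"
      using sets.sets_into_space[OF A] sp by auto
    then have "emeasure (distr M (F \<Otimes>\<^sub>M E) (\<lambda>\<omega>. (\<omega>, \<omega>))) (A \<times> B) = emeasure M (A \<inter> B)"
      using A B by (subst emeasure_distr[OF diagE]) auto
    also have "\<dots> = emeasure M A * emeasure M B"
      using indep[OF A B] by (simp add: emeasure_eq_measure ennreal_mult')
    finally show "emeasure M1 A * emeasure M2 B = emeasure (distr M (F \<Otimes>\<^sub>M E) (\<lambda>\<omega>. (\<omega>, \<omega>))) (A \<times> B)"
      using A B by (simp add: M1_def M2_def emeasure_restr_to_subalg[OF F] emeasure_restr_to_subalg[OF E])
  qed
  have fub: "integrable M1 (\<lambda>x. prob (Pair x -` C))" "prob ((\<lambda>\<omega>. (\<omega>, \<omega>)) -` C \<inter> space M) = (\<integral>x. prob (Pair x -` C) \<partial>M1)"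
    "\<And>x. Pair x -` C \<in> sets E"
    if C: "C \<in> sets (F \<Otimes>\<^sub>M E)" for C
  proof -
    have C': "C \<in> sets (M1 \<Otimes>\<^sub>M M2)" using C by (simp add: sM1 sM2 cong: sets_pair_measure_cong)
    show sec: "Pair x -` C \<in> sets E" for x using sets_Pair1[OF C] .
    have eq: "emeasure M2 (Pair x -` C) = ennreal (prob (Pair x -` C))" for x
      using sec[of x] by (simp add: M2_def emeasure_restr_to_subalg[OF E] emeasure_eq_measure)
    have "(\<lambda>x. enn2real (emeasure M2 (Pair x -` C))) \<in> borel_measurable M1"
      using M2.measurable_emeasure_Pair[OF C'] by measurable
    then have meas: "(\<lambda>x. prob (Pair x -` C)) \<in> borel_measurable M1" by (simp add: eq)
    show i: "integrable M1 (\<lambda>x. prob (Pair x -` C))"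
      by (rule M1.integrable_bounded[OF meas, of 1]) simp
    have "ennreal (prob ((\<lambda>\<omega>. (\<omega>, \<omega>)) -` C \<inter> space M)) = emeasure (M1 \<Otimes>\<^sub>M M2) C"
      unfolding prod by (subst emeasure_distr[OF diagE C]) (simp add: emeasure_eq_measure)
    also have "\<dots> = (\<integral>\<^sup>+ x. ennreal (prob (Pair x -` C)) \<partial>M1)"
      by (simp add: M2.emeasure_pair_measure_alt[OF C'] eq)
    also have "\<dots> = ennreal (\<integral>x. prob (Pair x -` C) \<partial>M1)"
      by (rule nn_integral_eq_integral[OF i]) simp
    finally show "prob ((\<lambda>\<omega>. (\<omega>, \<omega>)) -` C \<inter> space M) = (\<integral>x. prob (Pair x -` C) \<partial>M1)"
      by (simp add: ennreal_inj)
  qed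
  \<comment> \<open>The preimage under the diagonal is the sigma-algebra generated by
    \<open>F\<close> and \<open>G\<close> together, in a form to which Fubini applies.\<close>
  define D where "D = vimage_algebra (space M) (\<lambda>\<omega>. (\<omega>, \<omega>)) (F \<Otimes>\<^sub>M G)"
  have Dset: "\<exists>C\<in>sets (F \<Otimes>\<^sub>M G). A = (\<lambda>\<omega>. (\<omega>, \<omega>)) -` C \<inter> space M" if "A \<in> sets D" for A
    using that unfolding D_def by (subst (asm) sets_vimage_algebra2) (auto simp: space_pair_measure sp)
  show ?thesis
    unfolding D_def[symmetric] decoupled_def
  proof (intro conjI ballI)
    show "subalgebra M D"
      unfolding subalgebra_def
    proof (intro conjI subsetI)
      show "space D = space M" by (simp add: D_def)
      fix A assume "A \<in> sets D"
      then show "A \<in> sets M" using Dset[of A] measurable_sets[OF diagE] GF by auto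
    qed
    show "subalgebra M H" by (rule sub)
    fix A B assume "A \<in> sets D" and B: "B \<in> sets H"
    then obtain C where C: "C \<in> sets (F \<Otimes>\<^sub>M G)" "A = (\<lambda>\<omega>. (\<omega>, \<omega>)) -` C \<inter> space M" using Dset by blast
    have CE: "C \<in> sets (F \<Otimes>\<^sub>M E)" using C(1) GF by auto
    have BE: "B \<in> sets E" using B HE by auto
    have "space M \<in> sets F" using sp by (metis sets.top)
    then have CB: "C \<inter> (space M \<times> B) \<in> sets (F \<Otimes>\<^sub>M E)" using CE BE by (intro sets.Int pair_measureI)
    have secG: "Pair x -` C \<in> sets G" for x using sets_Pair1[OF C(1)] .
    have AB: "A \<inter> B = (\<lambda>\<omega>. (\<omega>, \<omega>)) -` (C \<inter> (space M \<times> B)) \<inter> space M"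
      using C(2) by auto
    have pAB: "prob (A \<inter> B) = (\<integral>x. prob ((Pair x -` C) \<inter> B) \<partial>M1)"
      and iAB: "integrable M1 (\<lambda>x. prob ((Pair x -` C) \<inter> B))"
    proof -
      have eq: "Pair x -` (C \<inter> (space M \<times> B)) = (Pair x -` C) \<inter> B" if "x \<in> space M1" for x
        using that sM1 by auto
      show "prob (A \<inter> B) = (\<integral>x. prob ((Pair x -` C) \<inter> B) \<partial>M1)"
        unfolding AB fub(2)[OF CB] by (rule Bochner_Integration.integral_cong[OF refl]) (simp only: eq)
      show "integrable M1 (\<lambda>x. prob ((Pair x -` C) \<inter> B))"
        using fub(1)[OF CB] by (rule iffD1[OF Bochner_Integration.integrable_cong[OF refl], rotated]) (simp only: eq)
    qed
    \<comment> \<open>For each fixed first coordinate the section of \<open>C\<close> is an event of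
      \<open>G\<close>, so the integrand is bounded by \<open>a\<close> pointwise.\<close>
    have "prob (A \<inter> B) - prob A * prob B = (\<integral>x. prob ((Pair x -` C) \<inter> B) - prob (Pair x -` C) * prob B \<partial>M1)"
      unfolding pAB unfolding C(2) fub(2)[OF CE] using iAB fub(1)[OF CE] by simp
    also have "norm \<dots> \<le> a"
      by (rule M1.norm_expectation_le) (use decoupledD(3)[OF d secG B] decoupled_nonneg[OF d] in auto)
    finally show "\<bar>prob (A \<inter> B) - prob A * prob B\<bar> \<le> a" by simp
  qed
qed

section \<open>Mixing coefficients as suprema\<close>

lemma abs_covariance_prob_le_1: "\<bar>prob (G \<inter> H) - prob G * prob H\<bar> \<le> 1"
proof -
  have "prob G * prob H \<le> 1" by (intro mult_le_one) auto
  moreover have "0 \<le> prob G * prob H" by simp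
  moreover have "0 \<le> prob (G \<inter> H)" "prob (G \<inter> H) \<le> 1" by auto
  ultimately show ?thesis by linarith
qed

lemma alpha_coeff_upper:
  assumes "G \<in> \<G>" "H \<in> \<H>"
  shows "\<bar>prob (G \<inter> H) - prob G * prob H\<bar> \<le> alpha_coeff M \<G> \<H>"
proof -
  have "bdd_above ((\<lambda>(G, H). \<bar>prob (G \<inter> H) - prob G * prob H\<bar>) ` (\<G> \<times> \<H>))"
    using abs_covariance_prob_le_1 by (intro bdd_aboveI2[where M=1]) auto
  from cSUP_upper[OF _ this, of "(G, H)"] show ?thesis using assms by (simp add: alpha_coeff_def)
qed

lemma alpha_coeff_le_1:
  assumes "\<G> \<noteq> {}" "\<H> \<noteq> {}"
  shows "alpha_coeff M \<G> \<H> \<le> 1"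
  unfolding alpha_coeff_def using abs_covariance_prob_le_1 assms by (intro cSUP_least) auto

lemma generated_events_nonempty: "generated_events M N W I \<noteq> {}"
  unfolding generated_events_def by (auto intro: sigma_sets.Empty)

lemma alpha_mixing_upper:
  "alpha_coeff M (generated_events M N W {0..j}) (generated_events M N W {j + n..}) \<le> alpha_mixing M N W n"
proof -
  have "bdd_above (range (\<lambda>j. alpha_coeff M (generated_events M N W {0..j}) (generated_events M N W {j + n..})))"
    using alpha_coeff_le_1[OF generated_events_nonempty generated_events_nonempty] by (intro bdd_aboveI2[where M=1]) auto
  then show ?thesis unfolding alpha_mixing_def by (rule cSUP_upper[rotated]) simp
qed

lemma alpha_mixing_le_1: "alpha_mixing M N W n \<le> 1"
  unfolding alpha_mixing_def
  by (intro cSUP_least alpha_coeff_le_1 generated_events_nonempty) simp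

lemma decoupled_alpha_mixing:
  assumes "\<And>k. W k \<in> M \<rightarrow>\<^sub>M N"
  shows "decoupled M (proc_algebra M N W {0..j}) (proc_algebra M N W {j + n..}) (alpha_mixing M N W n)"
  unfolding decoupled_def
  using assms
  by (auto intro!: subalgebra_proc_algebra order_trans[OF alpha_coeff_upper alpha_mixing_upper] simp: sets_proc_algebra)

end

section \<open>The iteration and its driving inputs\<close>

locale driven_iteration = prob_space M for M :: "'w measure" +
  fixes f :: "'x::polish_space \<Rightarrow> 'y::polish_space \<Rightarrow> real \<Rightarrow> 'x"
    and Y :: "nat \<Rightarrow> 'w \<Rightarrow> 'y" and \<epsilon> :: "nat \<Rightarrow> 'w \<Rightarrow> real" and X :: "nat \<Rightarrow> 'w \<Rightarrow> 'x" and x0 :: 'x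
  assumes f_meas: "(\<lambda>(x, y, u). f x y u) \<in> borel \<Otimes>\<^sub>M borel \<Otimes>\<^sub>M restrict_space borel {0..1} \<rightarrow>\<^sub>M borel"
    and Y_meas: "\<And>t. Y t \<in> M \<rightarrow>\<^sub>M borel"
    and eps_meas: "\<And>t. t \<ge> 1 \<Longrightarrow> \<epsilon> t \<in> M \<rightarrow>\<^sub>M restrict_space borel {0..1}"
    and X0_meas: "X 0 \<in> M \<rightarrow>\<^sub>M borel"
    and X_step: "\<And>t \<omega>. \<omega> \<in> space M \<Longrightarrow> X (Suc t) \<omega> = f (X t \<omega>) (Y t \<omega>) (\<epsilon> (Suc t) \<omega>)"
begin

definition input :: "nat \<Rightarrow> 'w \<Rightarrow> 'y \<times> real" where "input n \<omega> = (Y n \<omega>, \<epsilon> (Suc n) \<omega>)"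

abbreviation input_space :: "('y \<times> real) measure" where
  "input_space \<equiv> borel \<Otimes>\<^sub>M restrict_space borel {0..1}"

abbreviation frozen :: "nat \<Rightarrow> nat \<Rightarrow> 'w \<Rightarrow> 'x" where
  "frozen s \<equiv> iter_from f Y \<epsilon> s (\<lambda>_. x0)"

abbreviation \<alpha> :: "nat \<Rightarrow> real" where "\<alpha> \<equiv> alpha_mixing M input_space input"

abbreviation b :: "nat \<Rightarrow> real" where "b \<equiv> coupling_coeff M f Y \<epsilon> X x0"

lemma input_meas: "input n \<in> M \<rightarrow>\<^sub>M input_space"
  unfolding input_def[abs_def] using Y_meas[of n] eps_meas[of "Suc n"] by (intro measurable_Pair) auto

lemma step_meas:
  assumes "A \<in> F \<rightarrow>\<^sub>M borel" "g \<in> F \<rightarrow>\<^sub>M input_space"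
  shows "(\<lambda>\<omega>. f (A \<omega>) (fst (g \<omega>)) (snd (g \<omega>))) \<in> F \<rightarrow>\<^sub>M borel"
  using measurable_compose[OF measurable_Pair[OF assms] f_meas] by (simp add: case_prod_beta)

lemma X_meas: "X n \<in> M \<rightarrow>\<^sub>M borel"
proof (induction n)
  case (Suc n)
  have "(\<lambda>\<omega>. f (X n \<omega>) (fst (input n \<omega>)) (snd (input n \<omega>))) \<in> M \<rightarrow>\<^sub>M borel"
    by (rule step_meas[OF Suc input_meas])
  then show ?case by (rule measurable_cong[THEN iffD1, rotated]) (simp add: X_step input_def)
qed (rule X0_meas)

lemma frozen_meas:
  assumes "\<And>k. s \<le> k \<Longrightarrow> input k \<in> F \<rightarrow>\<^sub>M input_space"
  shows "frozen s n \<in> F \<rightarrow>\<^sub>M borel"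
proof (induction n)
  case (Suc n)
  show ?case
  proof (cases "Suc n \<le> s")
    case False
    then show ?thesis using step_meas[OF Suc assms[of n]] by (simp add: input_def)
  qed simp
qed simp

lemma iter_from_self:
  assumes "\<omega> \<in> space M" "s \<le> n"
  shows "iter_from f Y \<epsilon> s (X s) n \<omega> = X n \<omega>"
  using assms(2)
proof (induction n)
  case (Suc n)
  show ?case
  proof (cases "s = Suc n")
    case False
    then show ?thesis using Suc X_step[OF assms(1)] by simp
  qed simp
qed simp

lemma coupled_forever:
  assumes "\<omega> \<in> space M" "s \<le> l" "l \<le> n" "X l \<omega> = frozen s l \<omega>"
  shows "X n \<omega> = frozen s n \<omega>"
  using assms(3)
proof (induction n)
  case (Suc n)
  show ?case
  proof (cases "l = Suc n")
    case False
    then have "l \<le> n" using Suc by simp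
    then show ?thesis using Suc X_step[OF assms(1), of n] assms(2) by simp
  qed (use assms(4) in simp)
qed (use assms(4) in simp)

definition uncoupled :: "nat \<Rightarrow> nat \<Rightarrow> 'w set" where
  "uncoupled s l = {\<omega>\<in>space M. X l \<omega> \<noteq> frozen s l \<omega>}"

lemma uncoupled_sets: "uncoupled s l \<in> sets M"
proof -
  have "uncoupled s l = space M - {\<omega>\<in>space M. X l \<omega> = frozen s l \<omega>}" by (auto simp: uncoupled_def)
  moreover have "frozen s l \<in> M \<rightarrow>\<^sub>M borel" by (rule frozen_meas) (rule input_meas)
  ultimately show ?thesis using X_meas[of l] by (simp add: measurable_equality_set)
qed

lemma uncoupled_prob_le: "prob (uncoupled s (s + m)) \<le> b m"
proof -
  have "prob (uncoupled s (s + m)) = prob {\<omega>\<in>space M. iter_from f Y \<epsilon> s (X s) (s + m) \<omega> \<noteq> frozen s (s + m) \<omega>}"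
    unfolding uncoupled_def by (rule arg_cong[where f=prob]) (auto simp: iter_from_self)
  also have "\<dots> \<le> b m"
    unfolding coupling_coeff_def by (rule cSUP_upper) (auto intro!: bdd_aboveI2[where M=1])
  finally show ?thesis .
qed

lemma b_nonneg: "0 \<le> b m"
  using uncoupled_prob_le[of 0 m] measure_nonneg[of M "uncoupled 0 (0 + m)"] by linarith

lemma b_le_1: "b m \<le> 1"
  unfolding coupling_coeff_def by (intro cSUP_least) auto

lemma \<alpha>_nonneg: "0 \<le> \<alpha> n"
  using decoupled_nonneg[OF decoupled_alpha_mixing[OF input_meas, where j=0 and n=n]] .

text \<open>The iteration with the sample point of the initial state separated from that of the
  inputs. In this form the past is measurable for a product of sigma-algebras, one for
  \<open>X 0\<close> and one for the inputs; on the diagonal it is \<open>X\<close> itself.\<close>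

fun replay :: "nat \<Rightarrow> 'w \<times> 'w \<Rightarrow> 'x" where
  "replay 0 (\<omega>1, \<omega>2) = X 0 \<omega>1"
| "replay (Suc n) (\<omega>1, \<omega>2) = f (replay n (\<omega>1, \<omega>2)) (Y n \<omega>2) (\<epsilon> (Suc n) \<omega>2)"

lemma replay_diag: "\<omega> \<in> space M \<Longrightarrow> replay n (\<omega>, \<omega>) = X n \<omega>"
  by (induction n) (auto simp: X_step)

lemma decoupled_state:
  assumes indep: "indep_set (sets (vimage_algebra (space M) (X 0) borel)) (generated_events M input_space input UNIV)"
  shows "decoupled M (proc_algebra M borel X {0..j}) (proc_algebra M borel X {j + n..}) (\<alpha> (n div 2) + 2 * b (n div 2))"
proof -
  define F where "F = vimage_algebra (space M) (X 0) borel"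
  define E where "E = proc_algebra M input_space input UNIV"
  define G where "G = proc_algebra M input_space input {0..j}"
  define m where "m = n div 2"
  \<comment> \<open>The gap \<open>n\<close> is shared out: from \<open>j\<close> to
    \<open>s\<close> at least \<open>m\<close> steps for the inputs to mix, from \<open>s\<close> to
    \<open>j + n\<close> exactly \<open>m\<close> steps to couple. For odd \<open>n\<close> the
    mixing part gets the extra step.\<close>
  define s where "s = j + n - m"
  have s: "s + m = j + n" "j + m \<le> s" by (auto simp: s_def m_def)
  define H where "H = proc_algebra M input_space input {s..}"
  define D where "D = vimage_algebra (space M) (\<lambda>\<omega>. (\<omega>, \<omega>)) (F \<Otimes>\<^sub>M G)"
  have alg_sub: "sets (proc_algebra M input_space input I) \<subseteq> sets (proc_algebra M input_space input J)" if "I \<subseteq> J" for I J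
    by (rule sets_proc_algebra_subset)
       (use that measurable_space[OF input_meas] in \<open>auto intro!: measurable_proc_algebra\<close>)
  have inp: "input k \<in> proc_algebra M input_space input I \<rightarrow>\<^sub>M input_space" if "k \<in> I" for k I
    using that measurable_space[OF input_meas] by (intro measurable_proc_algebra) auto
  have Fsub: "subalgebra M F"
    using X0_meas measurable_sets[OF X0_meas] unfolding F_def subalgebra_def
    by (auto simp: sets_vimage_algebra2)
  have X0F: "X 0 \<in> F \<rightarrow>\<^sub>M borel" unfolding F_def by (rule measurable_vimage_algebra1) simp
  have dGH: "decoupled M G H (\<alpha> m)"
    unfolding G_def H_def
  proof (rule decoupled_mono[OF decoupled_alpha_mixing[OF input_meas, where j=j and n=m]])
    show "sets (proc_algebra M input_space input {s..}) \<subseteq> sets (proc_algebra M input_space input {j + m..})"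
      by (rule alg_sub) (use s in auto)
  qed simp_all
  have dDH: "decoupled M D H (\<alpha> m)"
    unfolding D_def
  proof (rule decoupled_adjoin_independent[OF Fsub _ _ dGH])
    show "subalgebra M E" unfolding E_def by (rule subalgebra_proc_algebra) (rule input_meas)
    show "sets G \<subseteq> sets E" "sets H \<subseteq> sets E" unfolding G_def H_def E_def by (intro alg_sub; simp)+
    show "prob (A \<inter> B) = prob A * prob B" if "A \<in> sets F" "B \<in> sets E" for A B
      using indep_setD[OF indep, of A B] that by (simp add: F_def E_def sets_proc_algebra)
  qed
  have replay_meas: "k \<le> j \<Longrightarrow> replay k \<in> F \<Otimes>\<^sub>M G \<rightarrow>\<^sub>M borel" for k
  proof (induction k)
    case 0
    have "(\<lambda>p. X 0 (fst p)) \<in> F \<Otimes>\<^sub>M G \<rightarrow>\<^sub>M borel" using measurable_compose[OF measurable_fst X0F] .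
    moreover have "replay 0 = (\<lambda>p. X 0 (fst p))" by (auto simp: fun_eq_iff)
    ultimately show ?case by simp
  next
    case (Suc k)
    have "(\<lambda>p. input k (snd p)) \<in> F \<Otimes>\<^sub>M G \<rightarrow>\<^sub>M input_space"
      using measurable_compose[OF measurable_snd inp[of k "{0..j}"]] Suc by (simp add: G_def)
    then have "(\<lambda>p. f (replay k p) (fst (input k (snd p))) (snd (input k (snd p)))) \<in> F \<Otimes>\<^sub>M G \<rightarrow>\<^sub>M borel"
      using Suc by (intro step_meas) auto
    moreover have "replay (Suc k) = (\<lambda>p. f (replay k p) (fst (input k (snd p))) (snd (input k (snd p))))"
      by (auto simp: fun_eq_iff input_def)
    ultimately show ?case by simp
  qed
  have diag: "(\<lambda>\<omega>. (\<omega>, \<omega>)) \<in> D \<rightarrow>\<^sub>M F \<Otimes>\<^sub>M G"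
    unfolding D_def by (rule measurable_vimage_algebra1) (auto simp: space_pair_measure F_def G_def)
  have past: "sets (proc_algebra M borel X {0..j}) \<subseteq> sets D"
  proof (rule sets_proc_algebra_subset)
    show spD: "space D = space M" by (simp add: D_def)
    fix k assume "k \<in> {0..j}"
    then have "(\<lambda>\<omega>. replay k (\<omega>, \<omega>)) \<in> D \<rightarrow>\<^sub>M borel"
      using measurable_compose[OF diag replay_meas[of k]] by simp
    then show "X k \<in> D \<rightarrow>\<^sub>M borel"
      by (rule measurable_cong[THEN iffD1, rotated]) (simp add: spD replay_diag)
  qed
  have fut: "sets (proc_algebra M borel (frozen s) {j + n..}) \<subseteq> sets H"
    unfolding H_def by (rule sets_proc_algebra_subset) (auto intro!: frozen_meas inp)
  have d0: "decoupled M (proc_algebra M borel X {0..j}) (proc_algebra M borel (frozen s) {j + n..}) (\<alpha> m)"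
    by (rule decoupled_mono[OF dDH past fut]) auto
  show ?thesis
    unfolding m_def[symmetric]
  proof (rule decoupled_approx[OF d0])
    show "subalgebra M (proc_algebra M borel X {j + n..})" by (rule subalgebra_proc_algebra) (rule X_meas)
    show "uncoupled s (s + m) \<in> sets M" by (rule uncoupled_sets)
    show "prob (uncoupled s (s + m)) \<le> b m" by (rule uncoupled_prob_le)
    show "\<exists>A'\<in>sets (proc_algebra M borel (frozen s) {j + n..}). A - uncoupled s (s + m) = A' - uncoupled s (s + m)"
      if "A \<in> sets (proc_algebra M borel X {j + n..})" for A
    proof (rule proc_algebra_agree[OF _ that])
      fix k \<omega> assume "k \<in> {j + n..}" "\<omega> \<in> space M - uncoupled s (s + m)"
      then show "X k \<omega> = frozen s k \<omega>"
        using s by (intro coupled_forever[of \<omega> s "s + m" k]) (auto simp: uncoupled_def)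
    qed
  qed
qed

lemma mixing_observable:
  assumes indep: "indep_set (sets (vimage_algebra (space M) (X 0) borel)) (generated_events M input_space input UNIV)"
    and \<Phi>: "\<Phi> \<in> borel_measurable borel"
  shows "mixing M (\<lambda>n \<omega>. \<Phi> (X n \<omega>)) (\<lambda>n. \<alpha> (n div 2) + 2 * b (n div 2))"
proof unfold_locales
  show "(\<lambda>\<omega>. \<Phi> (X k \<omega>)) \<in> borel_measurable M" for k using measurable_compose[OF X_meas \<Phi>] .
  have "sets (proc_algebra M borel (\<lambda>n \<omega>. \<Phi> (X n \<omega>)) I) \<subseteq> sets (proc_algebra M borel X I)" for I
    by (rule sets_proc_algebra_subset) (auto intro!: measurable_compose[OF measurable_proc_algebra \<Phi>])
  then show "decoupled M (proc_algebra M borel (\<lambda>n \<omega>. \<Phi> (X n \<omega>)) {0..j})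
      (proc_algebra M borel (\<lambda>n \<omega>. \<Phi> (X n \<omega>)) {j + n..}) (\<alpha> (n div 2) + 2 * b (n div 2))" for j n
    by (intro decoupled_mono[OF decoupled_state[OF indep, of j n]]) auto
qed

end

section \<open>Translation of the rate and moment hypotheses\<close>

lemma filterlim_div_2: "filterlim (\<lambda>n::nat. n div 2) at_top sequentially"
  unfolding filterlim_at_top
proof
  fix k :: nat
  show "eventually (\<lambda>n. k \<le> n div 2) sequentially"
    by (rule eventually_sequentiallyI[of "2 * k"]) linarith
qed

text \<open>Halving the index costs the constant \<open>4 powr \<theta>\<close>, since
  \<open>n + 1 \<le> 4 * (n div 2)\<close> for \<open>n \<ge> 2\<close>. For
  \<open>n \<le> 1\<close> the trivial bound 3 suffices, as \<open>(n + 1) / 4 \<le> 1\<close> makes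
  the power at least 1.\<close>

lemma power_rate_at_half:
  fixes e :: "nat \<Rightarrow> real"
  assumes e: "\<And>n. 1 \<le> n \<Longrightarrow> e n \<le> C * real n powr (-\<theta>)" "\<And>n. e n \<le> 3" and C: "0 \<le> C" and \<theta>: "0 < \<theta>"
  shows "e (n div 2) \<le> (C + 3) * 4 powr \<theta> * real (n + 1) powr (-\<theta>)"
proof -
  define q where "q = (real (n + 1) / 4) powr (-\<theta>)"
  have q: "q = 4 powr \<theta> * real (n + 1) powr (-\<theta>)"
    by (simp add: q_def powr_divide powr_minus field_simps)
  have q0: "0 \<le> q" by (simp add: q_def)
  have "e (n div 2) \<le> (C + 3) * q"
  proof (cases "2 \<le> n")
    case True
    then have n: "1 \<le> n div 2" "n + 1 \<le> 4 * (n div 2)" by presburger+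
    then have "real (n + 1) \<le> real (4 * (n div 2))" by (simp only: of_nat_le_iff)
    then have n2: "real (n + 1) / 4 \<le> real (n div 2)" by simp
    have "real (n div 2) powr (-\<theta>) \<le> q"
      unfolding q_def using n2 \<theta> by (intro powr_mono2') auto
    then have "e (n div 2) \<le> C * q" using e(1)[OF n(1)] C by (meson mult_left_mono order_trans)
    then show ?thesis using q0 by (simp add: distrib_right)
  next
    case False
    then have "real n \<le> 1" by simp
    then have n: "real (n + 1) / 4 \<le> 1" "0 < real (n + 1) / 4" by simp_all
    have "1 powr (-\<theta>) \<le> q" unfolding q_def using n \<theta> by (intro powr_mono2') auto
    then have "3 \<le> 3 * q" by simp
    moreover have "0 \<le> C * q" using C q0 by simp
    ultimately show ?thesis using e(2)[of "n div 2"] by (simp add: distrib_right)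
  qed
  then show ?thesis by (simp add: q mult.assoc)
qed

text \<open>The weight makes \<open>u powr s\<close> at most \<open>D / k^2\<close>, and raising to
  the power \<open>1 / s\<close> turns this into the exponent \<open>2 / s\<close>.\<close>

lemma rate_of_weighted_bound:
  fixes u :: real
  assumes "(real k + 1)\<^sup>2 * u powr s \<le> D" "0 \<le> u" "0 < s" "1 \<le> k"
  shows "u \<le> D powr (1 / s) * real k powr (- (2 / s))"
proof -
  have D0: "0 \<le> D" using assms(1) by (rule order_trans[rotated]) simp
  have "(real k)\<^sup>2 * u powr s \<le> (real k + 1)\<^sup>2 * u powr s"
    by (intro mult_right_mono power_mono) auto
  then have "(real k)\<^sup>2 * u powr s \<le> D" using assms(1) by linarith
  then have le: "u powr s \<le> D * real k powr (- 2)"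
    using assms(4) by (simp add: powr_minus field_simps)
  have "u = (u powr s) powr (1 / s)" using assms by (simp add: powr_powr)
  also have "\<dots> \<le> (D * real k powr (- 2)) powr (1 / s)"
    using le assms by (intro powr_mono2) auto
  also have "\<dots> = D powr (1 / s) * real k powr (- (2 / s))"
    using D0 by (simp add: powr_mult powr_powr)
  finally show ?thesis .
qed

lemma std_normal_integral:
  fixes h :: "real \<Rightarrow> real"
  assumes [measurable]: "h \<in> borel_measurable borel"
  shows "(\<integral>x. h x \<partial>std_normal_distribution) = (\<integral>t. h t * (1 / sqrt (2 * pi) * exp (- t\<^sup>2 / 2)) \<partial>lborel)"
proof -
  have "(\<integral>x. h x \<partial>std_normal_distribution) = (\<integral>t. std_normal_density t *\<^sub>R h t \<partial>lborel)"
    by (rule integral_density) auto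
  then show ?thesis by (simp only: std_normal_density_def real_scaleR_def mult.commute)
qed

context prob_space
begin

lemma bounded_momentsD:
  assumes [measurable]: "\<And>k. V k \<in> borel_measurable M" and b: "bounded_moments M V p"
  obtains R where "\<And>k. integrable M (\<lambda>\<omega>. \<bar>V k \<omega>\<bar> powr p)" "\<And>k. (\<integral>\<omega>. \<bar>V k \<omega>\<bar> powr p \<partial>M) \<le> R"
proof -
  define B where "B = (SUP n. \<integral>\<^sup>+\<omega>. ennreal (\<bar>V n \<omega>\<bar> powr p) \<partial>M)"
  have B: "B < \<infinity>" using b by (simp add: bounded_moments_def B_def)
  have le: "(\<integral>\<^sup>+\<omega>. ennreal (\<bar>V k \<omega>\<bar> powr p) \<partial>M) \<le> B" for k
    unfolding B_def by (rule SUP_upper) simp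
  have i: "integrable M (\<lambda>\<omega>. \<bar>V k \<omega>\<bar> powr p)" for k
    using le[of k] B by (intro integrableI_bounded) (auto intro: le_less_trans)
  have "(\<integral>\<omega>. \<bar>V k \<omega>\<bar> powr p \<partial>M) \<le> enn2real B" for k
  proof -
    have "ennreal (\<integral>\<omega>. \<bar>V k \<omega>\<bar> powr p \<partial>M) \<le> B"
      using le[of k] by (subst nn_integral_eq_integral[symmetric, OF i]) auto
    also have "B = ennreal (enn2real B)" using B by simp
    finally show ?thesis by simp
  qed
  with i show thesis by (rule that)
qed

lemma moments_decrease:
  fixes V :: "nat \<Rightarrow> 'a \<Rightarrow> real"
  assumes [measurable]: "\<And>k. V k \<in> borel_measurable M"
    and i: "\<And>k. integrable M (\<lambda>\<omega>. \<bar>V k \<omega>\<bar> powr p)" and R: "\<And>k. (\<integral>\<omega>. \<bar>V k \<omega>\<bar> powr p \<partial>M) \<le> R"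
    and s: "0 < s" "s \<le> p"
  shows "integrable M (\<lambda>\<omega>. \<bar>V k \<omega>\<bar> powr s)" "(\<integral>\<omega>. \<bar>V k \<omega>\<bar> powr s \<partial>M) \<le> 1 + R"
proof -
  show i': "integrable M (\<lambda>\<omega>. \<bar>V k \<omega>\<bar> powr s)"
    by (rule moment_integrable[OF _ i s]) simp
  have "(\<integral>\<omega>. \<bar>V k \<omega>\<bar> powr s \<partial>M) \<le> (\<integral>\<omega>. 1 + \<bar>V k \<omega>\<bar> powr p \<partial>M)"
    using i s by (intro integral_mono i' powr_le_one_plus_powr) auto
  also have "\<dots> \<le> 1 + R" using i R by (simp add: prob_space)
  finally show "(\<integral>\<omega>. \<bar>V k \<omega>\<bar> powr s \<partial>M) \<le> 1 + R" .
qed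

end

theorem theorem1p5:
  fixes M :: "'w measure"
    and f :: "'x::polish_space \<Rightarrow> 'y::polish_space \<Rightarrow> real \<Rightarrow> 'x"
    and Y :: "nat \<Rightarrow> 'w \<Rightarrow> 'y"
    and \<epsilon> :: "nat \<Rightarrow> 'w \<Rightarrow> real"
    and X :: "nat \<Rightarrow> 'w \<Rightarrow> 'x"
    and x0 :: 'x
    and \<Phi> :: "'x \<Rightarrow> real"
    and Yt :: "nat \<Rightarrow> 'w \<Rightarrow> 'y \<times> real"
    and \<alpha> b :: "nat \<Rightarrow> real"
    and S :: "nat \<Rightarrow> 'w \<Rightarrow> real"
  defines "Yt \<equiv> \<lambda>n \<omega>. (Y n \<omega>, \<epsilon> (Suc n) \<omega>)"
    and "\<alpha> \<equiv> alpha_mixing M (borel \<Otimes>\<^sub>M restrict_space borel {0..1}) Yt"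
    and "b \<equiv> coupling_coeff M f Y \<epsilon> X x0"
    and "S \<equiv> centered_sum M (\<lambda>n \<omega>. \<Phi> (X n \<omega>))"
  assumes prob: "prob_space M"
    and f_meas: "(\<lambda>(x, y, u). f x y u) \<in> borel \<Otimes>\<^sub>M borel \<Otimes>\<^sub>M restrict_space borel {0..1} \<rightarrow>\<^sub>M borel"
    and Y_meas: "\<And>t. Y t \<in> M \<rightarrow>\<^sub>M borel"
    and eps_meas: "\<And>t. t \<ge> 1 \<Longrightarrow> \<epsilon> t \<in> M \<rightarrow>\<^sub>M restrict_space borel {0..1}"
    and X0_meas: "X 0 \<in> M \<rightarrow>\<^sub>M borel"
    and X0_indep: "prob_space.indep_set M (sets (vimage_algebra (space M) (X 0) borel))
        (generated_events M (borel \<Otimes>\<^sub>M restrict_space borel {0..1}) Yt UNIV)"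
    and X_step: "\<And>t \<omega>. \<omega> \<in> space M \<Longrightarrow> X (Suc t) \<omega> = f (X t \<omega>) (Y t \<omega>) (\<epsilon> (Suc t) \<omega>)"
    and coupling: "b \<longlonglongrightarrow> 0"
    and Phi_meas: "\<Phi> \<in> borel_measurable borel"
    and Phi_integrable: "\<And>n. integrable M (\<lambda>\<omega>. \<Phi> (X n \<omega>))"
  shows
    "(\<forall>p>1. strongly_mixing M (borel \<Otimes>\<^sub>M restrict_space borel {0..1}) Yt \<longrightarrow>
          bounded_moments M (\<lambda>n \<omega>. \<Phi> (X n \<omega>)) p \<longrightarrow>
          (\<lambda>n. \<integral>\<omega>. \<bar>S n \<omega> / real n\<bar> \<partial>M) \<longlonglongrightarrow> 0) \<and>
     (\<forall>c r p. c > 0 \<longrightarrow> r > 2 \<longrightarrow>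
          (\<forall>n\<ge>1. \<alpha> n + b n \<le> c * real n powr (- (r / (r - 2)))) \<longrightarrow>
          r / 2 < p \<longrightarrow> p \<le> r \<longrightarrow>
          bounded_moments M (\<lambda>n \<omega>. \<Phi> (X n \<omega>)) p \<longrightarrow>
          (AE \<omega> in M. (\<lambda>n. S n \<omega> / real n) \<longlonglongrightarrow> 0)) \<and>
     (\<forall>r>2. bounded_moments M (\<lambda>n \<omega>. \<Phi> (X n \<omega>)) r \<longrightarrow>
          summable (\<lambda>k. (real k + 1)\<^sup>2 *
             (\<alpha> k powr ((r - 2) / (r + 2)) + b k powr ((r - 2) / (r + 2)))) \<longrightarrow>
          (\<forall>g :: real \<Rightarrow> real. continuous_on UNIV g \<longrightarrow> bounded (range g) \<longrightarrow>
             (\<lambda>n. (\<integral>\<omega>. g (real n powr (-1/2) * S n \<omega>) \<partial>M) -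
                  (\<integral>t. g (sqrt (prob_space.variance M (\<lambda>\<omega>. real n powr (-1/2) * S n \<omega>)) * t) *
                       (1 / sqrt (2 * pi) * exp (- t\<^sup>2 / 2)) \<partial>lborel)) \<longlonglongrightarrow> 0) \<and>
          (\<exists>\<sigma>>0. \<forall>a>0.
             limsup (\<lambda>n. ereal (measure M {\<omega> \<in> space M. real n powr (-1/2) * \<bar>S n \<omega>\<bar> \<ge> a}))
               \<le> ereal (\<integral>t. indicator (- {-a..a}) (\<sigma> * t) *
                       (1 / sqrt (2 * pi) * exp (- t\<^sup>2 / 2)) \<partial>lborel)))"
proof -
  interpret D: driven_iteration M f Y \<epsilon> X x0
    using prob f_meas Y_meas eps_meas X0_meas X_step
    by (simp add: driven_iteration_def driven_iteration_axioms_def)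
  have Yt: "Yt = D.input" by (simp add: fun_eq_iff Yt_def D.input_def)
  have \<alpha>: "\<alpha> = D.\<alpha>" by (simp add: \<alpha>_def Yt)
  have b: "b = D.b" by (simp add: b_def)
  have ab: "0 \<le> \<alpha> n" "\<alpha> n \<le> 1" "0 \<le> b n" "b n \<le> 1" for n
    unfolding \<alpha> b using D.\<alpha>_nonneg D.alpha_mixing_le_1 D.b_nonneg D.b_le_1 by auto
  define V where "V n \<omega> = \<Phi> (X n \<omega>)" for n \<omega>
  have V: "(\<lambda>n \<omega>. \<Phi> (X n \<omega>)) = V" by (simp add: fun_eq_iff V_def)
  have S: "S = centered_sum M V" by (simp add: S_def V)
  have mix: "mixing M V (\<lambda>n. \<alpha> (n div 2) + 2 * b (n div 2))"
    using D.mixing_observable[OF X0_indep[unfolded Yt] Phi_meas] unfolding V \<alpha> b .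
  have Vm[measurable]: "V k \<in> borel_measurable M" for k using mixing.V_meas[OF mix] .
  have Vi: "integrable M (V k)" for k using Phi_integrable[of k] by (simp add: V_def[abs_def])
  \<comment> \<open>Brings the halved index into the shifted form
    \<open>real (k + 1) powr (-\<theta>)\<close>, which is also meaningful at \<open>k = 0\<close>;
    the 3 bounds \<open>\<alpha> n + 2 * b n\<close>, since both coefficients are at most 1.\<close>
  have decay: "mixing M V (\<lambda>k. ((C + 3) * 4 powr \<theta>) * real (k + 1) powr (-\<theta>))"
    if "0 \<le> C" "0 < \<theta>" "\<And>n. 1 \<le> n \<Longrightarrow> \<alpha> n + 2 * b n \<le> C * real n powr (-\<theta>)" for C \<theta>
  proof (rule mixing_rate_mono[OF mix])
    fix n
    have "\<alpha> n + 2 * b n \<le> 3" for n using ab(2,4)[of n] by linarith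
    then show "\<alpha> (n div 2) + 2 * b (n div 2) \<le> (C + 3) * 4 powr \<theta> * real (n + 1) powr (-\<theta>)"
      using that by (intro power_rate_at_half[where e="\<lambda>n. \<alpha> n + 2 * b n"])
  qed
  have A: "(\<lambda>n. \<integral>\<omega>. \<bar>S n \<omega> / real n\<bar> \<partial>M) \<longlonglongrightarrow> 0"
    if p: "1 < p" and sm: "strongly_mixing M (borel \<Otimes>\<^sub>M restrict_space borel {0..1}) Yt"
      and bm: "bounded_moments M V p" for p
  proof -
    obtain R where R: "\<And>k. integrable M (\<lambda>\<omega>. \<bar>V k \<omega>\<bar> powr p)" "\<And>k. (\<integral>\<omega>. \<bar>V k \<omega>\<bar> powr p \<partial>M) \<le> R"
      using D.bounded_momentsD[OF Vm bm] by blast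
    have "\<alpha> \<longlonglongrightarrow> 0" using sm by (simp add: strongly_mixing_def \<alpha>_def)
    then have "(\<lambda>n. \<alpha> (n div 2) + 2 * b (n div 2)) \<longlonglongrightarrow> 0 + 2 * 0"
      by (intro tendsto_intros filterlim_compose[OF _ filterlim_div_2] coupling)
    then show ?thesis
      unfolding S by (intro mixing.L1_law_of_large_numbers[OF mix _ p Vi R]) simp
  qed
  have B: "AE \<omega> in M. (\<lambda>n. S n \<omega> / real n) \<longlonglongrightarrow> 0"
    if c: "0 < c" and r: "2 < r" and rate: "\<forall>n\<ge>1. \<alpha> n + b n \<le> c * real n powr (- (r / (r - 2)))"
      and p: "r / 2 < p" and bm: "bounded_moments M V p" for c r p
  proof -
    \<comment> \<open>The locale \<open>power_mixing\<close> works with moments of order at most 2,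
      so a higher moment is lowered to the second one.\<close>
    define q where "q = min p 2"
    have q: "1 < q" "q \<le> 2" "q \<le> p" using p r by (auto simp: q_def)
    define \<theta> where "\<theta> = r / (r - 2)"
    have \<theta>: "1 < \<theta>" using r by (simp add: \<theta>_def)
    have q\<theta>: "1 / \<theta> < 2 - 2 / q"
    proof -
      have eq: "1 / \<theta> = 1 - 2 / r" using r by (simp add: \<theta>_def diff_divide_distrib)
      \<comment> \<open>For \<open>p \<le> 2\<close>, the assumptions \<open>p > r / 2\<close> and
        \<open>r > 2\<close> give \<open>2 / p < 4 / r \<le> 1 + 2 / r\<close>; otherwise
        \<open>q = 2\<close> and the left side is 1.\<close>
      have "2 / q < 1 + 2 / r"
      proof (cases "p \<le> 2")
        case True
        have "2 / p < 2 / (r / 2)" using p r by (intro divide_strict_left_mono) auto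
        also have "\<dots> \<le> 1 + 2 / r" using r by (simp add: field_simps)
        finally show ?thesis using True by (simp add: q_def min_def)
      next
        case False
        then show ?thesis using r by (simp add: q_def)
      qed
      then show ?thesis unfolding eq by linarith
    qed
    obtain R where R: "\<And>k. integrable M (\<lambda>\<omega>. \<bar>V k \<omega>\<bar> powr p)" "\<And>k. (\<integral>\<omega>. \<bar>V k \<omega>\<bar> powr p \<partial>M) \<le> R"
      using D.bounded_momentsD[OF Vm bm] by blast
    have Rq: "integrable M (\<lambda>\<omega>. \<bar>V k \<omega>\<bar> powr q)" "(\<integral>\<omega>. \<bar>V k \<omega>\<bar> powr q \<partial>M) \<le> 1 + R" for k
      by (rule D.moments_decrease[OF Vm R]; use q in simp)+
    have "\<alpha> n + 2 * b n \<le> 2 * c * real n powr (-\<theta>)" if "1 \<le> n" for n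
    proof -
      have "\<alpha> n + b n \<le> c * real n powr (-\<theta>)" using rate that by (simp add: \<theta>_def)
      then show ?thesis using ab(1)[of n] by linarith
    qed
    then interpret P: mixing M V "\<lambda>k. ((2 * c + 3) * 4 powr \<theta>) * real (k + 1) powr (-\<theta>)"
      using c \<theta> by (intro decay) auto
    interpret P: power_mixing M V "(2 * c + 3) * 4 powr \<theta>" \<theta> q "1 + R"
      by unfold_locales (use \<theta> q q\<theta> Rq Vi in auto)
    show ?thesis unfolding S by (rule P.strong_law_of_large_numbers)
  qed
  have C: "(\<forall>g :: real \<Rightarrow> real. continuous_on UNIV g \<longrightarrow> bounded (range g) \<longrightarrow>
             (\<lambda>n. (\<integral>\<omega>. g (real n powr (-1/2) * S n \<omega>) \<partial>M) -
                  (\<integral>t. g (sqrt (prob_space.variance M (\<lambda>\<omega>. real n powr (-1/2) * S n \<omega>)) * t) *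
                       (1 / sqrt (2 * pi) * exp (- t\<^sup>2 / 2)) \<partial>lborel)) \<longlonglongrightarrow> 0) \<and>
          (\<exists>\<sigma>>0. \<forall>a>0.
             limsup (\<lambda>n. ereal (measure M {\<omega> \<in> space M. real n powr (-1/2) * \<bar>S n \<omega>\<bar> \<ge> a}))
               \<le> ereal (\<integral>t. indicator (- {-a..a}) (\<sigma> * t) *
                       (1 / sqrt (2 * pi) * exp (- t\<^sup>2 / 2)) \<partial>lborel))"
    if r: "2 < r" and bm: "bounded_moments M V r"
      and sm: "summable (\<lambda>k. (real k + 1)\<^sup>2 *
             (\<alpha> k powr ((r - 2) / (r + 2)) + b k powr ((r - 2) / (r + 2))))" for r
  proof -
    obtain R where R: "\<And>k. integrable M (\<lambda>\<omega>. \<bar>V k \<omega>\<bar> powr r)" "\<And>k. (\<integral>\<omega>. \<bar>V k \<omega>\<bar> powr r \<partial>M) \<le> R"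
      using D.bounded_momentsD[OF Vm bm] by blast
    define s where "s = (r - 2) / (r + 2)"
    have s: "0 < s" using r by (simp add: s_def)
    \<comment> \<open>A common bound on the terms of the series is turned into a power rate with
      exponent \<open>2 / s\<close>.\<close>
    obtain E where E: "\<And>k. norm ((real k + 1)\<^sup>2 * (\<alpha> k powr s + b k powr s)) \<le> E"
      using summable_imp_Bseq[OF sm] unfolding s_def[symmetric] Bseq_def by blast
    define C where "C = 3 * E powr (1 / s)"
    have C0: "0 \<le> C" by (simp add: C_def)
    have rate: "\<alpha> n + 2 * b n \<le> C * real n powr (- (2 / s))" if n: "1 \<le> n" for n
    proof -
      have le: "(real n + 1)\<^sup>2 * (\<alpha> n powr s + b n powr s) \<le> E"
        using E[of n] unfolding real_norm_def by (rule order_trans[OF abs_ge_self])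
      have "(real n + 1)\<^sup>2 * \<alpha> n powr s \<le> (real n + 1)\<^sup>2 * (\<alpha> n powr s + b n powr s)"
        "(real n + 1)\<^sup>2 * b n powr s \<le> (real n + 1)\<^sup>2 * (\<alpha> n powr s + b n powr s)"
        by (intro mult_left_mono; simp)+
      then have "(real n + 1)\<^sup>2 * \<alpha> n powr s \<le> E" "(real n + 1)\<^sup>2 * b n powr s \<le> E"
        using le by (blast intro: order_trans)+
      then have "\<alpha> n \<le> E powr (1 / s) * real n powr (- (2 / s))" "b n \<le> E powr (1 / s) * real n powr (- (2 / s))"
        using ab s n by (auto intro!: rate_of_weighted_bound)
      then show ?thesis by (simp add: C_def)
    qed
    interpret P: mixing M V "\<lambda>k. ((C + 3) * 4 powr (2 / s)) * real (k + 1) powr (- (2 / s))"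
      using C0 s rate by (intro decay) auto
    interpret P: moment_mixing M V "(C + 3) * 4 powr (2 / s)" "2 / s" r R
    proof unfold_locales
      \<comment> \<open>The factor \<open>r - 2\<close> cancels and leaves \<open>2 + 4 / r\<close>,
        so the weight and the power in the summability condition together exceed the threshold 2 of
        \<open>moment_mixing\<close>.\<close>
      have "2 / s * (1 - 2 / r) = 2 * (r + 2) / r"
        using r by (simp add: s_def field_simps)
      also have "2 < \<dots>" using r by (simp add: field_simps)
      finally show "2 < 2 / s * (1 - 2 / r)" .
    qed (use r R in auto)
    define Z where "Z n \<omega> = centered_sum M V n \<omega> / sqrt (real n)" for n \<omega>
    define v where "v n = (\<integral>\<omega>. (Z n \<omega>)\<^sup>2 \<partial>M)" for n
    have Zm[measurable]: "Z n \<in> borel_measurable M" for n unfolding Z_def[abs_def] by measurable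
    \<comment> \<open>This also holds at \<open>n = 0\<close>, where both sides are 0 by
      convention.\<close>
    have root: "real n powr (-1/2) = 1 / sqrt (real n)" for n
    proof -
      have "(-1/2 :: real) = - (1/2)" by simp
      then show ?thesis by (simp only: powr_minus powr_half_sqrt of_nat_0_le_iff inverse_eq_divide)
    qed
    have ZS: "real n powr (-1/2) * S n \<omega> = Z n \<omega>" for n \<omega>
      unfolding root by (simp add: S Z_def)
    have ZSabs: "real n powr (-1/2) * \<bar>S n \<omega>\<bar> = \<bar>Z n \<omega>\<bar>" for n \<omega>
      unfolding root by (simp add: S Z_def abs_divide)
    have EZ: "(\<integral>\<omega>. Z n \<omega> \<partial>M) = 0" for n
      using Vi by (simp add: Z_def centered_sum_def D.prob_space)
    have var: "prob_space.variance M (\<lambda>\<omega>. real n powr (-1/2) * S n \<omega>) = v n" for n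
      unfolding ZS EZ v_def by simp
    obtain B where B: "0 \<le> B" "\<And>n. (\<integral>\<omega>. (centered_sum M V n \<omega>)\<^sup>2 \<partial>M) \<le> real n * B"
      using P.variance_linear_growth by auto
    have v0: "0 \<le> v n" for n by (simp add: v_def)
    \<comment> \<open>The added 1 keeps the bound positive, so that \<open>2 * sqrt (B + 1)\<close>
      can serve as \<open>\<sigma>\<close> even when \<open>B = 0\<close>.\<close>
    have vB: "v n \<le> B + 1" for n
    proof -
      have "v n = (\<integral>\<omega>. (centered_sum M V n \<omega>)\<^sup>2 \<partial>M) / real n" by (simp add: v_def Z_def power_divide)
      also have "\<dots> \<le> real n * B / real n" using B(2) by (intro divide_right_mono) auto
      also have "\<dots> \<le> B" using B(1) by simp
      finally show ?thesis by simp
    qed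
    have char: "(\<lambda>n. (\<integral>\<omega>. iexp (t * Z n \<omega>) \<partial>M) - of_real (exp (- v n * t\<^sup>2 / 2))) \<longlonglongrightarrow> 0" for t
      unfolding v_def Z_def by (rule P.char_approx)
    show ?thesis
    proof (intro conjI allI impI)
      fix g :: "real \<Rightarrow> real" assume g: "continuous_on UNIV g" "bounded (range g)"
      obtain G where G: "\<And>x. \<bar>g x\<bar> \<le> G" using g(2) by (auto simp: bounded_iff)
      have [measurable]: "g \<in> borel_measurable borel" using g(1) by (rule borel_measurable_continuous_onI)
      have "(\<lambda>n. (\<integral>\<omega>. g (Z n \<omega>) \<partial>M) - (\<integral>x. g (sqrt (v n) * x) \<partial>std_normal_distribution)) \<longlonglongrightarrow> 0"
        by (rule D.weakly_approaching_normal[OF Zm v0 vB char g(1) G])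
      moreover have "(\<integral>x. g (sqrt (v n) * x) \<partial>std_normal_distribution)
          = (\<integral>t. g (sqrt (v n) * t) * (1 / sqrt (2 * pi) * exp (- t\<^sup>2 / 2)) \<partial>lborel)" for n
        by (rule std_normal_integral) measurable
      ultimately show "(\<lambda>n. (\<integral>\<omega>. g (real n powr (-1/2) * S n \<omega>) \<partial>M) -
                  (\<integral>t. g (sqrt (prob_space.variance M (\<lambda>\<omega>. real n powr (-1/2) * S n \<omega>)) * t) *
                       (1 / sqrt (2 * pi) * exp (- t\<^sup>2 / 2)) \<partial>lborel)) \<longlonglongrightarrow> 0"
        unfolding var unfolding ZS by simp
    next
      show "\<exists>\<sigma>>0. \<forall>a>0.
             limsup (\<lambda>n. ereal (measure M {\<omega> \<in> space M. real n powr (-1/2) * \<bar>S n \<omega>\<bar> \<ge> a}))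
               \<le> ereal (\<integral>t. indicator (- {-a..a}) (\<sigma> * t) *
                       (1 / sqrt (2 * pi) * exp (- t\<^sup>2 / 2)) \<partial>lborel)"
      proof (intro exI[of _ "2 * sqrt (B + 1)"] conjI allI impI)
        show "0 < 2 * sqrt (B + 1)" using B(1) by simp
        fix a :: real assume a: "0 < a"
        have "limsup (\<lambda>n. ereal (measure M {\<omega>\<in>space M. a \<le> \<bar>Z n \<omega>\<bar>}))
            \<le> ereal (\<integral>x. indicator (- {-a..a}) (2 * sqrt (B + 1) * x) \<partial>std_normal_distribution)"
          by (rule D.limsup_tail_le_normal[OF Zm v0 vB char a])
        also have "(\<integral>x. indicator (- {-a..a}) (2 * sqrt (B + 1) * x) \<partial>std_normal_distribution)
            = (\<integral>t. indicator (- {-a..a}) (2 * sqrt (B + 1) * t) * (1 / sqrt (2 * pi) * exp (- t\<^sup>2 / 2)) \<partial>lborel)"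
          by (rule std_normal_integral) measurable
        finally show "limsup (\<lambda>n. ereal (measure M {\<omega> \<in> space M. real n powr (-1/2) * \<bar>S n \<omega>\<bar> \<ge> a}))
               \<le> ereal (\<integral>t. indicator (- {-a..a}) (2 * sqrt (B + 1) * t) *
                       (1 / sqrt (2 * pi) * exp (- t\<^sup>2 / 2)) \<partial>lborel)"
          unfolding ZSabs .
      qed
    qed
  qed
  show ?thesis unfolding V using A B C by blast
qed

end
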